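(* Let $n$, $t$ and $x$ be rational integers with $n\geq3$ and $t\neq0$. Let $\beta_{1}=a+b\sqrt{t}$ with $a,b\in\mathbb{Q}$ and $b\neq0$, let $\beta_{2}=a-b\sqrt{t}$, and suppose that $\beta_1$ and $\beta_2$ are algebraic integers. Let $\gamma_{1}$ be an algebraic integer in $\mathbb{Q}(\sqrt{t})$ with $\gamma_{2}$ as its algebraic conjugate. Put $$U(x)=-\gamma_{2}(x-\beta_{2})^{n},\quad Z(x)=\gamma_{1}(x-\beta_{1})^{n},\quad W(x)=\frac{Z(x)}{U(x)},$$ $$\mathcal{A}(x)=\frac{\beta_{1}(x-\beta_{2})W(x)^{1/n}-\beta_{2}(x-\beta_{1})}{(x-\beta_{2})W(x)^{1/n}-(x-\beta_{1})},$$ and write $U(x)=(u_{1}+u_{2}\sqrt{t})/2$, where $u_{1},u_{2}\in\mathbb{Z}$ (so that, correspondingly, $Z(x)=(-u_1+u_2\sqrt{t})/2$). Put $$g_{1}=\gcd(u_{1},u_{2}),\qquad g_{2}=\gcd(u_{1}/g_{1},t),$$ $$g_{3}=\begin{cases}1&\text{if }t\equiv1\bmod4\text{ and }(u_{1}-u_{2})/g_{1}\equiv0\bmod2,\\2&\text{if }t\equiv3\bmod4\text{ and }(u_{1}-u_{2})/g_{1}\equiv0\bmod2,\\4&\text{otherwise,}\end{cases}$$ $$g_{4}=\gcd\left(\mathrm{core}(g_{2}g_{3}),\frac{\gcd(2,n)\,n}{\gcd(u_{1}/g_{1},\gcd(2,n)\,n)}\right),\qquad g=\frac{g_{1}\sqrt{g_{2}}}{\sqrt{g_{3}g_{4}}}.$$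 Let $d$ be the largest positive rational integer such that $u_{1}/(dg)$ is an algebraic integer, and let $\mathcal{C}_{n}$ and $\mathcal{D}_{n}$ be positive real numbers such that $$\max\left(1,\frac{\Gamma(1-1/n)\,r!}{\Gamma(r+1-1/n)},\frac{n\Gamma(r+1+1/n)}{\Gamma(1/n)\,r!}\right)\frac{D_{n,r}}{N_{d,n,r}}<\mathcal{C}_{n}\left(\frac{\mathcal{D}_{n}}{\mathcal{N}_{d,n}}\right)^{r}$$ holds for all non-negative integers $r$. Put $$E=\frac{|g|\mathcal{N}_{d,n}}{\mathcal{D}_{n}\min\left(\left|u_{2}\sqrt{t}\pm\sqrt{u_{2}^{2}t-u_{1}^{2}}\right|\right)},\qquad Q=\frac{\mathcal{D}_{n}\max\left(\left|u_{2}\sqrt{t}\pm\sqrt{u_{2}^{2}t-u_{1}^{2}}\right|\right)}{|g|\mathcal{N}_{d,n}},\qquad\kappa=\frac{\log Q}{\log E},$$ $$c=4\sqrt{|2t|}\left(|x-\beta_{1}|+|x-\beta_{2}|\right)\mathcal{C}_{n}Q\left(\max\left(1,\,5\sqrt{|2t|}\left|1-W(x)^{1/n}\right||x-\beta_{2}|\left|\mathcal{A}(x)-\beta_{1}\right|\mathcal{C}_{n}E\right)\right)^{\kappa},$$ where the minimum and maximum are over the two choices of the sign $\pm$. If $E>1$ and either $0<W(x)<1$ or $|W(x)|=1$ with $W(x)\neq-1$, then $$\left|\mathcal{A}(x)-\frac{p}{q}\right|>\frac{1}{c|q|^{\kappa+1}}$$ for all rational integers $p$ and $q$ with $q\ne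q0$.
   Context: For a complex number $w=se^{i\varphi}$ with $s\geq0$, $-\pi<\varphi\leq\pi$ (and $\varphi=0$ if $s=0$), $w^{1/n}$ denotes $s^{1/n}e^{i\varphi/n}$, where $s^{1/n}$ is the non-negative real $n$-th root; $\sqrt{w}=w^{1/2}$. For a positive integer $k$, $\mathrm{core}(k)$ is the unique squarefree divisor $k_1$ of $k$ such that $k/k_1$ is a perfect square. Conjugation means $\sqrt{t}\mapsto-\sqrt{t}$; if $t$ is a perfect square this is understood formally, i.e. $\gamma_1=a'+b'\sqrt{t}$, $\gamma_2=a'-b'\sqrt{t}$ for some chosen $a',b'\in\mathbb{Q}$, and $u_1=U(x)-Z(x)$, $u_2\sqrt{t}=U(x)+Z(x)$. For a positive integer $n\ge 2$ and a non-negative integer $r$, $X_{n,r}(x)={}_2F_1(-r,-r-1/n;1-1/n;x)$, a polynomial of degree $r$ with rational coefficients (${}_2F_1$ is the classical Gauss hypergeometric function). $D_{n,r}$ is the smallest positive integer such that $D_{n,r}X_{n,r}(x)$ has rational integer coefficients. For a positive integer $d$, $N_{d,n,r}$ is the greatest common divisor of the numerators (in lowest terms) of the coefficients of the polynomial $X_{n,r}(1-dx)$. With $v_p$ the $p$-adic valuation, $\mathcal{N}_{d,n}=\prod_{p\mid n}p^{\min(v_p(d),\,v_p(n)+1/(p-1))}$, the product over primes $p$ dividing $n$. It is understood that $U(x)\neq0$, $u_1\neq0$ (so that $d$ is defined) and that the denominator of $\mathcal{A}(x)$ is non-zero. *)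

theory Defs
  imports "HOL-Analysis.Analysis" "HOL-Computational_Algebra.Computational_Algebra"
begin

text \<open>
  Conventions. For complex \<open>w\<close>, the root \<open>w\<^sup>1\<^sup>/\<^sup>n\<close> is the principal value \<open>w powr (1 / of_nat n)\<close>, and
  \<open>csqrt\<close> is the principal square root; the first lemma spells out the polar form, including \<open>w = 0\<close>.
  For \<open>k > 0\<close>, the core of \<open>k\<close> is the library's \<open>squarefree_part k\<close>.
\<close>

lemma powr_inverse_nat_polar:
  fixes w :: complex
  assumes "n > 0"
  shows "w powr (1 / of_nat n) = rcis (root n (cmod w)) (Arg w / real n)"
proof (cases "w = 0")
  case True
  then show ?thesis using assms by (simp add: rcis_def)
next
  case False
  have "Ln w = of_real (ln (cmod w)) + \<i> * of_real (Arg w)"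
    using False by (simp add: complex_eq_iff Arg_eq_Im_Ln)
  then have "w powr (1 / of_nat n) = exp (of_real (ln (cmod w) / n) + \<i> * of_real (Arg w / n))"
    using False by (simp add: powr_def add_divide_distrib)
  also have "\<dots> = of_real (exp (ln (cmod w) / n)) * cis (Arg w / n)"
    by (simp only: exp_add exp_of_real cis_conv_exp)
  also have "exp (ln (cmod w) / n) = root n (cmod w)"
    using False assms by (simp add: root_powr_inverse powr_def)
  finally show ?thesis by (simp add: rcis_def)
qed

text \<open>
  The Gauss series \<open>\<^sub>2F\<^sub>1(-r, -r - 1/n; 1 - 1/n; x)\<close>, as a polynomial: the series terminates
  at \<open>x\<^sup>r\<close> because of the upper parameter \<open>-r\<close>.
\<close>

definition X_poly :: "nat \<Rightarrow> nat \<Rightarrow> rat poly" where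
  "X_poly n r =
     (\<Sum>k\<le>r. monom (fps_hypergeo [- of_nat r, - of_nat r - 1 / of_nat n] [1 - 1 / of_nat n] 1 $ k) k)"

lemma fps_of_poly_X_poly:
  "fps_of_poly (X_poly n r) =
     fps_hypergeo [- of_nat r, - of_nat r - 1 / of_nat n] [1 - 1 / of_nat n] 1"
proof (rule fps_ext)
  fix k
  show "fps_of_poly (X_poly n r) $ k =
    fps_hypergeo [- of_nat r, - of_nat r - 1 / of_nat n] [1 - 1 / of_nat n] 1 $ k"
    by (cases "k \<le> r")
       (auto simp: X_poly_def coeff_sum pochhammer_of_nat_eq_0_lemma simp del: of_nat_Suc)
qed

definition D_denom :: "nat \<Rightarrow> nat \<Rightarrow> nat" where
  "D_denom n r = (LEAST D. D > 0 \<and> (\<forall>k. coeff (smult (of_nat D) (X_poly n r)) k \<in> \<int>))"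

text \<open>
  \<open>quotient_of\<close> yields numerator and positive denominator in lowest terms; the coefficients
  beyond the degree have numerator \<open>0\<close> and do not affect the gcd.
\<close>

definition N_numer :: "nat \<Rightarrow> nat \<Rightarrow> nat \<Rightarrow> int" where
  "N_numer d n r =
     Gcd (range (\<lambda>k. fst (quotient_of (coeff (pcompose (X_poly n r) [:1, - of_nat d:]) k))))"

definition N_cal :: "nat \<Rightarrow> nat \<Rightarrow> real" where
  "N_cal d n =
     (\<Prod>p\<in>prime_factors n.
        real p powr min (real (multiplicity p d)) (real (multiplicity p n) + 1 / (real p - 1)))"

end

theory Submission
  imports Defs "Jordan_Normal_Form.Char_Poly"
begin

text \<open>
  The function \<open>H(w) = \<Sum>\<^sub>i\<^sub>,\<^sub>k (-1)\<^sup>i\<^sup>+\<^sup>k (r choose i) (r choose k) z\<^sup>k exp ((i - k + a) w) / (i - k + a)\<close>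
  with \<open>a = 1/n\<close> is a primitive of \<open>exp (a w) ((1 - exp w) (1 - z exp (-w)))\<^sup>r\<close>. Up to one common
  factor, its value at \<open>0\<close> is \<open>X\<^bsub>n,r\<^esub>(z)\<close> and its value at the logarithm of \<open>z\<close> is
  \<open>z\<^sup>a z\<^sup>r X\<^bsub>n,r\<^esub>(1/z)\<close>, so mean value estimates for \<open>H\<close> bound both the polynomials and
  the quality of the Pade approximation to \<open>z\<^sup>a\<close>. At \<open>z = W(x)\<close>, scaled by
  \<open>D\<^bsub>n,r\<^esub> / N\<^bsub>d,n,r\<^esub> (U / g)\<^sup>r\<close>, these approximations give linear forms in \<open>p\<close> and \<open>q\<close>
  that are algebraic integers with rational squares, hence of absolute value at least \<open>1\<close> unless
  they vanish, and two consecutive ones cannot both vanish. Choosing \<open>r\<close> according to the size of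
  \<open>q\<close> yields the claim. The estimates need \<open>Q \<ge> 1\<close> and, for real \<open>W\<close>, a lower bound on \<open>W\<close>; both
  follow from \<open>E > 1\<close> because \<open>D\<^bsub>n,r\<^esub> d\<^sup>r / N\<^bsub>d,n,r\<^esub>\<close> grows exponentially in \<open>r\<close>, which is read off
  the value of \<open>X\<^bsub>n,r\<^esub>\<close> at \<open>1\<close>.
\<close>

hide_const (open) Module.smult

section \<open>Sums and products of algebraic integers\<close>

text \<open>The constants form one budget. With \<tau> = 4 sqrt |2t| in front of \<open>c\<close>,
  the closing argument works as soon as \<tau> > 1 + 15/4, and \<tau> \<ge> 4 sqrt 2 leaves room for
  this. The bounds on the two polynomials may therefore lose a factor 15/4, but the bound on the
  remainder only 5/4, since the 5 in \<open>c\<close> is 4 * 5/4. The 5/4 is the price of sin y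
  \<ge> 4/5 y for 0 \<le> y \<le> pi/3, which covers y = pi/n because n \<ge> 3; the further factor
  3 in 15/4 is the cube root of 27, from sqrt W \<ge> 1/27. The threshold 1/27 and the growth rate
  belong together: (1 + v) / (1 - v) > 14/13 means v > 1/27, and 14/13 lies just below the cube root
  of 81/64, the rate obtained for n = 3. Rationality is claimed only for the square of the linear
  form, because \<open>g\<close> is in general only the square root of a rational number.
  Conjugation is a relation between expressions rather than a field automorphism, so that square
  values of \<open>t\<close> need no separate treatment.\<close>

lemma algebraic_int_eigenvalue_int_matrix:
  fixes A :: "int mat" and z :: complex
  assumes A: "A \<in> carrier_mat n n" and ev: "eigenvalue (map_mat of_int A) z"
  shows "algebraic_int z"
proof -
  have A': "map_mat of_int A \<in> carrier_mat n n" using A by simp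
  have "poly (char_poly (map_mat of_int A)) z = 0"
    using ev eigenvalue_root_char_poly[OF A', of z] by blast
  moreover have "char_poly (map_mat of_int A) = map_poly (of_int :: int \<Rightarrow> complex) (char_poly A)"
    by (rule of_int_hom.char_poly_hom[OF A])
  moreover have "monic (char_poly A)"
    using degree_monic_char_poly[OF A] by simp
  ultimately show ?thesis
    unfolding algebraic_int_altdef_ipoly by auto
qed

definition int_span :: "(nat \<Rightarrow> complex) \<Rightarrow> nat \<Rightarrow> complex set" where
  "int_span v n = {\<Sum>i<n. of_int (c i) * v i |c. True}"

lemma int_span_add: "x \<in> int_span v n \<Longrightarrow> y \<in> int_span v n \<Longrightarrow> x + y \<in> int_span v n"
proof -
  assume "x \<in> int_span v n" "y \<in> int_span v n"
  then obtain c d where "x = (\<Sum>i<n. of_int (c i) * v i)" "y = (\<Sum>i<n. of_int (d i) * v i)"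
    by (auto simp: int_span_def)
  then have "x + y = (\<Sum>i<n. of_int (c i + d i) * v i)"
    by (simp add: sum.distrib distrib_right)
  then show ?thesis unfolding int_span_def by (intro CollectI exI[of _ "\<lambda>i. c i + d i"]) auto
qed

lemma int_span_of_int_mult: "x \<in> int_span v n \<Longrightarrow> of_int k * x \<in> int_span v n"
proof -
  assume "x \<in> int_span v n"
  then obtain c where "x = (\<Sum>i<n. of_int (c i) * v i)"
    by (auto simp: int_span_def)
  then have "of_int k * x = (\<Sum>i<n. of_int (k * c i) * v i)"
    by (simp add: sum_distrib_left mult.assoc)
  then show ?thesis unfolding int_span_def by (intro CollectI exI[of _ "\<lambda>i. k * c i"]) auto
qed

lemma int_span_0: "0 \<in> int_span v n"
  unfolding int_span_def by (intro CollectI exI[of _ "\<lambda>i. 0"]) auto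

lemma int_span_sum: "(\<And>i. i \<in> I \<Longrightarrow> f i \<in> int_span v n) \<Longrightarrow> sum f I \<in> int_span v n"
  by (induction I rule: infinite_finite_induct) (auto simp: int_span_0 intro: int_span_add)

lemma int_span_gen: "i < n \<Longrightarrow> v i \<in> int_span v n"
  unfolding int_span_def
  by (intro CollectI exI[of _ "\<lambda>j. if j = i then 1 else 0"]) (auto simp: if_distrib[of of_int] if_distribR if_distrib[of "\<lambda>z. z * _"] cong: if_cong)

lemma int_span_mult_closed:
  assumes "\<And>i. i < n \<Longrightarrow> z * v i \<in> int_span v n" "x \<in> int_span v n"
  shows "z * x \<in> int_span v n"
proof -
  obtain c where "x = (\<Sum>i<n. of_int (c i) * v i)" using assms by (auto simp: int_span_def)
  then have "z * x = (\<Sum>i<n. of_int (c i) * (z * v i))"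
    by (simp add: sum_distrib_left mult_ac)
  also have "\<dots> \<in> int_span v n" by (intro int_span_sum int_span_of_int_mult assms) auto
  finally show ?thesis .
qed

text \<open>Determinant trick: the relations say that the vector of generators is an eigenvector,
  for the eigenvalue \<open>z\<close>, of an integer matrix. It is a genuine eigenvector because
  \<open>v k\<close> is not zero.\<close>

lemma algebraic_int_if_int_span_stable:
  fixes z :: complex
  assumes st: "\<And>i. i < n \<Longrightarrow> z * v i \<in> int_span v n" and nz: "k < n" "v k \<noteq> 0"
  shows "algebraic_int z"
proof -
  have "\<forall>i. \<exists>c. i < n \<longrightarrow> z * v i = (\<Sum>j<n. of_int (c j) * v j)"
    using st by (auto simp: int_span_def)
  then obtain c where c: "\<And>i. i < n \<Longrightarrow> z * v i = (\<Sum>j<n. of_int (c i j) * v j)"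
    by metis
  define A :: "int mat" where "A = mat n n (\<lambda>(i,j). c i j)"
  define w where "w = vec n v"
  have A: "A \<in> carrier_mat n n" by (simp add: A_def)
  have "map_mat of_int A *\<^sub>v w = z \<cdot>\<^sub>v w"
    by (rule eq_vecI) (auto simp: A_def w_def scalar_prod_def c atLeast0LessThan)
  moreover have "w $ k \<noteq> 0\<^sub>v n $ k" using nz by (simp add: w_def)
  then have "w \<noteq> 0\<^sub>v n" by auto
  ultimately have "eigenvector (map_mat of_int A) w z"
    by (simp add: eigenvector_def A_def w_def)
  then show ?thesis using algebraic_int_eigenvalue_int_matrix[OF A] by (auto simp: eigenvalue_def)
qed

lemma algebraic_int_monic_relation:
  fixes x :: complex
  assumes "algebraic_int x"
  obtains m c where "m > 0" "x ^ m = (\<Sum>i<m. of_int (c i) * x ^ i)"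
proof -
  from assms obtain p :: "int poly" where p: "poly (map_poly of_int p) x = 0" "lead_coeff p = 1"
    unfolding algebraic_int_altdef_ipoly by auto
  define m where "m = degree p"
  have m0: "m > 0"
  proof (rule ccontr)
    assume "\<not> m > 0"
    then obtain a where "p = [:a:]" by (auto simp: m_def elim: degree_eq_zeroE)
    then show False using p by (simp add: map_poly_pCons split: if_splits)
  qed
  have "0 = (\<Sum>i\<le>m. of_int (coeff p i) * x ^ i)"
    using p(1) unfolding poly_altdef m_def by (simp add: coeff_map_poly)
  also have "{..m} = insert m {..<m}" by auto
  also have "(\<Sum>i\<in>insert m {..<m}. of_int (coeff p i) * x ^ i) = x ^ m + (\<Sum>i<m. of_int (coeff p i) * x ^ i)"
    using p(2) by (simp add: m_def)
  finally have "x ^ m = - (\<Sum>i<m. of_int (coeff p i) * x ^ i)"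
    by (metis add.inverse_unique add.commute minus_unique)
  then have "x ^ m = (\<Sum>i<m. of_int (- coeff p i) * x ^ i)"
    by (simp only: of_int_minus mult_minus_left sum_negf)
  then show ?thesis by (rule that[OF m0])
qed

text \<open>The monomials x^i y^j with i < m and j < k, numbered by l = i k + j, span a group that
  is stable under \<open>x\<close> and under \<open>y\<close>: the monic relations rewrite x^m and
  y^k in lower powers. Hence it is stable under the sum and the product as well.\<close>

lemma
  fixes x y :: complex
  assumes "algebraic_int x" "algebraic_int y"
  shows algebraic_int_add: "algebraic_int (x + y)" and algebraic_int_mult: "algebraic_int (x * y)"
proof -
  obtain m c where m: "m > 0" and cx: "x ^ m = (\<Sum>i<m. of_int (c i) * x ^ i)"
    using algebraic_int_monic_relation[OF assms(1)] .
  obtain k e where k: "k > 0" and ey: "y ^ k = (\<Sum>i<k. of_int (e i) * y ^ i)"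
    using algebraic_int_monic_relation[OF assms(2)] .
  define v where "v l = x ^ (l div k) * y ^ (l mod k)" for l
  have gen: "x ^ i * y ^ j \<in> int_span v (m * k)" if "i < m" "j < k" for i j
  proof -
    have "i * k + j < Suc i * k" using that by simp
    also have "\<dots> \<le> m * k" using that by (intro mult_le_mono1) simp
    finally have "i * k + j < m * k" .
    moreover have "v (i * k + j) = x ^ i * y ^ j" using that by (simp add: v_def)
    ultimately show ?thesis using int_span_gen[of "i * k + j" "m * k" v] by simp
  qed
  have lt: "l div k < m" "l mod k < k" if "l < m * k" for l
    using that k by (auto simp: less_mult_imp_div_less)
  have X: "x * v l \<in> int_span v (m * k)" if l: "l < m * k" for l
  proof (cases "Suc (l div k) < m")
    case True
    then show ?thesis using gen[OF True lt(2)[OF l]] by (simp add: v_def mult.assoc)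
  next
    case False
    with lt(1)[OF l] have "Suc (l div k) = m" by simp
    moreover have "x * v l = x ^ Suc (l div k) * y ^ (l mod k)" by (simp add: v_def)
    ultimately have "x * v l = x ^ m * y ^ (l mod k)" by (simp only:)
    also have "\<dots> = (\<Sum>i<m. of_int (c i) * (x ^ i * y ^ (l mod k)))"
      by (simp add: cx sum_distrib_right mult.assoc)
    also have "\<dots> \<in> int_span v (m * k)"
      by (intro int_span_sum int_span_of_int_mult gen lt(2)[OF l]) auto
    finally show ?thesis .
  qed
  have Y: "y * v l \<in> int_span v (m * k)" if l: "l < m * k" for l
  proof (cases "Suc (l mod k) < k")
    case True
    then show ?thesis using gen[OF lt(1)[OF l] True] by (simp add: v_def mult_ac)
  next
    case False
    with lt(2)[OF l] have "Suc (l mod k) = k" by simp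
    moreover have "y * v l = x ^ (l div k) * y ^ Suc (l mod k)" by (simp add: v_def)
    ultimately have "y * v l = x ^ (l div k) * y ^ k" by (simp only:)
    also have "\<dots> = (\<Sum>i<k. of_int (e i) * (x ^ (l div k) * y ^ i))"
      by (simp add: ey sum_distrib_left mult_ac)
    also have "\<dots> \<in> int_span v (m * k)"
      by (intro int_span_sum int_span_of_int_mult gen lt(1)[OF l]) auto
    finally show ?thesis .
  qed
  have v0: "v 0 \<noteq> 0" "0 < m * k" using m k by (simp_all add: v_def)
  show "algebraic_int (x + y)"
    by (rule algebraic_int_if_int_span_stable[where v = v and n = "m * k" and k = 0])
       (simp_all add: distrib_right int_span_add X Y m k v0)
  show "algebraic_int (x * y)"
    by (rule algebraic_int_if_int_span_stable[where v = v and n = "m * k" and k = 0])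
       (simp_all add: mult.assoc int_span_mult_closed[of "m * k" x v, OF X Y] m k v0)
qed

lemma algebraic_int_diff: "algebraic_int (x::complex) \<Longrightarrow> algebraic_int y \<Longrightarrow> algebraic_int (x - y)"
  using algebraic_int_add[of x "- y"] by simp

lemma algebraic_int_power: "algebraic_int (x::complex) \<Longrightarrow> algebraic_int (x ^ k)"
  by (induction k) (auto intro: algebraic_int_mult)

lemma algebraic_int_sum:
  "(\<And>i. i \<in> I \<Longrightarrow> algebraic_int (f i :: complex)) \<Longrightarrow> algebraic_int (sum f I)"
  by (induction I rule: infinite_finite_induct) (auto intro: algebraic_int_add)

section \<open>The Pade polynomials and a primitive\<close>

text \<open>The coefficient of z^k in 2F1(-r, -r - a; 1 - a; z), with the signs of the two upper
  Pochhammer symbols cancelled, so that it is visibly nonnegative for 0 < a < 1. The field is left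
  open because rational, real and complex versions are compared later.\<close>

definition hyp_coeff :: "'a::field_char_0 \<Rightarrow> nat \<Rightarrow> nat \<Rightarrow> 'a" where
  "hyp_coeff a r k = of_nat (r choose k) * pochhammer (a + of_nat (r - k) + 1) k / pochhammer (1 - a) k"

definition hypX :: "'a::field_char_0 \<Rightarrow> nat \<Rightarrow> 'a \<Rightarrow> 'a" where
  "hypX a r z = (\<Sum>k\<le>r. hyp_coeff a r k * z ^ k)"

definition hypY :: "'a::field_char_0 \<Rightarrow> nat \<Rightarrow> 'a \<Rightarrow> 'a" where
  "hypY a r z = (\<Sum>k\<le>r. hyp_coeff a r k * z ^ (r - k))"

text \<open>For a = 1/n this is the last Gamma quotient in the hypothesis on \<open>\<C>\<close> and
  \<open>\<D>\<close>. Times \<open>a\<close>, it is the common factor between values of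
  \<open>hypH\<close> and the Pade polynomials.\<close>

definition hypN :: "'a::field_char_0 \<Rightarrow> nat \<Rightarrow> 'a" where
  "hypN a r = pochhammer (1 + a) r / fact r"

text \<open>Pascal's rule, read as the recursion for iterated differences.\<close>

lemma alternating_binomial_sum_Suc:
  fixes f :: "nat \<Rightarrow> 'a::comm_ring_1"
  shows "(\<Sum>i\<le>Suc r. (-1) ^ i * of_nat (Suc r choose i) * f i) =
         (\<Sum>i\<le>r. (-1) ^ i * of_nat (r choose i) * (f i - f (Suc i)))"
proof -
  have "(\<Sum>i\<le>Suc r. (-1) ^ i * of_nat (Suc r choose i) * f i) =
     f 0 + (\<Sum>i\<le>r. (-1) ^ Suc i * of_nat ((r choose Suc i) + (r choose i)) * f (Suc i))"
    by (subst sum.atMost_Suc_shift) (simp add: add.commute)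
  also have "\<dots> = (f 0 + (\<Sum>i\<le>r. (-1) ^ Suc i * of_nat (r choose Suc i) * f (Suc i)))
       + (\<Sum>i\<le>r. (-1) ^ Suc i * of_nat (r choose i) * f (Suc i))"
    by (simp add: sum.distrib sum_subtractf sum_negf distrib_left distrib_right left_diff_distrib)
  also have "f 0 + (\<Sum>i\<le>r. (-1) ^ Suc i * of_nat (r choose Suc i) * f (Suc i)) =
     (\<Sum>i\<le>Suc r. (-1) ^ i * of_nat (r choose i) * f i)"
    by (subst sum.atMost_Suc_shift) simp
  also have "\<dots> = (\<Sum>i\<le>r. (-1) ^ i * of_nat (r choose i) * f i)" by (simp add: binomial_eq_0)
  finally show ?thesis by (simp add: sum_subtractf right_diff_distrib sum_negf)
qed

text \<open>The left side is, up to sign, the \<open>r\<close>-th difference of 1 / y, so the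
  induction step subtracts the value at y + 1 from the value at y.\<close>

lemma alternating_binomial_partial_fractions:
  fixes y :: "'a::field_char_0"
  assumes "\<And>i. i \<le> r \<Longrightarrow> y + of_nat i \<noteq> 0"
  shows "(\<Sum>i\<le>r. (-1) ^ i * of_nat (r choose i) / (y + of_nat i)) = fact r / pochhammer y (Suc r)"
  using assms
proof (induction r arbitrary: y)
  case 0
  then show ?case by simp
next
  case (Suc r)
  have nz: "y + of_nat i \<noteq> 0" if "i \<le> Suc r" for i using Suc.prems that by blast
  have nz1: "y + 1 + of_nat i \<noteq> 0" if "i \<le> r" for i using nz[of "Suc i"] that by (simp add: add_ac)
  have S: "(\<Sum>i\<le>Suc r. (-1) ^ i * of_nat (Suc r choose i) * (1 / (y + of_nat i))) =
      (\<Sum>i\<le>r. (-1) ^ i * of_nat (r choose i) * (1 / (y + of_nat i) - 1 / (y + of_nat (Suc i))))"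
    by (rule alternating_binomial_sum_Suc)
  also have "\<dots> = (\<Sum>i\<le>r. (-1) ^ i * of_nat (r choose i) / (y + of_nat i))
       - (\<Sum>i\<le>r. (-1) ^ i * of_nat (r choose i) / (y + 1 + of_nat i))"
    by (simp add: sum_subtractf right_diff_distrib add_ac)
  also have "\<dots> = fact r / pochhammer y (Suc r) - fact r / pochhammer (y + 1) (Suc r)"
    using Suc.IH[of y] Suc.IH[of "y + 1"] nz nz1 by simp
  also have "\<dots> = fact (Suc r) / pochhammer y (Suc (Suc r))"
  proof -
    define P where "P = pochhammer (y + 1) r"
    have e1: "pochhammer y (Suc r) = y * P" by (simp add: pochhammer_rec P_def)
    have e2: "pochhammer (y + 1) (Suc r) = P * (y + 1 + of_nat r)" by (simp add: pochhammer_Suc P_def)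
    have e3: "pochhammer y (Suc (Suc r)) = y * (P * (y + 1 + of_nat r))"
      by (subst pochhammer_rec) (simp add: e2)
    define T where "T = y + 1 + of_nat r"
    have e4: "fact (Suc r) = (T - y) * fact r" by (simp add: T_def add.commute)
    have "y \<noteq> 0" using nz[of 0] by simp
    moreover have "T \<noteq> 0" using nz1[of r] by (simp add: T_def)
    moreover have "P \<noteq> 0" unfolding P_def pochhammer_eq_0_iff
      using nz1 by (metis add.left_inverse less_imp_le)
    ultimately show ?thesis unfolding e1 e2 e3 e4 T_def[symmetric] by (simp add: field_simps)
  qed
  finally show ?case by simp
qed

text \<open>Real and complex arguments are both needed: monotonicity is used on the real line, the
  quasi-period on vertical lines.\<close>

definition hypH :: "'a::{real_normed_field,banach} \<Rightarrow> nat \<Rightarrow> 'a \<Rightarrow> 'a \<Rightarrow> 'a" where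
  "hypH a r z w = (\<Sum>i\<le>r. \<Sum>k\<le>r. (-1) ^ i * of_nat (r choose i) * ((-1) ^ k * of_nat (r choose k)) * z ^ k
      * exp (w * (of_nat i - of_nat k + a)) / (of_nat i - of_nat k + a))"

lemma nonint_shift:
  assumes "a \<notin> (\<int> :: 'a::field_char_0 set)"
  shows "of_nat i - of_nat k + a \<noteq> 0" "a - of_nat k + of_nat i \<noteq> 0" "a + of_nat i \<noteq> 0" "1 - a + of_nat k \<noteq> 0"
proof -
  have *: "a = of_int j \<Longrightarrow> False" for j using assms by auto
  show "of_nat i - of_nat k + a \<noteq> 0" using *[of "int k - int i"] by (auto simp: algebra_simps)
  then show "a - of_nat k + of_nat i \<noteq> 0" by (simp add: algebra_simps)
  show "a + of_nat i \<noteq> 0" using *[of "- int i"] by (auto simp: eq_neg_iff_add_eq_0)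
  show "1 - a + of_nat k \<noteq> 0" using *[of "1 + int k"] by (auto simp: algebra_simps)
qed

lemma alternating_binomial_power:
  fixes z :: "'a::comm_ring_1"
  shows "(\<Sum>k\<le>r. (-1) ^ k * of_nat (r choose k) * z ^ k) = (1 - z) ^ r"
  using binomial_ring[of "- z" 1 r] by (simp add: power_minus[of z] mult_ac)

lemma hypH_has_field_derivative:
  assumes "a \<notin> \<int>"
  shows "(hypH a r z has_field_derivative exp (a * w) * ((1 - exp w) * (1 - z * exp (- w))) ^ r) (at w within S)"
proof -
  have "(hypH a r z has_field_derivative
     (\<Sum>i\<le>r. \<Sum>k\<le>r. (-1) ^ i * of_nat (r choose i) * ((-1) ^ k * of_nat (r choose k)) * z ^ k
      * exp (w * (of_nat i - of_nat k + a)))) (at w within S)"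
    unfolding hypH_def
    by (intro DERIV_sum) (auto intro!: derivative_eq_intros simp: nonint_shift[OF assms])
  also have "(\<Sum>i\<le>r. \<Sum>k\<le>r. (-1) ^ i * of_nat (r choose i) * ((-1) ^ k * of_nat (r choose k)) * z ^ k
      * exp (w * (of_nat i - of_nat k + a))) =
     (\<Sum>i\<le>r. \<Sum>k\<le>r. exp (a * w) * (((-1) ^ i * of_nat (r choose i) * exp w ^ i) * ((-1) ^ k * of_nat (r choose k) * (z * exp (- w)) ^ k)))"
  proof (intro sum.cong refl)
    fix i k
    have "w * (of_nat i - of_nat k + a) = a * w + of_nat i * w + of_nat k * (- w)" by (simp add: algebra_simps)
    then have "exp (w * (of_nat i - of_nat k + a)) = exp (a * w) * exp w ^ i * exp (- w) ^ k"
      by (simp only: exp_add exp_of_nat_mult)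
    then show "(-1) ^ i * of_nat (r choose i) * ((-1) ^ k * of_nat (r choose k)) * z ^ k
      * exp (w * (of_nat i - of_nat k + a)) = exp (a * w) * (((-1) ^ i * of_nat (r choose i) * exp w ^ i) * ((-1) ^ k * of_nat (r choose k) * (z * exp (- w)) ^ k))"
      by (simp add: power_mult_distrib mult_ac)
  qed
  also have "\<dots> = exp (a * w) * ((\<Sum>i\<le>r. (-1) ^ i * of_nat (r choose i) * exp w ^ i) * (\<Sum>k\<le>r. (-1) ^ k * of_nat (r choose k) * (z * exp (- w)) ^ k))"
    by (simp only: sum_distrib_left[symmetric] sum_product)
  also have "\<dots> = exp (a * w) * ((1 - exp w) * (1 - z * exp (- w))) ^ r"
    by (simp only: alternating_binomial_power) (simp only: power_mult_distrib)
  finally show ?thesis .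
qed

text \<open>The sign disappears because (a - k)_k = (-1)^k (1 - a)_k. This is what turns the partial
  fraction sums inside \<open>hypH\<close> into hypergeometric coefficients.\<close>

lemma hyp_coeff_alt:
  fixes a :: "'a::field_char_0"
  assumes a: "a \<notin> \<int>" and k: "k \<le> r"
  shows "a * hypN a r * ((-1) ^ k * of_nat (r choose k) * (fact r / pochhammer (a - of_nat k) (Suc r))) = hyp_coeff a r k"
proof -
  have s1: "pochhammer (a - of_nat k) (Suc r) = pochhammer (a - of_nat k) k * pochhammer a (Suc r - k)"
    using pochhammer_product[of k "Suc r" "a - of_nat k"] k by simp
  have s2: "pochhammer (a - of_nat k) k = (-1) ^ k * pochhammer (1 - a) k"
    using pochhammer_minus'[of "a - 1" k] by (simp add: algebra_simps)
  have s3: "a * pochhammer (1 + a) r = pochhammer a (Suc r)"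
    by (simp add: pochhammer_rec add.commute)
  have s4: "pochhammer a (Suc r) = pochhammer a (Suc r - k) * pochhammer (a + of_nat (Suc r - k)) k"
    using pochhammer_product[of "Suc r - k" "Suc r" a] k by simp
  have s5: "a + of_nat (Suc r - k) = a + of_nat (r - k) + 1"
    using k by (simp add: Suc_diff_le add_ac)
  have nz: "pochhammer a (Suc r - k) \<noteq> 0" "pochhammer (1 - a) k \<noteq> 0"
    unfolding pochhammer_eq_0_iff using nonint_shift[OF a] by (metis add.left_inverse)+
  have "a * hypN a r * ((-1) ^ k * of_nat (r choose k) * (fact r / pochhammer (a - of_nat k) (Suc r)))
     = (a * pochhammer (1 + a) r) * ((-1) ^ k * of_nat (r choose k)) / pochhammer (a - of_nat k) (Suc r)"
    by (simp add: hypN_def)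
  also have "\<dots> = (pochhammer a (Suc r - k) * pochhammer (a + of_nat (r - k) + 1) k) * ((-1) ^ k * of_nat (r choose k)) / ((-1) ^ k * pochhammer (1 - a) k * pochhammer a (Suc r - k))"
    by (simp only: s1 s2 s3 s4 s5)
  also have "\<dots> = hyp_coeff a r k" using nz by (simp add: hyp_coeff_def)
  finally show ?thesis .
qed

lemma hypH_0:
  assumes a: "a \<notin> \<int>"
  shows "a * hypN a r * hypH a r z 0 = hypX a r z"
proof -
  have "hypH a r z 0 = (\<Sum>k\<le>r. \<Sum>i\<le>r. ((-1) ^ k * of_nat (r choose k)) * z ^ k *
      ((-1) ^ i * of_nat (r choose i) / (a - of_nat k + of_nat i)))"
    unfolding hypH_def by (subst sum.swap) (simp add: algebra_simps)
  also have "\<dots> = (\<Sum>k\<le>r. ((-1) ^ k * of_nat (r choose k)) * z ^ k * (fact r / pochhammer (a - of_nat k) (Suc r)))"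
    unfolding sum_distrib_left[symmetric]
    by (intro sum.cong refl, subst alternating_binomial_partial_fractions) (auto simp: nonint_shift[OF a])
  finally have "a * hypN a r * hypH a r z 0 = (\<Sum>k\<le>r. a * hypN a r * ((-1) ^ k * of_nat (r choose k) * (fact r / pochhammer (a - of_nat k) (Suc r))) * z ^ k)"
    by (simp add: sum_distrib_left mult_ac)
  also have "\<dots> = hypX a r z" unfolding hypX_def by (intro sum.cong refl) (simp only: hyp_coeff_alt[OF a] atMost_iff)
  finally show ?thesis .
qed

lemma sum_atMost_rev: "(\<Sum>k\<le>r. f k) = (\<Sum>k\<le>r. f (r - k))" for r :: nat
  by (rule sum.reindex_bij_witness[of _ "\<lambda>k. r - k" "\<lambda>k. r - k"]) auto

text \<open>At a logarithm of \<open>z\<close> the two indices change roles: the inner sum over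
  \<open>k\<close> is evaluated by partial fractions, and reversing both indices attaches the old
  coefficients to z^(r - k). Any logarithm will do.\<close>

lemma hypH_ln:
  assumes a: "a \<notin> \<int>" and z: "exp om = z"
  shows "a * hypN a r * hypH a r z om = exp (a * om) * hypY a r z"
proof -
  have "hypH a r z om = (\<Sum>i\<le>r. \<Sum>k\<le>r. exp (a * om) * ((-1) ^ i * of_nat (r choose i) * z ^ i) *
      ((-1) ^ k * of_nat (r choose k) / (of_nat i - of_nat k + a)))"
    unfolding hypH_def
  proof (intro sum.cong refl)
    fix i k
    have "om * (of_nat i - of_nat k + a) = a * om + of_nat i * om + of_nat k * (- om)" by (simp add: algebra_simps)
    then have "exp (om * (of_nat i - of_nat k + a)) = exp (a * om) * z ^ i * exp (- om) ^ k"
      by (simp only: exp_add exp_of_nat_mult z)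
    then have "z ^ k * exp (om * (of_nat i - of_nat k + a)) = exp (a * om) * z ^ i * (z * exp (- om)) ^ k"
      by (simp add: power_mult_distrib mult_ac)
    also have "z * exp (- om) = 1" by (simp add: z[symmetric] exp_minus)
    finally show "(-1) ^ i * of_nat (r choose i) * ((-1) ^ k * of_nat (r choose k)) * z ^ k * exp (om * (of_nat i - of_nat k + a)) / (of_nat i - of_nat k + a)
      = exp (a * om) * ((-1) ^ i * of_nat (r choose i) * z ^ i) * ((-1) ^ k * of_nat (r choose k) / (of_nat i - of_nat k + a))"
      by (simp add: mult_ac)
  qed
  also have "\<dots> = (\<Sum>i\<le>r. exp (a * om) * ((-1) ^ i * of_nat (r choose i) * z ^ i) *
      ((-1) ^ r * (fact r / pochhammer (a - of_nat (r - i)) (Suc r))))"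
    unfolding sum_distrib_left[symmetric]
  proof (intro sum.cong refl arg_cong2[of _ _ _ _ "(*)"])
    fix i assume "i \<in> {..r}"
    then have i: "i \<le> r" by simp
    have "(\<Sum>k\<le>r. (-1) ^ k * of_nat (r choose k) / (of_nat i - of_nat k + a)) =
       (\<Sum>k\<le>r. (-1) ^ (r - k) * of_nat (r choose (r - k)) / (of_nat i - of_nat (r - k) + a))"
      by (rule sum_atMost_rev)
    also have "\<dots> = (\<Sum>k\<le>r. (-1) ^ r * ((-1) ^ k * of_nat (r choose k) / (a - of_nat (r - i) + of_nat k)))"
    proof (intro sum.cong refl)
      fix k assume "k \<in> {..r}"
      then have k: "k \<le> r" by simp
      have "(-1 :: 'a) ^ (r - k) = (-1) ^ r * (-1) ^ k"
        using k by (simp add: minus_one_power_iff)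
      moreover have "r choose (r - k) = r choose k" using k by (metis binomial_symmetric)
      moreover have "of_nat i - of_nat (r - k) + a = a - of_nat (r - i) + of_nat k"
        using i k by (simp add: of_nat_diff)
      ultimately show "(-1) ^ (r - k) * of_nat (r choose (r - k)) / (of_nat i - of_nat (r - k) + a) = (-1) ^ r * ((-1) ^ k * of_nat (r choose k) / (a - of_nat (r - i) + of_nat k))"
        by (simp add: algebra_simps)
    qed
    also have "\<dots> = (-1) ^ r * (fact r / pochhammer (a - of_nat (r - i)) (Suc r))"
      unfolding sum_distrib_left[symmetric]
      by (subst alternating_binomial_partial_fractions) (auto simp: nonint_shift[OF a])
    finally show "(\<Sum>k\<le>r. (-1) ^ k * of_nat (r choose k) / (of_nat i - of_nat k + a)) = (-1) ^ r * (fact r / pochhammer (a - of_nat (r - i)) (Suc r))" .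
  qed
  also have "\<dots> = (\<Sum>k\<le>r. exp (a * om) * ((-1) ^ (r - k) * of_nat (r choose (r - k)) * z ^ (r - k)) *
      ((-1) ^ r * (fact r / pochhammer (a - of_nat (r - (r - k))) (Suc r))))"
    by (rule sum_atMost_rev)
  also have "\<dots> = (\<Sum>k\<le>r. exp (a * om) * z ^ (r - k) * ((-1) ^ k * of_nat (r choose k) * (fact r / pochhammer (a - of_nat k) (Suc r))))"
  proof (intro sum.cong refl)
    fix k assume "k \<in> {..r}"
    then have k: "k \<le> r" by simp
    have e: "(-1 :: 'a) ^ (r - k) * (-1) ^ r = (-1) ^ k" "r choose (r - k) = r choose k" "r - (r - k) = k"
      using k by (simp_all add: minus_one_power_iff binomial_symmetric[symmetric])
    have "exp (a * om) * ((-1) ^ (r - k) * of_nat (r choose (r - k)) * z ^ (r - k)) *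
      ((-1) ^ r * (fact r / pochhammer (a - of_nat (r - (r - k))) (Suc r))) =
      exp (a * om) * z ^ (r - k) * (((-1) ^ (r - k) * (-1) ^ r) * of_nat (r choose (r - k)) * (fact r / pochhammer (a - of_nat (r - (r - k))) (Suc r)))"
      by (simp only: mult_ac)
    then show "exp (a * om) * ((-1) ^ (r - k) * of_nat (r choose (r - k)) * z ^ (r - k)) *
      ((-1) ^ r * (fact r / pochhammer (a - of_nat (r - (r - k))) (Suc r))) = exp (a * om) * z ^ (r - k) * ((-1) ^ k * of_nat (r choose k) * (fact r / pochhammer (a - of_nat k) (Suc r)))"
      by (simp only: e)
  qed
  finally have "a * hypN a r * hypH a r z om = exp (a * om) * (\<Sum>k\<le>r. a * hypN a r * ((-1) ^ k * of_nat (r choose k) * (fact r / pochhammer (a - of_nat k) (Suc r))) * z ^ (r - k))"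
    by (simp add: sum_distrib_left mult_ac)
  also have "\<dots> = exp (a * om) * hypY a r z" unfolding hypY_def by (intro arg_cong2[of _ _ _ _ "(*)"] sum.cong refl) (simp only: hyp_coeff_alt[OF a] atMost_iff)
  finally show ?thesis .
qed

text \<open>The exponents differ from \<open>a\<close> by integers only, so all terms acquire the
  same multiplier.\<close>

lemma hypH_period:
  fixes a z w :: complex
  shows "hypH a r z (w + 2 * of_real pi * \<i>) = exp (2 * of_real pi * \<i> * a) * hypH a r z w"
  unfolding hypH_def sum_distrib_left
proof (intro sum.cong refl)
  fix i k
  have "(w + 2 * of_real pi * \<i>) * (of_nat i - of_nat k + a) = 2 * of_real pi * \<i> * a + w * (of_nat i - of_nat k + a) + of_int (int i - int k) * (2 * of_real pi * \<i>)"
    by (simp add: algebra_simps)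
  then have "exp ((w + 2 * of_real pi * \<i>) * (of_nat i - of_nat k + a)) = exp (2 * of_real pi * \<i> * a) * exp (w * (of_nat i - of_nat k + a)) * exp (of_int (int i - int k) * (2 * of_real pi * \<i>))"
    by (simp only: exp_add)
  also have "exp (of_int (int i - int k) * (2 * of_real pi * \<i>)) = 1"
    using exp_integer_2pi[of "of_int (int i - int k)"] by (simp add: mult_ac)
  finally show "(-1) ^ i * of_nat (r choose i) * ((-1) ^ k * of_nat (r choose k)) * z ^ k * exp ((w + 2 * of_real pi * \<i>) * (of_nat i - of_nat k + a)) / (of_nat i - of_nat k + a)
     = exp (2 * of_real pi * \<i> * a) * ((-1) ^ i * of_nat (r choose i) * ((-1) ^ k * of_nat (r choose k)) * z ^ k * exp (w * (of_nat i - of_nat k + a)) / (of_nat i - of_nat k + a))"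
    by (simp add: mult_ac)
qed

section \<open>Analytic bounds\<close>

text \<open>From sin y \<ge> y - y^3 / 6, once y^2 \<le> 6/5. The range up to pi / 3 is what a \<le>
  1/3 requires for y = pi a.\<close>

lemma four_fifths_le_sin:
  fixes y :: real
  assumes "0 \<le> y" "y \<le> pi / 3"
  shows "4 / 5 * y \<le> sin y"
proof -
  have M: "x - x ^ 3 / 6 \<le> sin x" if "x \<ge> 0" for x :: real
  proof -
    have "\<bar>sin x - (\<Sum>m<3. sin_coeff m * x ^ m)\<bar> \<le> inverse (fact 3) * \<bar>x\<bar> ^ 3"
      by (rule Maclaurin_sin_bound)
    moreover have "(\<Sum>m<3. sin_coeff m * x ^ m) = x" by (simp add: numeral_3_eq_3 sin_coeff_def)
    ultimately have "\<bar>sin x - x\<bar> \<le> x ^ 3 / 6" using that by (simp add: fact_numeral)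
    then show ?thesis by linarith
  qed
  \<comment> \<open>A crude bound pi \<le> 81/25, obtained from \<open>M\<close> itself at pi / 6,
    where the sine is 1/2; it starts from pi < 4.\<close>
  define p where "p = pi / 6"
  have p: "0 < p" "p \<le> 2 / 3" using pi_gt_zero pi_half_less_two by (auto simp: p_def)
  have "p ^ 2 \<le> (2 / 3) ^ 2" using p by (intro power_mono) auto
  then have "p * p ^ 2 \<le> p * (4 / 9)" using p by (intro mult_left_mono) (auto simp: power2_eq_square)
  then have "p ^ 3 \<le> p * (4 / 9)" by (simp add: power3_eq_cube power2_eq_square mult.assoc)
  moreover have "p - p ^ 3 / 6 \<le> 1 / 2" using M[of p] p sin_30 by (simp add: p_def)
  ultimately have "p \<le> 27 / 50" by simp
  then have "y \<le> 27 / 25" using assms by (simp add: p_def)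
  then have "y ^ 2 \<le> (27 / 25) ^ 2" using assms by (intro power_mono) auto
  then have "y * y ^ 2 \<le> y * (6 / 5)" using assms by (intro mult_left_mono) (auto simp: power2_eq_square)
  then have "y ^ 3 \<le> y * (6 / 5)" by (simp add: power3_eq_cube power2_eq_square mult.assoc)
  then show ?thesis using M[of y] assms by simp
qed

lemma unit_fraction_not_int:
  assumes "0 < a" "a < 1"
  shows "a \<notin> (\<int> :: real set)" "complex_of_real a \<notin> \<int>"
proof -
  show *: "a \<notin> (\<int> :: real set)" using assms by (auto elim!: Ints_cases)
  show "complex_of_real a \<notin> \<int>"
  proof
    assume "complex_of_real a \<in> \<int>"
    then obtain k where "complex_of_real a = of_int k" by (auto elim: Ints_cases)
    then have "complex_of_real a = complex_of_real (of_int k)" by simp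
    then have "a = of_int k" by (simp only: of_real_eq_iff)
    with * show False by simp
  qed
qed

section \<open>Real parameters embedded into the complex numbers\<close>

lemma hypN_of_real: "hypN (complex_of_real a) r = of_real (hypN a r)"
  by (simp add: hypN_def pochhammer_prod)

lemma hypN_ge_1:
  fixes a :: real
  assumes "a \<ge> 0" shows "hypN a r \<ge> 1"
proof -
  have "(\<Prod>i<r. 1 + real i) \<le> (\<Prod>i<r. 1 + a + real i)" using assms by (intro prod_mono) auto
  moreover have "(\<Prod>i<r. 1 + real i) = fact r" by (simp add: fact_prod_Suc atLeast0LessThan add.commute)
  ultimately show ?thesis by (simp add: hypN_def pochhammer_prod atLeast0LessThan)
qed

lemma hyp_coeff_of_real: "hyp_coeff (complex_of_real a) r k = of_real (hyp_coeff a r k)"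
  by (simp add: hyp_coeff_def pochhammer_prod)

lemma hypX_of_real: "hypX (complex_of_real a) r (of_real x) = of_real (hypX a r x)"
  by (simp add: hypX_def hyp_coeff_of_real)

lemma hypY_of_real: "hypY (complex_of_real a) r (of_real x) = of_real (hypY a r x)"
  by (simp add: hypY_def hyp_coeff_of_real)

lemma hypH_of_real: "hypH (complex_of_real a) r (of_real x) (of_real w) = of_real (hypH a r x w)"
proof -
  have "exp (complex_of_real w * (of_nat i - of_nat k + complex_of_real a)) = of_real (exp (w * (of_nat i - of_nat k + a)))" for i k
    unfolding exp_of_real[symmetric] by simp
  then show ?thesis by (simp add: hypH_def)
qed

text \<open>Since \<open>H\<close> is multiplied by \<open>exp (2 \<pi> i a)\<close> under translation by \<open>2 \<pi> i\<close>, a bound on its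
  derivative along one vertical period bounds \<open>H\<close> itself.\<close>

lemma hypH_vertical_bound:
  fixes a :: real
  assumes a: "0 < a" "a \<le> 1 / 3"
    and B: "\<And>t::real. norm (exp (of_real a * (b + \<i> * of_real t)) *
      ((1 - exp (b + \<i> * of_real t)) * (1 - z * exp (- (b + \<i> * of_real t)))) ^ r) \<le> B"
  shows "a * norm (hypH (of_real a) r z b) \<le> 5 / 4 * B"
proof -
  note ni = unit_fraction_not_int[of a]
  have B0: "0 \<le> B" using B[of 0] norm_ge_zero order_trans by blast
  let ?H = "hypH (of_real a) r z"
  let ?S = "closed_segment b (b + 2 * of_real pi * \<i>)"
  have "norm (?H (b + 2 * of_real pi * \<i>) - ?H b) \<le> B * norm (b + 2 * of_real pi * \<i> - b)"
  proof (rule field_differentiable_bound[of ?S])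
    fix w assume "w \<in> ?S"
    then obtain u where "w = (1 - u) *\<^sub>R b + u *\<^sub>R (b + 2 * of_real pi * \<i>)" by (auto simp: in_segment)
    then have w: "w = b + \<i> * of_real (2 * pi * u)" by (simp add: scaleR_conv_of_real algebra_simps)
    show "norm (exp (of_real a * w) * ((1 - exp w) * (1 - z * exp (- w))) ^ r) \<le> B"
      unfolding w by (rule B)
  qed (use a ni in \<open>auto intro: hypH_has_field_derivative\<close>)
  moreover have "?H (b + 2 * of_real pi * \<i>) - ?H b = (exp (\<i> * of_real (2 * pi * a)) - 1) * ?H b"
  proof -
    have "2 * of_real pi * \<i> * of_real a = \<i> * complex_of_real (2 * pi * a)" by simp
    then show ?thesis by (simp only: hypH_period left_diff_distrib mult_1_left)
  qed
  moreover have "norm (exp (\<i> * of_real (2 * pi * a)) - 1) = 2 * \<bar>sin (pi * a)\<bar>"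
    using dist_exp_i_1[of "2 * pi * a"] by simp
  ultimately have 1: "2 * \<bar>sin (pi * a)\<bar> * norm (?H b) \<le> B * (2 * pi)" by (simp add: norm_mult)
  have "4 / 5 * (pi * a) \<le> sin (pi * a)" using a by (intro four_fifths_le_sin) auto
  then have "2 * (4 / 5 * (pi * a)) * norm (?H b) \<le> 2 * \<bar>sin (pi * a)\<bar> * norm (?H b)"
    by (intro mult_right_mono) auto
  from this 1 have "2 * (4 / 5 * (pi * a)) * norm (?H b) \<le> B * (2 * pi)" by (rule order_trans)
  then have "pi * (a * norm (?H b)) \<le> pi * (5 / 4 * B)" by (simp add: mult_ac)
  then show ?thesis by (simp only: mult_le_cancel_left_pos[OF pi_gt_zero])
qed

text \<open>Taking out exp (i \<theta> / 2) leaves a real number. For |\<theta>| < pi its norm is at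
  most 2 + 2 cos (\<theta> / 2) for all \<open>t\<close> and at most 2 - 2 cos (\<theta> / 2) for
  \<open>t\<close> between 0 and \<theta>; these are the squares of |1 + s| and |1 - s| for the
  principal square root s of exp (i \<theta>).\<close>

lemma norm_circle_factor:
  "norm ((1 - exp (\<i> * of_real t)) * (1 - exp (\<i> * of_real \<theta>) * exp (- (\<i> * of_real t))))
     = 2 * \<bar>cos (\<theta> / 2) - cos (t - \<theta> / 2)\<bar>"
proof -
  define s where "s = exp (\<i> * of_real (\<theta> / 2))"
  have "exp (\<i> * of_real \<theta>) = s * s" by (simp add: s_def exp_add[symmetric] mult_ac)
  moreover have "exp (\<i> * of_real t) = s * cis (t - \<theta> / 2)"
    by (simp add: s_def cis_conv_exp exp_add[symmetric] algebra_simps)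
  moreover have "s * s * exp (- (\<i> * of_real t)) = s * cis (- (t - \<theta> / 2))"
    by (simp add: s_def cis_conv_exp exp_add[symmetric] algebra_simps)
  moreover have "1 = s * cis (- (\<theta> / 2))" by (simp add: s_def cis_conv_exp exp_add[symmetric] algebra_simps)
  moreover have "s = cis (\<theta> / 2)" by (simp add: s_def cis_conv_exp)
  ultimately have "(1 - exp (\<i> * of_real t)) * (1 - exp (\<i> * of_real \<theta>) * exp (- (\<i> * of_real t)))
     = s * (cis (\<theta> / 2) + cis (- (\<theta> / 2)) - (cis (t - \<theta> / 2) + cis (- (t - \<theta> / 2))))"
  proof -
    assume e: "exp (\<i> * of_real \<theta>) = s * s" "exp (\<i> * of_real t) = s * cis (t - \<theta> / 2)"
      "s * s * exp (- (\<i> * of_real t)) = s * cis (- (t - \<theta> / 2))" and one: "1 = s * cis (- (\<theta> / 2))"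
      and s: "s = cis (\<theta> / 2)"
    have cc: "cis (t - \<theta> / 2) * cis (- (t - \<theta> / 2)) = 1" by (simp add: cis_mult)
    have "(1 - exp (\<i> * of_real t)) * (1 - exp (\<i> * of_real \<theta>) * exp (- (\<i> * of_real t)))
      = 1 + s * s * (cis (t - \<theta> / 2) * cis (- (t - \<theta> / 2))) - s * (cis (t - \<theta> / 2) + cis (- (t - \<theta> / 2)))"
      unfolding e(1) e(3) unfolding e(2) by (simp add: algebra_simps)
    also have "\<dots> = s * cis (- (\<theta> / 2)) + s * s - s * (cis (t - \<theta> / 2) + cis (- (t - \<theta> / 2)))"
      using cc one by simp
    finally show ?thesis using s by (simp add: algebra_simps)
  qed
  also have "cis u + cis (- u) - (cis v + cis (- v)) = of_real (2 * (cos u - cos v))" for u v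
    by (simp add: complex_eq_iff)
  finally show ?thesis by (simp only: norm_mult norm_of_real s_def norm_exp_i_times abs_mult mult_1_left abs_numeral)
qed

lemma norm_one_pm_exp_i:
  "norm (1 + exp (\<i> * of_real x)) ^ 2 = 2 + 2 * cos x" "norm (1 - exp (\<i> * of_real x)) ^ 2 = 2 - 2 * cos x"
proof -
  have "(1 + cos x)\<^sup>2 + (sin x)\<^sup>2 = 2 + 2 * cos x" "(1 - cos x)\<^sup>2 + (sin x)\<^sup>2 = 2 - 2 * cos x"
    using sin_cos_squared_add[of x] by (simp_all add: power2_eq_square algebra_simps)
  then show "norm (1 + exp (\<i> * of_real x)) ^ 2 = 2 + 2 * cos x" "norm (1 - exp (\<i> * of_real x)) ^ 2 = 2 - 2 * cos x"
    by (simp_all add: cmod_power2 cis_conv_exp[symmetric])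
qed

text \<open>Both 0 and the logarithm i \<theta> lie on the imaginary axis, where exp (a w) has norm
  1. The single values are bounded over a full vertical period, the difference by the mean value
  estimate on the segment between the two points.\<close>

lemma hyp_bounds_circle:
  fixes a \<theta> :: real
  assumes a: "0 < a" "a \<le> 1 / 3" and \<theta>: "\<bar>\<theta>\<bar> < pi"
  defines "z \<equiv> exp (\<i> * of_real \<theta>)" and "s \<equiv> exp (\<i> * of_real (\<theta> / 2))" and "za \<equiv> exp (of_real a * (\<i> * of_real \<theta>))"
  shows "norm (hypX (of_real a) r z) \<le> 5 / 4 * hypN a r * norm (1 + s) ^ (2 * r)"
    and "norm (hypY (of_real a) r z) \<le> 5 / 4 * hypN a r * norm (1 + s) ^ (2 * r)"
    and "norm (hypX (of_real a) r z - za * hypY (of_real a) r z) \<le> 5 / 4 * hypN a r * norm (1 - za) * norm (1 - s) ^ (2 * r)"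
proof -
  note ni = unit_fraction_not_int[of a]
  have ni': "complex_of_real a \<notin> \<int>" using a ni by auto
  have c0: "cos (\<theta> / 2) \<ge> 0" using \<theta> by (intro cos_ge_zero) auto
  have N0: "hypN a r \<ge> 1" using a by (intro hypN_ge_1) auto
  define H where "H = hypH (of_real a) r z"
  have HB: "a * norm (H (\<i> * of_real y)) \<le> 5 / 4 * (2 + 2 * cos (\<theta> / 2)) ^ r" for y
    unfolding H_def
  proof (rule hypH_vertical_bound[OF a])
    fix t :: real
    have e: "\<i> * of_real y + \<i> * of_real t = \<i> * complex_of_real (y + t)" by (simp add: algebra_simps)
    have 1: "norm (exp (of_real a * (\<i> * complex_of_real (y + t)))) = 1" by (simp add: norm_exp_eq_Re)
    have "2 * \<bar>cos (\<theta> / 2) - cos (y + t - \<theta> / 2)\<bar> \<le> 2 + 2 * cos (\<theta> / 2)"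
    proof -
      define c where "c = cos (y + t - \<theta> / 2)"
      have "- 1 \<le> c" "c \<le> 1" by (simp_all add: c_def)
      then show ?thesis using c0 unfolding c_def[symmetric] by (auto simp: abs_if)
    qed
    then have "norm ((1 - exp (\<i> * complex_of_real (y + t))) * (1 - z * exp (- (\<i> * complex_of_real (y + t))))) \<le> 2 + 2 * cos (\<theta> / 2)"
      unfolding z_def norm_circle_factor .
    then show "norm (exp (of_real a * (\<i> * of_real y + \<i> * of_real t)) * ((1 - exp (\<i> * of_real y + \<i> * of_real t)) * (1 - z * exp (- (\<i> * of_real y + \<i> * of_real t)))) ^ r) \<le> (2 + 2 * cos (\<theta> / 2)) ^ r"
      unfolding e norm_mult[of "exp _"] 1 norm_power mult_1 by (rule power_mono) simp
  qed
  have P: "norm (1 + s) ^ (2 * r) = (2 + 2 * cos (\<theta> / 2)) ^ r" "norm (1 - s) ^ (2 * r) = (2 - 2 * cos (\<theta> / 2)) ^ r"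
    unfolding power_mult s_def norm_one_pm_exp_i by simp_all
  have za1: "norm za = 1" by (simp add: za_def norm_exp_eq_Re)
  have X: "hypX (of_real a) r z = of_real (a * hypN a r) * H 0"
    using hypH_0[OF ni', of r z] by (simp add: H_def hypN_of_real)
  have Y: "za * hypY (of_real a) r z = of_real (a * hypN a r) * H (\<i> * of_real \<theta>)"
    using hypH_ln[OF ni', of "\<i> * of_real \<theta>" z r] by (simp add: H_def hypN_of_real z_def za_def)
  show "norm (hypX (of_real a) r z) \<le> 5 / 4 * hypN a r * norm (1 + s) ^ (2 * r)"
    using mult_left_mono[OF HB[of 0], of "hypN a r"] N0 a unfolding X P by (simp add: norm_mult mult_ac)
  have "norm (hypY (of_real a) r z) = norm (za * hypY (of_real a) r z)" using za1 by (simp add: norm_mult)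
  then show "norm (hypY (of_real a) r z) \<le> 5 / 4 * hypN a r * norm (1 + s) ^ (2 * r)"
    using mult_left_mono[OF HB[of \<theta>], of "hypN a r"] N0 a unfolding Y P by (simp add: norm_mult mult_ac)
  let ?S = "closed_segment 0 (\<i> * complex_of_real \<theta>)"
  have "norm (H 0 - H (\<i> * of_real \<theta>)) \<le> (2 - 2 * cos (\<theta> / 2)) ^ r * norm (0 - \<i> * complex_of_real \<theta>)"
    unfolding H_def
  proof (rule field_differentiable_bound[of ?S])
    fix w assume "w \<in> ?S"
    then obtain u where u: "0 \<le> u" "u \<le> 1" and "w = (1 - u) *\<^sub>R 0 + u *\<^sub>R (\<i> * of_real \<theta>)" by (auto simp: in_segment)
    then have w: "w = \<i> * of_real (\<theta> * u)" by (simp add: scaleR_conv_of_real algebra_simps)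
    have 1: "norm (exp (of_real a * (\<i> * complex_of_real (\<theta> * u)))) = 1" by (simp add: norm_exp_eq_Re)
    \<comment> \<open>On the segment the angle stays within |\<theta>| / 2 of the midpoint, so its
      cosine is at least cos (\<theta> / 2) and the absolute value can be resolved.\<close>
    have "\<bar>\<theta> * u - \<theta> / 2\<bar> = \<bar>\<theta>\<bar> * \<bar>u - 1 / 2\<bar>" by (simp add: abs_mult[symmetric] algebra_simps)
    also have "\<dots> \<le> \<bar>\<theta>\<bar> * (1 / 2)" using u by (intro mult_left_mono) (auto simp: abs_if)
    finally have "cos \<bar>\<theta> / 2\<bar> \<le> cos \<bar>\<theta> * u - \<theta> / 2\<bar>" using \<theta> by (intro cos_monotone_0_pi_le) auto
    then have "cos (\<theta> / 2) \<le> cos (\<theta> * u - \<theta> / 2)" by (simp only: cos_abs_real)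
    then have "2 * \<bar>cos (\<theta> / 2) - cos (\<theta> * u - \<theta> / 2)\<bar> \<le> 2 - 2 * cos (\<theta> / 2)"
      using cos_le_one[of "\<theta> * u - \<theta> / 2"] by (simp add: abs_if)
    then have "norm ((1 - exp (\<i> * complex_of_real (\<theta> * u))) * (1 - z * exp (- (\<i> * complex_of_real (\<theta> * u))))) \<le> 2 - 2 * cos (\<theta> / 2)"
      unfolding z_def norm_circle_factor .
    then show "norm (exp (of_real a * w) * ((1 - exp w) * (1 - z * exp (- w))) ^ r) \<le> (2 - 2 * cos (\<theta> / 2)) ^ r"
      unfolding w norm_mult[of "exp _"] 1 norm_power mult_1 by (rule power_mono) simp
  qed (auto intro: hypH_has_field_derivative[OF ni'])
  then have D: "norm (H 0 - H (\<i> * of_real \<theta>)) \<le> (2 - 2 * cos (\<theta> / 2)) ^ r * \<bar>\<theta>\<bar>" by (simp add: norm_mult)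
  \<comment> \<open>The mean value estimate yields the arc length a |\<theta>|, while the claim has
    the chord |1 - za|; the sine bound costs the factor 5/4.\<close>
  have "norm (1 - za) = norm (exp (\<i> * of_real (a * \<theta>)) - 1)" by (simp add: za_def mult_ac norm_minus_commute)
  also have "\<dots> = 2 * \<bar>sin (a * \<theta> / 2)\<bar>" by (rule dist_exp_i_1)
  also have "\<bar>sin (a * \<theta> / 2)\<bar> = \<bar>sin (a * \<bar>\<theta>\<bar> / 2)\<bar>" by (cases "\<theta> \<ge> 0") auto
  finally have nza: "norm (1 - za) = 2 * \<bar>sin (a * \<bar>\<theta>\<bar> / 2)\<bar>" .
  have a\<theta>: "a * \<bar>\<theta>\<bar> \<le> (1 / 3) * pi" using a \<theta> by (intro mult_mono) auto
  have "4 / 5 * (a * \<bar>\<theta>\<bar> / 2) \<le> sin (a * \<bar>\<theta>\<bar> / 2)" 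
  proof (rule four_fifths_le_sin[rotated])
    show "a * \<bar>\<theta>\<bar> / 2 \<le> pi / 3" using a\<theta> pi_gt_zero by linarith
  qed (use a in auto)
  then have za2: "a * \<bar>\<theta>\<bar> \<le> 5 / 4 * norm (1 - za)" using nza by auto
  have "norm (hypX (of_real a) r z - za * hypY (of_real a) r z) = a * hypN a r * norm (H 0 - H (\<i> * of_real \<theta>))"
    unfolding X Y right_diff_distrib[symmetric] using a N0 by (simp add: norm_mult)
  also have "\<dots> \<le> a * hypN a r * ((2 - 2 * cos (\<theta> / 2)) ^ r * \<bar>\<theta>\<bar>)"
    using a N0 by (intro mult_left_mono D) auto
  also have "\<dots> = hypN a r * (2 - 2 * cos (\<theta> / 2)) ^ r * (a * \<bar>\<theta>\<bar>)" by simp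
  also have "\<dots> \<le> hypN a r * (2 - 2 * cos (\<theta> / 2)) ^ r * (5 / 4 * norm (1 - za))"
    using N0 by (intro mult_left_mono za2) auto
  finally show "norm (hypX (of_real a) r z - za * hypY (of_real a) r z) \<le> 5 / 4 * hypN a r * norm (1 - za) * norm (1 - s) ^ (2 * r)"
    unfolding P by (simp add: mult_ac)
qed

text \<open>On [ln x, 0] the kernel (1 - exp w) (1 - x exp (-w)) lies between 0 and (1 - s)^2, the
  maximum being attained at w = ln s. So \<open>hypH\<close> is monotone there, which gives the
  signs. The last claim moves the value at ln x to ln s, in preparation for a better vertical
  line.\<close>

lemma hyp_bounds_real:
  fixes a x s :: real
  assumes a: "0 < a" "a < 1" and s: "0 < s" "s < 1" and x: "x = s ^ 2"
  shows "0 \<le> hypX a r x" "0 \<le> hypY a r x" "x powr a * hypY a r x \<le> hypX a r x"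
    and "hypX a r x - x powr a * hypY a r x \<le> hypN a r * (1 - x powr a) * (1 - s) ^ (2 * r)"
    and "x powr a * hypY a r x \<le> a * hypN a r * hypH a r x (ln s)"
proof -
  have ni: "a \<notin> \<int>" using a unit_fraction_not_int[of a] by auto
  have N0: "hypN a r \<ge> 1" using a by (intro hypN_ge_1) auto
  have "s * s < 1 * 1" using s by (intro mult_strict_mono) auto
  then have x0: "0 < x" "x < 1" using s by (auto simp: x power2_eq_square)
  have lx: "ln x = 2 * ln s" using s by (simp add: x ln_realpow)
  have ls: "ln x \<le> ln s" "ln s \<le> 0" using s by (auto simp: lx)
  define H where "H = hypH a r x"
  have d: "0 \<le> (1 - exp w) * (1 - x * exp (- w)) \<and> (1 - exp w) * (1 - x * exp (- w)) \<le> (1 - s) ^ 2"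
    if "ln x \<le> w" "w \<le> 0" for w
  proof
    have "x \<le> exp w" using that x0 by (metis exp_le_cancel_iff exp_ln)
    then have "x * exp (- w) \<le> 1" by (simp add: exp_minus field_simps)
    then show "0 \<le> (1 - exp w) * (1 - x * exp (- w))" using that by (intro mult_nonneg_nonneg) auto
    have "(1 - s) ^ 2 - (1 - exp w) * (1 - x * exp (- w)) = (exp w - s) ^ 2 * exp (- w)"
      by (simp add: x power2_eq_square exp_minus field_simps)
    moreover have "(exp w - s) ^ 2 * exp (- w) \<ge> 0" by simp
    ultimately show "(1 - exp w) * (1 - x * exp (- w)) \<le> (1 - s) ^ 2" by linarith
  qed
  have mono: "H u \<le> H v" if "ln x \<le> u" "u \<le> v" "v \<le> 0" for u v
  proof (rule DERIV_nonneg_imp_nondecreasing[OF that(2)])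
    fix w assume "u \<le> w" "w \<le> v"
    then show "\<exists>y. DERIV H w :> y \<and> y \<ge> 0"
      unfolding H_def using d[of w] that
      by (intro exI[of _ "exp (a * w) * ((1 - exp w) * (1 - x * exp (- w))) ^ r"] conjI hypH_has_field_derivative ni) auto
  qed
  define S where "S = ((1 - s) ^ 2) ^ r"
  \<comment> \<open>Comparing \<open>H\<close> with a primitive of the majorant S exp (a w), instead
    of using the length of the interval, produces the factor 1 - x powr a exactly.\<close>
  define F where "F w = S * exp (a * w) / a - H w" for w
  have "F (ln x) \<le> F 0"
  proof (rule DERIV_nonneg_imp_nondecreasing[of "ln x" 0 F])
    fix w assume w: "ln x \<le> w" "w \<le> 0"
    have "((1 - exp w) * (1 - x * exp (- w))) ^ r \<le> S"
      unfolding S_def using d[OF w] by (intro power_mono) auto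
    then have "0 \<le> exp (a * w) * S - exp (a * w) * ((1 - exp w) * (1 - x * exp (- w))) ^ r" by simp
    moreover have "(F has_real_derivative (exp (a * w) * S - exp (a * w) * ((1 - exp w) * (1 - x * exp (- w))) ^ r)) (at w)"
      unfolding H_def F_def using a
      by (auto intro!: derivative_eq_intros hypH_has_field_derivative ni)
    ultimately show "\<exists>y. (F has_real_derivative y) (at w) \<and> 0 \<le> y" by blast
  qed (use ls in auto)
  moreover have xa: "x powr a = exp (a * ln x)" using x0 by (simp add: powr_def)
  ultimately have "H 0 - H (ln x) \<le> S * (1 - x powr a) / a"
    by (simp add: F_def diff_divide_distrib right_diff_distrib)
  then have D: "a * hypN a r * (H 0 - H (ln x)) \<le> a * hypN a r * (S * (1 - x powr a) / a)"
    using a N0 by (intro mult_left_mono) auto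
  have X: "hypX a r x = a * hypN a r * H 0"
    using hypH_0[OF ni, of r x] by (simp add: H_def)
  have Y: "x powr a * hypY a r x = a * hypN a r * H (ln x)"
    using hypH_ln[OF ni, of "ln x" x r] x0 by (simp add: H_def xa)
  show "hypX a r x - x powr a * hypY a r x \<le> hypN a r * (1 - x powr a) * (1 - s) ^ (2 * r)"
  proof -
    have "a * hypN a r * (S * (1 - x powr a) / a) = hypN a r * (1 - x powr a) * (1 - s) ^ (2 * r)"
      using a by (simp add: S_def power_mult)
    with D show ?thesis unfolding X Y by (simp add: right_diff_distrib)
  qed
  show "x powr a * hypY a r x \<le> hypX a r x"
    unfolding X Y using mono[of "ln x" 0] ls a N0 by (intro mult_left_mono) auto
  show "x powr a * hypY a r x \<le> a * hypN a r * hypH a r x (ln s)"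
    unfolding Y H_def[symmetric] using mono[of "ln x" "ln s"] ls a N0 by (intro mult_left_mono) auto
  have cf: "0 \<le> hyp_coeff a r k" for k
    unfolding hyp_coeff_def using a by (intro divide_nonneg_nonneg mult_nonneg_nonneg pochhammer_nonneg) auto
  show "0 \<le> hypX a r x" "0 \<le> hypY a r x"
    unfolding hypX_def hypY_def using cf x0 by (auto intro!: sum_nonneg)
qed

text \<open>On the line Re w = ln s both exp w and x exp (-w) have norm \<open>s\<close>, so each
  factor of the kernel is at most 1 + s. The line through ln x would give a worse rate, hence the
  shift by monotonicity.\<close>

lemma hypY_bound_real:
  fixes a x s :: real
  assumes a: "0 < a" "a \<le> 1 / 3" and s: "0 < s" "s < 1" and x: "x = s ^ 2"
  shows "x powr a * hypY a r x \<le> 5 / 4 * hypN a r * s powr a * (1 + s) ^ (2 * r)"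
proof -
  have N0: "hypN a r \<ge> 1" using a by (intro hypN_ge_1) auto
  have "a * norm (hypH (complex_of_real a) r (of_real x) (of_real (ln s))) \<le> 5 / 4 * (s powr a * ((1 + s) ^ 2) ^ r)"
  proof (rule hypH_vertical_bound[OF a])
    fix t :: real
    define w where "w = complex_of_real (ln s) + \<i> * of_real t"
    have e: "exp w = of_real s * cis t"
      unfolding w_def exp_add cis_conv_exp exp_of_real using s by simp
    have e': "of_real x * exp (- w) = of_real s * cis (- t)"
      unfolding exp_minus e using s by (simp add: x power2_eq_square cis_inverse[symmetric] field_simps)
    have 1: "norm (exp (complex_of_real a * w)) = s powr a"
      using s by (simp add: norm_exp_eq_Re w_def powr_def)
    have "norm (1 - exp w) \<le> 1 + s" "norm (1 - of_real x * exp (- w)) \<le> 1 + s"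
      unfolding e' unfolding e using s norm_triangle_ineq4[of 1 "of_real s * cis t"] norm_triangle_ineq4[of 1 "of_real s * cis (- t)"]
      by (simp_all add: norm_mult)
    then have "norm ((1 - exp w) * (1 - of_real x * exp (- w))) \<le> (1 + s) * (1 + s)"
      unfolding norm_mult by (intro mult_mono) (use s in auto)
    then show "norm (exp (complex_of_real a * (of_real (ln s) + \<i> * of_real t)) * ((1 - exp (of_real (ln s) + \<i> * of_real t)) * (1 - of_real x * exp (- (of_real (ln s) + \<i> * of_real t)))) ^ r) \<le> s powr a * ((1 + s) ^ 2) ^ r"
      unfolding w_def[symmetric] norm_mult[of "exp _"] 1 norm_power
      by (intro mult_left_mono power_mono) (simp_all add: power2_eq_square)
  qed
  then have "a * hypH a r x (ln s) \<le> 5 / 4 * (s powr a * ((1 + s) ^ 2) ^ r)"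
    unfolding hypH_of_real norm_of_real using a
    by (meson abs_ge_self mult_left_mono order_trans less_imp_le)
  then have "hypN a r * (a * hypH a r x (ln s)) \<le> hypN a r * (5 / 4 * (s powr a * ((1 + s) ^ 2) ^ r))"
    using N0 by (intro mult_left_mono) auto
  with hyp_bounds_real(5)[of a s x r] a s x show ?thesis
    unfolding power_mult by (simp add: mult_ac)
qed

text \<open>The lower bound on \<open>csqrt W\<close> in the real case keeps \<open>W\<close> away from \<open>0\<close>, where the bound on
  \<open>hypY\<close> fails.\<close>

lemma hyp_bounds:
  fixes W :: complex and a :: real and r :: nat
  assumes a: "0 < a" "a \<le> 1 / 3"
    and W: "(W \<in> \<real> \<and> 0 < Re W \<and> Re W < 1 \<and> 1 / 27 \<le> Re (csqrt W)) \<or> (cmod W = 1 \<and> W \<noteq> -1)"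
  defines "N \<equiv> hypN a r" and "X \<equiv> hypX (of_real a) r W" and "Y \<equiv> hypY (of_real a) r W"
  shows "norm X \<le> 15 / 4 * N * norm (1 + csqrt W) ^ (2 * r)"
    and "norm Y \<le> 15 / 4 * N * norm (1 + csqrt W) ^ (2 * r)"
    and "norm (X - W powr of_real a * Y) \<le> 5 / 4 * N * norm (1 - W powr of_real a) * norm (1 - csqrt W) ^ (2 * r)"
proof -
  have N0: "N \<ge> 1" using a by (auto simp: N_def intro: hypN_ge_1)
  have "norm X \<le> 15 / 4 * N * norm (1 + csqrt W) ^ (2 * r) \<and>
    norm Y \<le> 15 / 4 * N * norm (1 + csqrt W) ^ (2 * r) \<and>
    norm (X - W powr of_real a * Y) \<le> 5 / 4 * N * norm (1 - W powr of_real a) * norm (1 - csqrt W) ^ (2 * r)"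
    using W
  proof
    assume c: "cmod W = 1 \<and> W \<noteq> -1"
    then have W0: "W \<noteq> 0" by auto
    define \<theta> where "\<theta> = Im (Ln W)"
    have "Re (Ln W) = 0" using c W0 by simp
    then have L: "Ln W = \<i> * of_real \<theta>" by (simp add: complex_eq_iff \<theta>_def)
    have eW: "exp (\<i> * of_real \<theta>) = W" using W0 L by (metis exp_Ln)
    have "\<theta> \<noteq> pi" using eW c by auto
    moreover have "- pi < \<theta>" "\<theta> \<le> pi" using mpi_less_Im_Ln[OF W0] Im_Ln_le_pi[OF W0] by (auto simp: \<theta>_def)
    ultimately have \<theta>: "\<bar>\<theta>\<bar> < pi" by auto
    have s: "csqrt W = exp (\<i> * of_real (\<theta> / 2))" using csqrt_exp_Ln[OF W0] L by simp
    have za: "W powr of_real a = exp (of_real a * (\<i> * of_real \<theta>))" using W0 L by (simp add: powr_def)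
    note B = hyp_bounds_circle[OF a \<theta>, of r, unfolded eW, folded s za X_def Y_def N_def]
    have "5 / 4 * N * norm (1 + csqrt W) ^ (2 * r) \<le> 15 / 4 * N * norm (1 + csqrt W) ^ (2 * r)"
      using N0 by (intro mult_right_mono) auto
    with B show ?thesis by linarith
  next
    assume c: "W \<in> \<real> \<and> 0 < Re W \<and> Re W < 1 \<and> 1 / 27 \<le> Re (csqrt W)"
    define x where "x = Re W"
    have x: "0 < x" "x < 1" and Wx: "W = of_real x" using c by (auto simp: x_def)
    define s where "s = sqrt x"
    have s: "0 < s" "s < 1" "x = s ^ 2" using x by (auto simp: s_def real_sqrt_lt_1_iff)
    have cs: "csqrt W = of_real s" using x by (simp add: Wx s_def)
    have s27: "1 / 27 \<le> s" using c cs by simp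
    have za: "W powr of_real a = of_real (x powr a)" using x by (simp add: Wx powr_of_real)
    have a1: "a < 1" using a by simp
    have XY: "X = of_real (hypX a r x)" "Y = of_real (hypY a r x)"
      by (simp_all add: X_def Y_def Wx hypX_of_real hypY_of_real)
    note B = hyp_bounds_real[OF a(1) a1 s, of r] hypY_bound_real[OF a s, of r]
    have P: "norm (1 + csqrt W) = 1 + s" "norm (1 - csqrt W) = 1 - s"
    proof -
      have "1 + csqrt W = of_real (1 + s)" "1 - csqrt W = of_real (1 - s)" using cs by simp_all
      then show "norm (1 + csqrt W) = 1 + s" "norm (1 - csqrt W) = 1 - s"
        using s by (simp_all only: norm_of_real)
    qed
    have xa: "0 < x powr a" "x powr a \<le> 1" using x a by (auto intro: powr_le1)
    have "x powr a = s powr a * s powr a" using s by (simp add: power2_eq_square powr_mult)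
    then have "s powr a * (s powr a * hypY a r x) \<le> s powr a * (5 / 4 * N * (1 + s) ^ (2 * r))"
      using B(6) by (simp add: N_def mult_ac)
    then have Y1: "s powr a * hypY a r x \<le> 5 / 4 * N * (1 + s) ^ (2 * r)"
      using s by (simp only: mult_le_cancel_left_pos powr_gt_zero)
    \<comment> \<open>Dividing the bound on s powr a * Y by s powr a costs at most 3, since a \<le>
      1/3 and s \<ge> 1/27; this makes 15/4 out of 5/4.\<close>
    have "1 / 3 \<le> s powr a"
    proof -
      have "(1 / 3) = (1 / 27) powr (1 / 3 :: real)"
        using powr_powr[of "1 / 3" "3 :: real" "1 / 3"] by (simp add: powr_numeral power3_eq_cube)
      also have "\<dots> \<le> s powr (1 / 3)" using s27 by (intro powr_mono2) auto
      also have "\<dots> \<le> s powr a" using s a by (intro powr_mono') auto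
      finally show ?thesis .
    qed
    then have "1 / 3 * hypY a r x \<le> s powr a * hypY a r x" using B(2) by (intro mult_right_mono) auto
    with Y1 have Y2: "hypY a r x \<le> 15 / 4 * N * (1 + s) ^ (2 * r)" by linarith
    have sa1: "s powr a \<le> 1" using s a by (auto intro: powr_le1)
    have "s powr a * (5 / 4 * N * (1 + s) ^ (2 * r)) \<le> 1 * (5 / 4 * N * (1 + s) ^ (2 * r))"
      using sa1 N0 s by (intro mult_right_mono) auto
    then have X1: "x powr a * hypY a r x \<le> 5 / 4 * N * (1 + s) ^ (2 * r)"
      using B(6) by (simp add: N_def mult_ac)
    have "N * (1 - x powr a) * (1 - s) ^ (2 * r) \<le> N * 1 * (1 + s) ^ (2 * r)"
      using N0 xa s by (intro mult_mono power_mono) auto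
    \<comment> \<open>9/4 = 5/4 + 1: the bound on x powr a * Y plus that on the remainder.\<close>
    then have X2: "hypX a r x \<le> 9 / 4 * N * (1 + s) ^ (2 * r)" using X1 B(4) by (simp add: N_def)
    have "0 \<le> N * (1 + s) ^ (2 * r)" using N0 s by simp
    with X2 have X3: "hypX a r x \<le> 15 / 4 * N * (1 + s) ^ (2 * r)" by linarith
    have "0 \<le> N * (1 - x powr a) * (1 - s) ^ (2 * r)" using N0 xa s by simp
    with B(4) have D: "hypX a r x - x powr a * hypY a r x \<le> 5 / 4 * N * (1 - x powr a) * (1 - s) ^ (2 * r)"
      unfolding N_def by linarith
    have e: "X - W powr of_real a * Y = of_real (hypX a r x - x powr a * hypY a r x)"
      "1 - W powr of_real a = of_real (1 - x powr a)" by (simp_all add: XY za)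
    have "norm (X - W powr of_real a * Y) = hypX a r x - x powr a * hypY a r x"
      using B(3) by (simp only: e norm_of_real)
    moreover have "norm (1 - W powr of_real a) = 1 - x powr a"
      using xa by (simp only: e norm_of_real)
    ultimately show ?thesis unfolding P using D X3 Y2 B(1,2) by (simp add: XY)
  qed
  then show "norm X \<le> 15 / 4 * N * norm (1 + csqrt W) ^ (2 * r)"
    and "norm Y \<le> 15 / 4 * N * norm (1 + csqrt W) ^ (2 * r)"
    and "norm (X - W powr of_real a * Y) \<le> 5 / 4 * N * norm (1 - W powr of_real a) * norm (1 - csqrt W) ^ (2 * r)"
    by auto
qed

section \<open>Consecutive approximants are independent\<close>

text \<open>After division by the exact power of 1 - x, the cofactor would still tend to 0 as x
  tends to 1 from the left, and hence vanish at 1. A one-sided bound suffices, which is all that the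
  estimates on (0, 1) provide.\<close>

lemma le_order_if_bound:
  fixes p :: "real poly"
  assumes p: "p \<noteq> 0" and B: "\<And>x. 0 < x \<Longrightarrow> x < 1 \<Longrightarrow> \<bar>poly p x\<bar> \<le> B * (1 - x) ^ k"
  shows "k \<le> order 1 p"
proof (rule ccontr)
  assume "\<not> k \<le> order 1 p"
  then obtain m where k: "k = order 1 p + Suc m" using less_imp_Suc_add by (metis not_le add_Suc_right)
  obtain q where q: "p = [:- 1, 1:] ^ order 1 p * q" "\<not> [:- 1, 1:] dvd q"
    using order_decomp[OF p] by blast
  have qb: "\<bar>poly q x\<bar> \<le> B * (1 - x) ^ Suc m" if "0 < x" "x < 1" for x
  proof -
    have "\<bar>poly p x\<bar> = (1 - x) ^ order 1 p * \<bar>poly q x\<bar>"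
      using that by (subst q(1)) (simp add: abs_mult power_abs)
    then have "(1 - x) ^ order 1 p * \<bar>poly q x\<bar> \<le> (1 - x) ^ order 1 p * (B * (1 - x) ^ Suc m)"
      using B[OF that] by (simp add: k power_add mult_ac)
    then show ?thesis using that by (simp only: mult_le_cancel_left_pos zero_less_power diff_gt_0_iff_gt)
  qed
  have "\<bar>poly q 1\<bar> \<le> B * (1 - 1) ^ Suc m"
  proof (rule tendsto_le[of "at_left 1"])
    show "((\<lambda>x. B * (1 - x) ^ Suc m) \<longlongrightarrow> B * (1 - 1) ^ Suc m) (at_left (1::real))"
      by (intro tendsto_intros)
    show "((\<lambda>x. \<bar>poly q x\<bar>) \<longlongrightarrow> \<bar>poly q 1\<bar>) (at_left (1::real))"
      by (intro tendsto_intros)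
    show "\<forall>\<^sub>F x in at_left (1::real). \<bar>poly q x\<bar> \<le> B * (1 - x) ^ Suc m"
      using eventually_at_left_real[of 0 "1 :: real", simplified] by eventually_elim (use qb in auto)
  qed simp
  then have "poly q 1 = 0" by simp
  with q(2) show False by (simp add: poly_eq_0_iff_dvd)
qed

text \<open>Serves to carry polynomial identities from the reals or rationals to the complex
  numbers: at natural numbers the embeddings commute with everything.\<close>

lemma poly_eqI_nat:
  fixes p q :: "'a::field_char_0 poly"
  assumes "\<And>m::nat. poly p (of_nat m) = poly q (of_nat m)"
  shows "p = q"
proof (rule ccontr)
  assume "p \<noteq> q"
  then have "finite {x. poly (p - q) x = 0}" by (intro poly_roots_finite) simp
  moreover have "range of_nat \<subseteq> {x. poly (p - q) x = 0}" using assms by auto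
  ultimately have "finite (range (of_nat :: nat \<Rightarrow> 'a))" by (rule rev_finite_subset)
  then show False using finite_imageD[of "of_nat :: nat \<Rightarrow> 'a" UNIV] by (simp add: inj_on_def)
qed

section \<open>The approximants as polynomials and their determinant\<close>

definition hypX_poly :: "'a::field_char_0 \<Rightarrow> nat \<Rightarrow> 'a poly" where
  "hypX_poly a r = (\<Sum>k\<le>r. monom (hyp_coeff a r k) k)"

definition hypY_poly :: "'a::field_char_0 \<Rightarrow> nat \<Rightarrow> 'a poly" where
  "hypY_poly a r = (\<Sum>k\<le>r. monom (hyp_coeff a r k) (r - k))"

lemma poly_hyp_poly: "poly (hypX_poly a r) z = hypX a r z" "poly (hypY_poly a r) z = hypY a r z"
  by (simp_all add: hypX_poly_def hypY_poly_def hypX_def hypY_def poly_sum poly_monom)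

lemma degree_hyp_poly: "degree (hypX_poly a r) \<le> r" "degree (hypY_poly a r) \<le> r"
  unfolding hypX_poly_def hypY_poly_def
  by (intro degree_sum_le finite_atMost order_trans[OF degree_monom_le], simp)+

lemma hyp_at_0:
  fixes a :: "'a::field_char_0"
  shows "hypX a r 0 = 1" "hypY a r 0 = hyp_coeff a r r"
proof -
  have "hypX a r 0 = (\<Sum>k\<le>r. if k = 0 then hyp_coeff a r k else 0)"
    unfolding hypX_def by (intro sum.cong) auto
  then show "hypX a r 0 = 1" by (simp add: hyp_coeff_def)
  have "hypY a r 0 = (\<Sum>k\<le>r. if k = r then hyp_coeff a r k else 0)"
    unfolding hypY_def by (intro sum.cong) auto
  then show "hypY a r 0 = hyp_coeff a r r" by simp
qed

text \<open>Replacing \<open>s\<close> by the smaller \<open>x\<close>, and x powr a by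
  \<open>x\<close>, makes the bound a pure power of 1 - x, in the form needed to read off an order
  of vanishing.\<close>

lemma hyp_error_bound:
  fixes a x :: real
  assumes a: "0 < a" "a < 1" and x: "0 < x" "x < 1"
  shows "\<bar>hypX a r x - x powr a * hypY a r x\<bar> \<le> hypN a r * (1 - x) ^ (2 * r + 1)"
proof -
  define s where "s = sqrt x"
  have s: "0 < s" "s < 1" "x = s ^ 2" using x by (auto simp: s_def real_sqrt_lt_1_iff)
  have N0: "hypN a r \<ge> 1" using a by (intro hypN_ge_1) auto
  have "s * s \<le> 1 * s" using s by (intro mult_right_mono) auto
  then have "x \<le> s" using s by (simp add: power2_eq_square)
  have "x powr 1 \<le> x powr a" using a x by (intro powr_mono') auto
  then have 1: "1 - x powr a \<le> 1 - x" using x by simp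
  have 2: "0 \<le> 1 - x powr a" using x a by (auto intro: powr_le1)
  have "\<bar>hypX a r x - x powr a * hypY a r x\<bar> = hypX a r x - x powr a * hypY a r x"
    using hyp_bounds_real(3)[OF a s, of r] by simp
  also have "\<dots> \<le> hypN a r * (1 - x powr a) * (1 - s) ^ (2 * r)" by (rule hyp_bounds_real(4)[OF a s])
  also have "\<dots> \<le> hypN a r * (1 - x) * (1 - x) ^ (2 * r)"
    using N0 1 2 s x \<open>x \<le> s\<close> by (intro mult_mono power_mono) auto
  finally show ?thesis by simp
qed

text \<open>The approximation error forces a zero of order \<open>2 r + 1\<close> at \<open>1\<close>, which is also the largest possible
  degree, so the determinant is a multiple of \<open>(1 - z)\<close> to that power; its value at \<open>0\<close> is not zero.\<close>

lemma hyp_determinant_nonzero: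
  fixes a :: real and z :: complex
  assumes a: "0 < a" "a < 1" and z: "z \<noteq> 1"
  shows "hypX (of_real a) r z * hypY (of_real a) (Suc r) z \<noteq> hypX (of_real a) (Suc r) z * hypY (of_real a) r z"
proof -
  define P :: "real poly" where "P = hypX_poly a r * hypY_poly a (Suc r) - hypX_poly a (Suc r) * hypY_poly a r"
  have Pp: "poly P x = hypX a r x * hypY a (Suc r) x - hypX a (Suc r) x * hypY a r x" for x
    by (simp add: P_def poly_hyp_poly)
  have deg: "degree P \<le> 2 * r + 1"
    unfolding P_def
    by (intro degree_diff_le order_trans[OF degree_mult_le])
       (use degree_hyp_poly[of a r] degree_hyp_poly[of a "Suc r"] in auto)
  have pos: "0 < pochhammer (1 - a) k" "0 < pochhammer (a + 1) k" for k
    using a by (auto intro!: pochhammer_pos)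
  \<comment> \<open>Both X polynomials are 1 at 0, so the determinant there is the difference of two
    consecutive top coefficients, whose quotient exceeds 1 by 2 a / (1 - a + r).\<close>
  have "poly P 0 = hyp_coeff a (Suc r) (Suc r) - hyp_coeff a r r"
    by (simp add: Pp hyp_at_0)
  also have "hyp_coeff a (Suc r) (Suc r) = hyp_coeff a r r * ((a + 1 + real r) / (1 - a + real r))"
    by (simp add: hyp_coeff_def pochhammer_Suc)
  also have "\<dots> - hyp_coeff a r r = hyp_coeff a r r * (2 * a / (1 - a + real r))"
    using a by (simp add: field_simps)
  also have "\<dots> \<noteq> 0" using a pos[of r] by (simp add: hyp_coeff_def)
  finally have P0: "P \<noteq> 0" by auto
  define B where "B = hypN a r * hypY a (Suc r) 1 + hypN a (Suc r) * hypY a r 1"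
  have cf: "0 \<le> hyp_coeff a r k" for k r
    unfolding hyp_coeff_def using a by (intro divide_nonneg_nonneg mult_nonneg_nonneg pochhammer_nonneg) auto
  have N0: "hypN a k \<ge> 1" for k using a by (intro hypN_ge_1) auto
  have "2 * r + 1 \<le> order 1 P"
  proof (rule le_order_if_bound[OF P0])
    fix x :: real assume x: "0 < x" "x < 1"
    have Yb: "hypY a k x \<le> hypY a k 1" "0 \<le> hypY a k x" for k
      unfolding hypY_def using x cf by (auto intro!: sum_mono sum_nonneg mult_left_le power_le_one)
    define e where "e k = hypX a k x - x powr a * hypY a k x" for k
    have e: "\<bar>e k\<bar> \<le> hypN a k * (1 - x) ^ (2 * k + 1)" for k
      unfolding e_def by (rule hyp_error_bound[OF a x])
    have "(1 - x) ^ (2 * Suc r + 1) \<le> (1 - x) ^ (2 * r + 1)" using x by (intro power_decreasing) auto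
    then have "hypN a (Suc r) * (1 - x) ^ (2 * Suc r + 1) \<le> hypN a (Suc r) * (1 - x) ^ (2 * r + 1)"
      using N0[of "Suc r"] by (intro mult_left_mono) auto
    then have e': "\<bar>e (Suc r)\<bar> \<le> hypN a (Suc r) * (1 - x) ^ (2 * r + 1)" using e[of "Suc r"] by linarith
    \<comment> \<open>The terms with x powr a cancel, so the determinant is linear in the two
      errors.\<close>
    have "poly P x = e r * hypY a (Suc r) x - e (Suc r) * hypY a r x"
      by (simp add: Pp e_def algebra_simps)
    then have "\<bar>poly P x\<bar> \<le> \<bar>e r\<bar> * hypY a (Suc r) x + \<bar>e (Suc r)\<bar> * hypY a r x"
      using Yb by (simp add: abs_mult[symmetric] order_trans[OF abs_triangle_ineq4] abs_mult)
    also have "\<dots> \<le> (hypN a r * (1 - x) ^ (2 * r + 1)) * hypY a (Suc r) 1 + (hypN a (Suc r) * (1 - x) ^ (2 * r + 1)) * hypY a r 1"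
      using Yb e[of r] e' N0[of r] N0[of "Suc r"] x by (intro add_mono mult_mono) auto
    also have "\<dots> = B * (1 - x) ^ (2 * r + 1)" by (simp add: B_def algebra_simps)
    finally show "\<bar>poly P x\<bar> \<le> B * (1 - x) ^ (2 * r + 1)" .
  qed
  then have "[:- 1, 1:] ^ (2 * r + 1) dvd P" using order_divides[of 1 "2 * r + 1" P] by blast
  then obtain q where q: "P = [:- 1, 1:] ^ (2 * r + 1) * q" by (elim dvdE)
  then have "q \<noteq> 0" using P0 by auto
  have nz: "[:- 1, 1 :: real:] ^ (2 * r + 1) \<noteq> 0" by (subst power_eq_0_iff) simp
  have "degree P = degree ([:- 1, 1 :: real:] ^ (2 * r + 1)) + degree q"
    unfolding q using nz \<open>q \<noteq> 0\<close> by (rule degree_mult_eq)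
  also have "degree ([:- 1, 1 :: real:] ^ (2 * r + 1)) = 2 * r + 1" by (subst degree_power_eq) auto
  finally have "degree q = 0" using deg by simp
  then obtain c where c: "q = [:c:]" by (auto elim: degree_eq_zeroE)
  then have c0: "c \<noteq> 0" using \<open>q \<noteq> 0\<close> by auto
  let ?a = "complex_of_real a"
  have "hypX_poly ?a r * hypY_poly ?a (Suc r) - hypX_poly ?a (Suc r) * hypY_poly ?a r = smult (of_real c) ([:- 1, 1:] ^ (2 * r + 1))"
  proof (rule poly_eqI_nat)
    fix m :: nat
    have "poly P (real m) = c * (real m - 1) ^ (2 * r + 1)"
    proof -
      have "poly ([:- 1, 1:] ^ k * [:c:]) y = c * (y - 1) ^ k" for k and y :: real by simp
      then show ?thesis unfolding q c .
    qed
    then have "complex_of_real (hypX a r (real m) * hypY a (Suc r) (real m) - hypX a (Suc r) (real m) * hypY a r (real m)) = of_real (c * (real m - 1) ^ (2 * r + 1))"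
      by (simp only: Pp)
    then show "poly (hypX_poly ?a r * hypY_poly ?a (Suc r) - hypX_poly ?a (Suc r) * hypY_poly ?a r) (of_nat m) = poly (smult (of_real c) ([:- 1, 1:] ^ (2 * r + 1))) (of_nat m)"
      using hypX_of_real[of a _ "real m"] hypY_of_real[of a _ "real m"]
      by (simp add: poly_hyp_poly del: power_Suc)
  qed
  note e = arg_cong[OF this, of "\<lambda>p. poly p z"]
  have "poly (smult (of_real c) ([:- 1, 1:] ^ k)) z = of_real c * (z - 1) ^ k" for k by simp
  with e  have "hypX ?a r z * hypY ?a (Suc r) z - hypX ?a (Suc r) z * hypY ?a r z = of_real c * (z - 1) ^ (2 * r + 1)"
    by (simp only: poly_hyp_poly poly_diff poly_mult)
  also have "\<dots> \<noteq> 0" using c0 z by simp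
  finally show ?thesis by simp
qed

section \<open>Growth of the common denominators\<close>

text \<open>\<open>hypV n r\<close> is n^r (1 - 1/n)_r, and \<open>hypT r\<close> is (2r)! / r!.
  Together with n^r they make up the value of X at 1.\<close>

definition hypV :: "nat \<Rightarrow> nat \<Rightarrow> nat" where "hypV n r = (\<Prod>j<r. n * Suc j - 1)"
definition hypT :: "nat \<Rightarrow> nat" where "hypT r = (\<Prod>j<r. 4 * j + 2)"

lemma coprime_hypV: "n > 0 \<Longrightarrow> coprime (hypV n r) n"
  unfolding hypV_def
proof (intro prod_coprime_left)
  fix j assume "n > 0"
  then have "coprime (n * Suc j - 1) (n * Suc j)" by (intro coprime_diff_one_left_nat) simp
  then show "coprime (n * Suc j - 1) n" by (simp only: coprime_mult_right_iff)
qed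

text \<open>Among three consecutive factors of \<open>hypT\<close> the middle one is 12 s +
  6.\<close>

lemma three_power_dvd_hypT: "3 ^ s dvd hypT (3 * s)"
proof (induction s)
  case (Suc s)
  have "hypT (3 * Suc s) = hypT (3 * s) * ((4 * (3 * s) + 2) * (4 * (3 * s + 1) + 2) * (4 * (3 * s + 2) + 2))"
    by (simp add: hypT_def numeral_3_eq_3 algebra_simps)
  also have "\<dots> = 3 * (hypT (3 * s) * ((4 * (3 * s) + 2) * (4 * s + 2) * (4 * (3 * s + 2) + 2)))"
    by (simp add: algebra_simps)
  finally show ?case using Suc by (simp add: mult_dvd_mono)
qed simp

lemma two_power_dvd_hypT: "2 ^ r dvd hypT r"
proof -
  have "(\<Prod>j<r. 2) dvd hypT r" unfolding hypT_def by (intro prod_dvd_prod) auto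
  then show ?thesis by simp
qed

lemma hypT_pos: "hypT r > 0" by (simp add: hypT_def)

text \<open>Since \<open>hypV n r\<close> is coprime to \<open>n\<close>, the powers of \<open>2\<close> and \<open>3\<close> in \<open>hypT r\<close> can be discarded for
  \<open>n = 4\<close> and \<open>n = 3\<close>; the growth in these cases comes only from this.\<close>

lemma denominator_growth_aux:
  assumes dv: "hypV n r dvd K * hypT r * n ^ r" and K: "K > 0" and n: "n > 0"
    and e: "e dvd hypT r" "coprime (hypV n r) e" and m: "\<And>j. (4 * j + 2) * m \<le> (n * Suc j - 1) * 4"
  shows "e * m ^ r \<le> K * 4 ^ r"
proof -
  obtain T where T: "hypT r = e * T" using e by (elim dvdE)
  then have T0: "T > 0" using hypT_pos[of r] by (cases T) auto
  have "coprime (hypV n r) (n ^ r * e)"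
    using coprime_hypV[OF n] e by (simp add: coprime_power_right_iff)
  moreover have "hypV n r dvd (K * T) * (n ^ r * e)" using dv T by (simp add: mult_ac)
  ultimately have "hypV n r dvd K * T" by (simp add: coprime_dvd_mult_left_iff)
  then have V: "hypV n r \<le> K * T" using K T0 by (intro dvd_imp_le) auto
  \<comment> \<open>Factor by factor, \<open>hypV\<close> is at least (m/4)^r times
    \<open>hypT\<close>.\<close>
  have "(\<Prod>j<r. (4 * j + 2) * m) \<le> (\<Prod>j<r. (n * Suc j - 1) * 4)" by (intro prod_mono) (use m in auto)
  then have "hypT r * m ^ r \<le> hypV n r * 4 ^ r" by (simp only: hypT_def hypV_def prod.distrib prod_constant card_lessThan)
  also have "\<dots> \<le> K * T * 4 ^ r" using V by simp
  finally have "T * (e * m ^ r) \<le> T * (K * 4 ^ r)" by (simp add: T mult_ac)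
  then show ?thesis using T0 by simp
qed

text \<open>The rates per unit of \<open>s\<close> are 81/64 for n = 3 (3^3/4^3 from the factors,
  times 3 from the discarded threes), 8 for n = 4, and 125/64 for n \<ge> 5. The case n = 3 fixes
  the constant and also the steps of length three.\<close>

lemma denominator_growth:
  assumes dv: "hypV n (3 * s) dvd K * hypT (3 * s) * n ^ (3 * s)" and K: "K > 0" and n: "n \<ge> 3"
  shows "(81 / 64) ^ s \<le> real K"
proof -
  have 64: "(4::nat) ^ (3 * s) = 64 ^ s" by (simp add: power_mult)
  have "81 ^ s \<le> K * 64 ^ s"
  proof -
    consider "n = 3" | "n = 4" | "n \<ge> 5" using n by linarith
    then show ?thesis
    proof cases
      case 1
      have "3 ^ s * 3 ^ (3 * s) \<le> K * 4 ^ (3 * s)"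
        by (rule denominator_growth_aux[OF dv K _ three_power_dvd_hypT])
           (use 1 coprime_hypV[of 3] in \<open>auto simp: coprime_power_right_iff\<close>)
      moreover have "(3::nat) ^ s * 3 ^ (3 * s) = 81 ^ s" by (simp add: power_mult power_mult_distrib[symmetric])
      ultimately show ?thesis by (simp only: 64)
    next
      case 2
      have "coprime (hypV 4 (3 * s)) (2 ^ 2)" using coprime_hypV[of 4 "3 * s"] by simp
      then have "coprime (hypV 4 (3 * s)) 2" by (simp only: coprime_power_right_iff) simp
      then have "2 ^ (3 * s) * 4 ^ (3 * s) \<le> K * 4 ^ (3 * s)"
        by (intro denominator_growth_aux[OF dv K _ two_power_dvd_hypT])
           (use 2 in \<open>auto simp: coprime_power_right_iff\<close>)
      moreover have "(81::nat) ^ s \<le> 512 ^ s" by (intro power_mono) auto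
      moreover have "(2::nat) ^ (3 * s) * 4 ^ (3 * s) = 512 ^ s" by (simp add: power_mult power_mult_distrib[symmetric])
      ultimately show ?thesis unfolding 64 by linarith
    next
      case 3
      have "1 * 5 ^ (3 * s) \<le> K * 4 ^ (3 * s)"
      proof (rule denominator_growth_aux[OF dv K])
        fix j
        have "5 * Suc j \<le> n * Suc j" using 3 by (intro mult_right_mono) auto
        then show "(4 * j + 2) * 5 \<le> (n * Suc j - 1) * 4" by simp
      qed (use 3 in auto)
      moreover have "(81::nat) ^ s \<le> 125 ^ s" by (intro power_mono) auto
      moreover have "(5::nat) ^ (3 * s) = 125 ^ s" by (simp add: power_mult)
      ultimately show ?thesis unfolding 64 by linarith
    qed
  qed
  then have "real (81 ^ s) \<le> real (K * 64 ^ s)" by (simp only: of_nat_le_iff)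
  then show ?thesis by (simp add: power_divide field_simps)
qed

section \<open>Arithmetic of the hypergeometric polynomials\<close>

lemma hyp_coeff_conv_pochhammer:
  assumes "k \<le> r"
  shows "hyp_coeff a r k = pochhammer (- of_nat r) k * pochhammer (- of_nat r - a) k / (pochhammer (1 - a) k * fact k)"
proof -
  have 1: "of_nat (r choose k) = (-1) ^ k * pochhammer (- of_nat r :: 'a) k / fact k"
    by (simp add: binomial_gbinomial gbinomial_pochhammer)
  have 2: "pochhammer (- of_nat r - a) k = (-1) ^ k * pochhammer (a + of_nat (r - k) + 1) k"
  proof -
    have "- of_nat r - a = - (of_nat r + a)" "of_nat r + a - of_nat k + 1 = a + of_nat (r - k) + 1"
      using assms by (simp_all add: of_nat_diff)
    then show ?thesis by (simp only: pochhammer_minus)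
  qed
  show ?thesis unfolding hyp_coeff_def 1 2 by (simp add: mult_ac)
qed

lemma coeff_X_poly:
  "coeff (X_poly n r) k = (if k \<le> r then hyp_coeff (1 / of_nat n) r k else 0)"
  by (simp add: X_poly_def coeff_sum fps_hypergeo_nth hyp_coeff_conv_pochhammer)

lemma poly_X_poly: "poly (X_poly n r) y = hypX (1 / of_nat n) r y"
proof -
  have "X_poly n r = hypX_poly (1 / of_nat n) r"
    by (rule poly_eqI) (simp add: coeff_X_poly hypX_poly_def coeff_sum)
  then show ?thesis by (simp add: poly_hyp_poly)
qed

lemma degree_X_poly: "degree (X_poly n r) \<le> r"
  by (rule degree_le) (simp add: coeff_X_poly)

lemma hyp_coeff_of_rat:
  "(hyp_coeff (1 / of_nat n) r k :: complex) = of_rat (hyp_coeff (1 / of_nat n) r k)"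
  by (simp add: hyp_coeff_def pochhammer_prod of_rat_divide of_rat_mult of_rat_prod of_rat_add of_rat_diff)

lemma hypX_of_rat: "hypX (1 / of_nat n) r (of_rat y :: complex) = of_rat (hypX (1 / of_nat n) r y)"
  by (simp add: hypX_def hyp_coeff_of_rat of_rat_sum of_rat_mult of_rat_power)

lemma Ints_coeff_mult:
  fixes p q :: "'a::comm_ring_1 poly"
  assumes "\<And>k. coeff p k \<in> \<int>" "\<And>k. coeff q k \<in> \<int>"
  shows "coeff (p * q) k \<in> \<int>"
  unfolding coeff_mult by (intro Ints_sum Ints_mult assms)

lemma Ints_coeff_pcompose:
  fixes p q :: "'a::comm_ring_1 poly"
  assumes "\<And>k. coeff p k \<in> \<int>" and q: "\<And>k. coeff q k \<in> \<int>"
  shows "coeff (pcompose p q) k \<in> \<int>"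
  using assms(1)
proof (induction p arbitrary: k)
  case (pCons a p)
  have "a \<in> \<int>" using pCons.prems[of 0] by simp
  moreover have "coeff p k \<in> \<int>" for k using pCons.prems[of "Suc k"] by simp
  ultimately show ?case using pCons.IH
    by (auto simp: pcompose_pCons coeff_pCons intro!: Ints_add Ints_coeff_mult q split: nat.splits)
qed simp

text \<open>The least element exists because the product of the denominators of all coefficients
  qualifies.\<close>

lemma D_denom: "D_denom n r > 0" "of_nat (D_denom n r) * coeff (X_poly n r) k \<in> \<int>"
proof -
  define den where "den k = snd (quotient_of (coeff (X_poly n r) k))" for k
  define D where "D = nat (\<Prod>k\<le>r. den k)"
  have dp: "den k > 0" for k unfolding den_def by (rule quotient_of_denom_pos')
  then have Dp: "D > 0" by (simp add: D_def prod_pos)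
  have D': "of_nat D = (of_int (\<Prod>k\<le>r. den k) :: rat)" using dp
    by (simp add: D_def prod_pos less_imp_le)
  have "of_nat D * coeff (X_poly n r) k \<in> \<int>" for k
  proof (cases "k \<le> r")
    case True
    obtain u where "coeff (X_poly n r) k = of_int u / of_int (den k)"
      unfolding den_def using quotient_of_div[OF prod.collapse[symmetric]] by blast
    moreover obtain m where "(\<Prod>k\<le>r. den k) = den k * m" using True by (metis atMost_iff dvdE dvd_prodI finite_atMost)
    ultimately have "of_nat D * coeff (X_poly n r) k = of_int (m * u)"
      using dp[of k] by (simp add: D')
    then show ?thesis by simp
  qed (simp add: coeff_X_poly)
  then have "D > 0 \<and> (\<forall>k. coeff (smult (of_nat D) (X_poly n r)) k \<in> \<int>)" using Dp by simp
  then have *: "D_denom n r > 0 \<and> (\<forall>k. coeff (smult (of_nat (D_denom n r)) (X_poly n r)) k \<in> \<int>)"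
    unfolding D_denom_def by (rule LeastI)
  then show "D_denom n r > 0" "of_nat (D_denom n r) * coeff (X_poly n r) k \<in> \<int>" by auto
qed

text \<open>Chu-Vandermonde summation: lower parameter minus second upper parameter is (1 - a) - (-r
  - a) = 1 + r, and (1 + r)_r = (2r)! / r!.\<close>

lemma hypX_1:
  fixes n :: nat
  assumes n: "n \<ge> 2"
  shows "hypX (1 / of_nat n) r (1::'a::field_char_0) = of_nat (hypT r * n ^ r) / of_nat (hypV n r)"
proof -
  define a :: 'a where "a = 1 / of_nat n"
  have na: "of_nat n * a = 1" using n by (simp add: a_def)
  have cne: "1 - a \<noteq> - of_nat i" for i
  proof
    assume "1 - a = - of_nat i"
    then have "of_nat n * (1 - a) = of_nat n * (- of_nat i)" by simp
    then have "of_nat (n * Suc i) = (of_nat 1 :: 'a)" using na by (simp add: algebra_simps)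
    then have "n * Suc i = 1" by (simp only: of_nat_eq_iff)
    then show False using n by simp
  qed
  have "hypX a r 1 = (\<Sum>k=0..r. pochhammer (- of_nat r - a) k * pochhammer (- of_nat r) k / (of_nat (fact k) * pochhammer (1 - a) k))"
    unfolding hypX_def by (intro sum.cong) (auto simp: hyp_coeff_conv_pochhammer mult_ac)
  also have "\<dots> = pochhammer (1 - a - (- of_nat r - a)) r / pochhammer (1 - a) r"
    by (rule Vandermonde_pochhammer) (use cne in auto)
  also have "1 - a - (- of_nat r - a) = 1 + of_nat r" by simp
  also have "pochhammer (1 + of_nat r) r = (of_nat (hypT r) :: 'a)"
  proof -
    have f: "fact (2 * r) = fact r * hypT r" for r
      by (induction r) (simp_all add: hypT_def algebra_simps)
    have "fact r * pochhammer (1 + of_nat r) r = (fact (2 * r) :: 'a)"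
      using pochhammer_product'[of "1::'a" r r] by (simp add: pochhammer_fact mult_2)
    also have "\<dots> = of_nat (fact (2 * r))" by simp
    also have "\<dots> = fact r * of_nat (hypT r)" unfolding f by simp
    finally show ?thesis by simp
  qed
  also have "pochhammer (1 - a) r = of_nat (hypV n r) / of_nat n ^ r"
  proof -
    have "of_nat (n * Suc j - 1) / of_nat n = 1 - a + of_nat j" for j
    proof -
      have "of_nat (n * Suc j - 1) = (of_nat (n * Suc j) - 1 :: 'a)" using n by (subst of_nat_diff) auto
      then show ?thesis using n by (simp add: a_def field_simps)
    qed
    then have "pochhammer (1 - a) r = (\<Prod>j<r. of_nat (n * Suc j - 1) / of_nat n)"
      by (simp only: pochhammer_prod atLeast0LessThan)
    then show ?thesis by (simp only: prod_dividef prod_constant card_lessThan hypV_def of_nat_prod)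
  qed
  finally show ?thesis by (simp add: a_def)
qed

lemma hypV_pos: "n \<ge> 2 \<Longrightarrow> hypV n r > 0"
  by (auto simp: hypV_def intro!: prod_pos)

text \<open>The gcd cannot be 0, because the constant coefficient of X(1 - d y) is the value of X at
  1.\<close>

lemma N_numer_pos:
  assumes "n \<ge> 2" shows "N_numer d n r > 0"
proof -
  have "coeff (pcompose (X_poly n r) [:1, - of_nat d:]) 0 = hypX (1 / of_nat n) r 1"
    by (simp add: poly_0_coeff_0[symmetric] poly_pcompose poly_X_poly)
  also have "\<dots> \<noteq> 0" unfolding hypX_1[OF assms] using hypT_pos[of r] hypV_pos[OF assms, of r] assms by simp
  finally have nz: "coeff (pcompose (X_poly n r) [:1, - of_nat d:]) 0 \<noteq> 0" .
  then have "fst (quotient_of (coeff (pcompose (X_poly n r) [:1, - of_nat d:]) 0)) \<noteq> 0"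
    by (metis div_0 of_int_0 prod.collapse quotient_of_div)
  moreover have "N_numer d n r dvd fst (quotient_of (coeff (pcompose (X_poly n r) [:1, - of_nat d:]) 0))"
    unfolding N_numer_def by (rule Gcd_dvd) (rule rangeI)
  ultimately have "N_numer d n r \<noteq> 0" by (metis dvd_0_left_iff)
  moreover have "N_numer d n r \<ge> 0" unfolding N_numer_def by simp
  ultimately show ?thesis by simp
qed

text \<open>Write a coefficient of X(1 - d y) as u / v in lowest terms. Then \<open>N_numer\<close>
  divides u by definition, and v divides \<open>D_denom\<close>, since clearing the denominators of
  X also clears those after an integral substitution. So the two scalings act separately on
  numerator and denominator.\<close>

lemma scaled_X_poly_integral:
  fixes n r d :: nat
  assumes n: "n \<ge> 2"
  obtains c :: "nat \<Rightarrow> int" where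
    "\<And>y::complex. of_nat (D_denom n r) / of_int (N_numer d n r) * hypX (1 / of_nat n) r (1 - of_nat d * y) = (\<Sum>k\<le>r. of_int (c k) * y ^ k)"
proof -
  define p where "p = pcompose (X_poly n r) [:1, - of_nat d:]"
  have Np: "N_numer d n r > 0" by (rule N_numer_pos[OF n])
  have dp: "degree p \<le> r"
    using degree_X_poly[of n r] by (simp add: p_def degree_pcompose)
  have "\<exists>c. of_nat (D_denom n r) / of_int (N_numer d n r) * coeff p k = of_int c" for k
  proof -
    define u where "u = fst (quotient_of (coeff p k))"
    define v where "v = snd (quotient_of (coeff p k))"
    have v: "v > 0" unfolding v_def by (rule quotient_of_denom_pos')
    have cp: "coprime u v" unfolding u_def v_def by (rule quotient_of_coprime) simp
    have e: "coeff p k = of_int u / of_int v" unfolding u_def v_def by (rule quotient_of_div) simp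
    have "N_numer d n r dvd u" unfolding N_numer_def u_def p_def by (rule Gcd_dvd) simp
    then obtain u' where u': "u = N_numer d n r * u'" by (elim dvdE)
    have "coeff (pcompose (smult (of_nat (D_denom n r)) (X_poly n r)) [:1, - of_nat d:]) k \<in> \<int>"
      by (rule Ints_coeff_pcompose) (auto simp: D_denom coeff_pCons split: nat.splits)
    then have "of_nat (D_denom n r) * coeff p k \<in> \<int>" by (simp add: p_def pcompose_smult)
    then obtain w where "of_nat (D_denom n r) * coeff p k = of_int w" by (elim Ints_cases)
    then have "of_int (int (D_denom n r) * u) = (of_int (w * v) :: rat)" using v by (simp add: e field_simps)
    then have "int (D_denom n r) * u = w * v" by (simp only: of_int_eq_iff)
    then have "v dvd int (D_denom n r) * u" by simp
    then have "v dvd int (D_denom n r)" using cp by (simp add: coprime_commute coprime_dvd_mult_left_iff)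
    then obtain D' where D': "int (D_denom n r) = v * D'" by (elim dvdE)
    have "of_nat (D_denom n r) = (of_int v * of_int D' :: rat)"
      using arg_cong[OF D', of "of_int :: int \<Rightarrow> rat"] by simp
    then have "of_nat (D_denom n r) / of_int (N_numer d n r) * coeff p k = of_int (D' * u')"
      unfolding e using u' v Np by simp
    then show ?thesis by blast
  qed
  then obtain c where c: "\<And>k. of_nat (D_denom n r) / of_int (N_numer d n r) * coeff p k = of_int (c k)" by metis
  have R: "of_nat (D_denom n r) / of_int (N_numer d n r) * poly p y = (\<Sum>k\<le>r. of_int (c k) * y ^ k)" for y
  proof -
    have "poly p y = (\<Sum>k\<le>r. coeff p k * y ^ k)"
      unfolding poly_altdef using dp by (intro sum.mono_neutral_left) (auto simp: coeff_eq_0)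
    then have "q * poly p y = (\<Sum>k\<le>r. q * coeff p k * y ^ k)" for q
      by (simp add: sum_distrib_left mult.assoc)
    then show ?thesis by (simp only: c)
  qed
  have "smult (of_nat (D_denom n r) / of_int (N_numer d n r)) (pcompose (hypX_poly (1 / of_nat n) r) [:1, - of_nat d:]) = (\<Sum>k\<le>r. monom (of_int (c k) :: complex) k)"
  proof (rule poly_eqI_nat)
    fix m :: nat
    have "poly p (of_nat m) = hypX (1 / of_nat n) r (1 - of_nat d * of_nat m)"
      by (simp add: p_def poly_pcompose poly_X_poly mult.commute)
    then have "of_nat (D_denom n r) / of_int (N_numer d n r) * hypX (1 / of_nat n) r (1 - of_nat d * of_nat m) = (\<Sum>k\<le>r. of_int (c k) * of_nat m ^ k :: rat)"
      using R[of "of_nat m"] by simp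
    then have "of_rat (of_nat (D_denom n r) / of_int (N_numer d n r) * hypX (1 / of_nat n) r (1 - of_nat d * of_nat m)) = (of_rat (\<Sum>k\<le>r. of_int (c k) * of_nat m ^ k) :: complex)"
      by (simp only:)
    then have "of_nat (D_denom n r) / of_int (N_numer d n r) * hypX (1 / of_nat n) r (1 - of_nat d * of_nat m) = (\<Sum>k\<le>r. of_int (c k) * of_nat m ^ k :: complex)"
      by (simp add: of_rat_mult of_rat_divide hypX_of_rat[symmetric] of_rat_sum of_rat_power of_rat_diff)
    then show "poly (smult (of_nat (D_denom n r) / of_int (N_numer d n r)) (pcompose (hypX_poly (1 / of_nat n) r) [:1, - of_nat d:])) (of_nat m) = poly (\<Sum>k\<le>r. monom (of_int (c k) :: complex) k) (of_nat m)"
      by (simp add: poly_pcompose poly_hyp_poly poly_sum poly_monom mult.commute)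
  qed
  from arg_cong[OF this, of poly]
  have "of_nat (D_denom n r) / of_int (N_numer d n r) * hypX (1 / of_nat n) r (1 - of_nat d * y) = (\<Sum>k\<le>r. of_int (c k) * y ^ k)" for y :: complex
    by (simp add: fun_eq_iff poly_pcompose poly_hyp_poly poly_sum poly_monom mult.commute)
  then show thesis by (rule that)
qed

text \<open>Put K = D d^r / N. At y = 1/d the argument of X is 0 and X(0) = 1, which shows that K is
  an integer. At y = 0 the product K X(1) turns out to be the integer c_0 d^r, so the denominator of
  X(1) must be absorbed by K.\<close>

lemma scaled_denominator_growth:
  fixes n d s :: nat
  assumes n: "n \<ge> 3" and d: "d > 0"
  shows "(81 / 64) ^ s \<le> real (D_denom n (3 * s)) / of_int (N_numer d n (3 * s)) * real d ^ (3 * s)"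
proof -
  define r where "r = 3 * s"
  have n2: "n \<ge> 2" using n by simp
  define q :: complex where "q = of_nat (D_denom n r) / of_int (N_numer d n r)"
  obtain c :: "nat \<Rightarrow> int" where c: "\<And>y::complex. q * hypX (1 / of_nat n) r (1 - of_nat d * y) = (\<Sum>k\<le>r. of_int (c k) * y ^ k)"
    using scaled_X_poly_integral[OF n2] unfolding q_def by blast
  define K where "K = (\<Sum>k\<le>r. c k * int d ^ (r - k))"
  have "q = (\<Sum>k\<le>r. of_int (c k) * (1 / of_nat d) ^ k)"
    using c[of "1 / of_nat d"] d by (simp add: hyp_at_0)
  then have "q * of_nat d ^ r = (\<Sum>k\<le>r. of_int (c k) * ((1 / of_nat d) ^ k * of_nat d ^ r))"
    by (simp add: sum_distrib_right mult.assoc)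
  also have "\<dots> = of_int K"
    unfolding K_def of_int_sum
  proof (intro sum.cong refl)
    fix k assume "k \<in> {..r}"
    then have "(of_nat d :: complex) ^ r = of_nat d ^ k * of_nat d ^ (r - k)" by (simp add: power_add[symmetric])
    then show "of_int (c k) * ((1 / of_nat d) ^ k * of_nat d ^ r) = complex_of_int (c k * int d ^ (r - k))"
      using d by (simp add: power_one_over)
  qed
  finally have K: "q * of_nat d ^ r = of_int K" .
  have "complex_of_real (real (D_denom n r) / of_int (N_numer d n r) * real d ^ r) = of_real (of_int K)"
    using K by (simp add: q_def)
  then have KR: "real (D_denom n r) / of_int (N_numer d n r) * real d ^ r = of_int K" by (simp only: of_real_eq_iff)
  have "real (D_denom n r) / of_int (N_numer d n r) * real d ^ r > 0"
    using D_denom(1)[of n r] N_numer_pos[OF n2, of d r] d by simp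
  then have K0: "K > 0" by (simp only: KR of_int_0_less_iff)
  have "(\<Sum>k\<le>r. complex_of_int (c k) * 0 ^ k) = (\<Sum>k\<le>r. if k = 0 then of_int (c k) else 0)"
    by (intro sum.cong) auto
  then have "q * hypX (1 / of_nat n) r 1 = of_int (c 0)" using c[of 0] by simp
  moreover have "(q * of_nat d ^ r) * hypX (1 / of_nat n) r 1 = (q * hypX (1 / of_nat n) r 1) * of_nat d ^ r"
    by (simp only: mult_ac)
  ultimately have "of_int K * (of_nat (hypT r * n ^ r) / of_nat (hypV n r)) = complex_of_int (c 0 * int d ^ r)"
    unfolding K hypX_1[OF n2] by simp
  then have "of_int (K * int (hypT r * n ^ r)) = complex_of_int (c 0 * int d ^ r * int (hypV n r))"
    using hypV_pos[OF n2, of r] by (simp add: field_simps)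
  then have "K * int (hypT r * n ^ r) = c 0 * int d ^ r * int (hypV n r)" by (simp only: of_int_eq_iff)
  then have "int (hypV n r) dvd int (nat K * hypT r * n ^ r)" using K0 by (simp add: mult_ac)
  then have "hypV n r dvd nat K * hypT r * n ^ r" by (simp only: int_dvd_int_iff)
  then have "(81 / 64) ^ s \<le> real (nat K)" unfolding r_def by (rule denominator_growth) (use K0 n in auto)
  then show ?thesis using K0 KR by (simp add: r_def)
qed

section \<open>Formal conjugation and integrality\<close>

text \<open>The relation is not functional when \<open>t\<close> is a perfect square, so it also covers the formal
  conjugation of that case.\<close>

definition conj_pair :: "int \<Rightarrow> complex \<Rightarrow> complex \<Rightarrow> bool" where
  "conj_pair t z z' \<longleftrightarrow> (\<exists>a b :: rat. z = of_rat a + of_rat b * csqrt (of_int t) \<and> z' = of_rat a - of_rat b * csqrt (of_int t))"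

lemma conj_pair_of_rat: "conj_pair t (of_rat a) (of_rat a)"
  unfolding conj_pair_def by (rule exI[of _ a], rule exI[of _ 0], simp)

lemma conj_pair_of_int: "conj_pair t (of_int a) (of_int a)"
  using conj_pair_of_rat[of t "of_int a"] by simp

lemma conj_pair_sym: "conj_pair t z z' \<Longrightarrow> conj_pair t z' z"
  unfolding conj_pair_def
proof (elim exE conjE)
  fix a b :: rat
  assume "z = of_rat a + of_rat b * csqrt (of_int t)" "z' = of_rat a - of_rat b * csqrt (of_int t)"
  then show "\<exists>a b. z' = of_rat a + of_rat b * csqrt (of_int t) \<and> z = of_rat a - of_rat b * csqrt (of_int t)"
    by - (rule exI[of _ a], rule exI[of _ "- b"], simp add: of_rat_minus)
qed

lemma conj_pair_add: "conj_pair t z z' \<Longrightarrow> conj_pair t w w' \<Longrightarrow> conj_pair t (z + w) (z' + w')"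
  unfolding conj_pair_def
proof (elim exE conjE)
  fix a b c e :: rat
  assume h: "z = of_rat a + of_rat b * csqrt (of_int t)" "z' = of_rat a - of_rat b * csqrt (of_int t)"
    "w = of_rat c + of_rat e * csqrt (of_int t)" "w' = of_rat c - of_rat e * csqrt (of_int t)"
  show "\<exists>a b. z + w = of_rat a + of_rat b * csqrt (of_int t) \<and> z' + w' = of_rat a - of_rat b * csqrt (of_int t)"
    by (rule exI[of _ "a + c"], rule exI[of _ "b + e"], simp add: h of_rat_add algebra_simps)
qed

lemma conj_pair_minus: "conj_pair t z z' \<Longrightarrow> conj_pair t (- z) (- z')"
  unfolding conj_pair_def
proof (elim exE conjE)
  fix a b :: rat
  assume "z = of_rat a + of_rat b * csqrt (of_int t)" "z' = of_rat a - of_rat b * csqrt (of_int t)"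
  then show "\<exists>a b. - z = of_rat a + of_rat b * csqrt (of_int t) \<and> - z' = of_rat a - of_rat b * csqrt (of_int t)"
    by - (rule exI[of _ "- a"], rule exI[of _ "- b"], simp add: of_rat_minus)
qed

lemma conj_pair_diff: "conj_pair t z z' \<Longrightarrow> conj_pair t w w' \<Longrightarrow> conj_pair t (z - w) (z' - w')"
  using conj_pair_add[of t z z' "- w" "- w'"] conj_pair_minus[of t w w'] by simp

lemma conj_pair_mult: "conj_pair t z z' \<Longrightarrow> conj_pair t w w' \<Longrightarrow> conj_pair t (z * w) (z' * w')"
  unfolding conj_pair_def
proof (elim exE conjE)
  fix a b c e :: rat
  define s where "s = csqrt (of_int t)"
  have t: "of_int t = s * s" using power2_csqrt[of "of_int t"] by (simp only: power2_eq_square s_def)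
  assume e: "z = of_rat a + of_rat b * csqrt (of_int t)" "z' = of_rat a - of_rat b * csqrt (of_int t)"
    "w = of_rat c + of_rat e * csqrt (of_int t)" "w' = of_rat c - of_rat e * csqrt (of_int t)"
  show "\<exists>a b. z * w = of_rat a + of_rat b * csqrt (of_int t) \<and> z' * w' = of_rat a - of_rat b * csqrt (of_int t)"
    unfolding e s_def[symmetric]
    by (rule exI[of _ "a * c + b * e * of_int t"], rule exI[of _ "a * e + b * c"],
        simp add: of_rat_add of_rat_mult t algebra_simps)
qed

lemma conj_pair_power: "conj_pair t z z' \<Longrightarrow> conj_pair t (z ^ k) (z' ^ k)"
proof (induction k)
  case 0
  then show ?case using conj_pair_of_int[of t 1] by simp
qed (simp add: conj_pair_mult)

lemma conj_pair_sum: "(\<And>i. i \<in> I \<Longrightarrow> conj_pair t (f i) (f' i)) \<Longrightarrow> conj_pair t (sum f I) (sum f' I)"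
proof (induction I rule: infinite_finite_induct)
  case (infinite I)
  then show ?case using conj_pair_of_int[of t 0] by simp
next
  case empty
  then show ?case using conj_pair_of_int[of t 0] by simp
qed (simp add: conj_pair_add)

text \<open>Adding or subtracting the two members isolates either the rational part or the part with
  the root, and \<open>z\<close> equals that part alone. This also holds for a formal pair when
  \<open>t\<close> is a square.\<close>

lemma conj_pair_square_rational:
  assumes "conj_pair t z (\<epsilon> * z)" "\<epsilon> = 1 \<or> \<epsilon> = -1"
  shows "z ^ 2 \<in> \<rat>"
proof -
  let ?s = "csqrt (of_int t)"
  obtain a b where ab: "z = of_rat a + of_rat b * ?s" "\<epsilon> * z = of_rat a - of_rat b * ?s"
    using assms(1) unfolding conj_pair_def by blast
  have t: "?s ^ 2 = of_int t" by simp
  from assms(2) have "z = of_rat a \<or> z = of_rat b * ?s"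
  proof
    assume "\<epsilon> = 1"
    then have "2 * z = 2 * of_rat a" using ab by (simp add: algebra_simps)
    then show ?thesis by simp
  next
    assume "\<epsilon> = -1"
    then have "2 * z = 2 * (of_rat b * ?s)" using ab by (simp add: algebra_simps)
    then show ?thesis by simp
  qed
  then have "z ^ 2 = of_rat (a ^ 2) \<or> z ^ 2 = of_rat (b ^ 2 * of_int t)"
    by (auto simp: power_mult_distrib of_rat_power of_rat_mult)
  then show ?thesis by (auto simp del: of_rat_power)
qed

lemma norm_ge_1_if_square_rational:
  fixes z :: complex
  assumes "algebraic_int z" "z ^ 2 \<in> \<rat>" "z \<noteq> 0"
  shows "norm z \<ge> 1"
proof -
  have "z ^ 2 \<in> \<int>" using assms by (intro rational_algebraic_int_is_int algebraic_int_power)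
  then obtain k where k: "z ^ 2 = of_int k" by (elim Ints_cases)
  then have "k \<noteq> 0" using assms(3) by auto
  then have "1 \<le> \<bar>k\<bar>" by simp
  then have "1 \<le> real_of_int \<bar>k\<bar>" by (simp only: of_int_1_le_iff)
  also have "\<dots> = norm z ^ 2" using k by (simp add: norm_power[symmetric])
  finally show ?thesis using power2_le_imp_le[of 1 "norm z"] by simp
qed

text \<open>The number is a root of \<open>X\<^sup>4 - T X\<^sup>2 + N\<^sup>2\<close>, where \<open>T\<close> and \<open>N\<^sup>2\<close> are the trace and the norm of
  its square; the choice of \<open>g3\<close> makes \<open>T\<close> and \<open>N\<close> integers.\<close>

lemma algebraic_int_scaled_quadratic:
  fixes v1 v2 t e g3 g4 :: int
  assumes e: "e > 0" "e dvd v1" "e dvd t" and g4: "g4 > 0"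
    and g3: "g3 = 4 \<or> g3 = 2 \<and> odd t \<and> even (v1 - v2) \<or> g3 = 1 \<and> t mod 4 = 1 \<and> even (v1 - v2)"
  shows "algebraic_int ((of_int v1 + of_int v2 * csqrt (of_int t)) / 2 * of_real (sqrt (of_int (g3 * g4)) / sqrt (of_int e)))"
    (is "algebraic_int ?\<alpha>")
proof -
  obtain w where w: "v1 = e * w" using e by (elim dvdE)
  obtain \<tau> where \<tau>: "t = e * \<tau>" using e by (elim dvdE)
  \<comment> \<open>Since v1 = e w and t = e \<tau>, the two forms are (v1^2 + t v2^2) / e and (v1^2
    - t v2^2) / e; trace and norm divide them by 2 and by 4.\<close>
  have "2 dvd g3 * (e * w ^ 2 + \<tau> * v2 ^ 2) \<and> 4 dvd g3 * (e * w ^ 2 - \<tau> * v2 ^ 2)"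
    using g3
  proof (elim disjE conjE)
    assume "g3 = 2" "odd t" "even (v1 - v2)"
    then have "even (e * w ^ 2 - \<tau> * v2 ^ 2)" using w \<tau> by auto
    then have "2 * 2 dvd 2 * (e * w ^ 2 - \<tau> * v2 ^ 2)" by (intro mult_dvd_mono) auto
    then show ?thesis using \<open>g3 = 2\<close> by simp
  next
    assume g: "g3 = 1" "t mod 4 = 1" "even (v1 - v2)"
    then have "odd t" by presburger
    then have o: "odd e" "odd \<tau>" using \<tau> by auto
    have p: "even w \<longleftrightarrow> even v2" using g(3) w o by auto
    \<comment> \<open>Two odd numbers with product 1 modulo 4 are congruent modulo 4.\<close>
    have "(e - \<tau>) mod 4 = 0"
    proof -
      have "e mod 4 = 1 \<or> e mod 4 = 3" "\<tau> mod 4 = 1 \<or> \<tau> mod 4 = 3" using o by presburger+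
      moreover have "(e mod 4) * (\<tau> mod 4) mod 4 = 1" using g(2) \<tau> by (simp add: mod_mult_eq)
      ultimately have "e mod 4 = \<tau> mod 4" by auto
      then show ?thesis by (simp add: mod_eq_dvd_iff)
    qed
    then have "4 dvd e - \<tau>" by (rule mod_0_imp_dvd)
    then obtain k where "e - \<tau> = 4 * k" by (elim dvdE)
    then have k: "e = \<tau> + 4 * k" by simp
    have 4: "4 dvd e * w ^ 2 - \<tau> * v2 ^ 2"
    proof (cases "even w")
      case True
      then obtain i j where "w = 2 * i" "v2 = 2 * j" using p by (auto elim!: evenE)
      then have "e * w ^ 2 - \<tau> * v2 ^ 2 = 4 * (e * i ^ 2 - \<tau> * j ^ 2)" by (simp add: power2_eq_square algebra_simps)
      then show ?thesis by simp
    next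
      case False
      then obtain i j where "w = 2 * i + 1" "v2 = 2 * j + 1" using p by (auto elim!: oddE)
      then have "e * w ^ 2 - \<tau> * v2 ^ 2 = 4 * (e * i ^ 2 + e * i - \<tau> * j ^ 2 - \<tau> * j + k)"
        using k by (simp add: power2_eq_square algebra_simps)
      then show ?thesis by simp
    qed
    have "even (e * w ^ 2 + \<tau> * v2 ^ 2)" using p o by auto
    with 4 show ?thesis using g(1) by simp
  qed auto
  then obtain T1 N1 where T1: "g3 * (e * w ^ 2 + \<tau> * v2 ^ 2) = 2 * T1" and N1: "g3 * (e * w ^ 2 - \<tau> * v2 ^ 2) = 4 * N1"
    unfolding dvd_def by blast
  define s where "s = csqrt (of_int t)"
  define G where "G = complex_of_int (g3 * g4) / of_int e"
  define T where "T = g4 * T1"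
  define N where "N = g4 * N1"
  have ce: "complex_of_int e \<noteq> 0" using e by simp
  have "s ^ 2 = of_int e * of_int \<tau>" by (simp add: s_def \<tau>)
  then have s2: "s * s = of_int e * of_int \<tau>" by (simp only: power2_eq_square)
  have g3p: "g3 > 0" using g3 by auto
  have sq: "of_real (sqrt (of_int (g3 * g4)) / sqrt (of_int e)) ^ 2 = G"
  proof -
    have "(sqrt (of_int (g3 * g4)) / sqrt (of_int e)) ^ 2 = real_of_int (g3 * g4) / of_int e"
      using e g3p g4 by (simp add: power_divide real_sqrt_mult power_mult_distrib)
    then show ?thesis by (simp only: of_real_power[symmetric] G_def) simp
  qed
  have v: "(of_int v2 * s) ^ 2 = of_int e * (of_int \<tau> * of_int v2 ^ 2)"
    "complex_of_int v1 ^ 2 = of_int e * (of_int e * of_int w ^ 2)"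
    by (simp_all add: power_mult_distrib power2_eq_square s2 w)
  have Ge: "G * of_int e = of_int (g3 * g4)" using ce by (simp add: G_def)
  have Tc: "of_int T = G * ((of_int v1) ^ 2 + (of_int v2 * s) ^ 2) / 2"
  proof -
    have "complex_of_int (2 * T) = of_int ((g3 * g4) * (e * w ^ 2 + \<tau> * v2 ^ 2))"
      using arg_cong[OF T1, of "\<lambda>x. g4 * x"] by (simp only: T_def mult_ac)
    also have "\<dots> = (G * of_int e) * (of_int e * of_int w ^ 2 + of_int \<tau> * of_int v2 ^ 2)"
      by (simp only: Ge) simp
    finally show ?thesis unfolding v by (simp add: algebra_simps)
  qed
  have Nc: "of_int N = G * ((of_int v1) ^ 2 - (of_int v2 * s) ^ 2) / 4"
  proof -
    have "complex_of_int (4 * N) = of_int ((g3 * g4) * (e * w ^ 2 - \<tau> * v2 ^ 2))"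
      using arg_cong[OF N1, of "\<lambda>x. g4 * x"] by (simp only: N_def mult_ac)
    also have "\<dots> = (G * of_int e) * (of_int e * of_int w ^ 2 - of_int \<tau> * of_int v2 ^ 2)"
      by (simp only: Ge) simp
    finally show ?thesis unfolding v by (simp add: algebra_simps)
  qed
  have a2: "?\<alpha> ^ 2 = (of_int v1 + of_int v2 * s) ^ 2 / 4 * G"
    unfolding power_mult_distrib sq s_def[symmetric] by (simp add: power_divide)
  have "(?\<alpha> ^ 2) ^ 2 - of_int T * ?\<alpha> ^ 2 + of_int N ^ 2 = 0"
    unfolding a2 Tc Nc by (simp add: power2_eq_square field_simps)
  moreover have "poly (map_poly of_int [:N ^ 2, 0, - T, 0, 1:]) z = (z ^ 2) ^ 2 - of_int T * z ^ 2 + of_int N ^ 2" for z :: complex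
    by (simp add: map_poly_pCons power2_eq_square algebra_simps)
  ultimately have r: "poly (map_poly of_int [:N ^ 2, 0, - T, 0, 1:]) ?\<alpha> = 0" by (simp only:)
  show ?thesis unfolding algebraic_int_altdef_ipoly
    by (rule exI[of _ "[:N ^ 2, 0, - T, 0, 1:]"]) (use r in simp)
qed

section \<open>Integrality and conjugation of the homogenised approximants\<close>

lemma hypY_conv_hypX: "z \<noteq> 0 \<Longrightarrow> hypY a r z = z ^ r * hypX a r (1 / z)"
  unfolding hypX_def hypY_def sum_distrib_left
  by (intro sum.cong refl) (simp add: power_diff power_one_over field_simps)

text \<open>For y = (U - Z) / (d U) the argument Z / U is 1 - d y, so the scaled value becomes a
  form of degree r with integer coefficients in U / g and (U - Z) / (d g). The second of these is u1
  / (d g) in the application, whence the condition that defines \<open>d\<close>.\<close>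

lemma algebraic_int_scaled_hypX:
  fixes U Z g :: complex
  assumes n: "n \<ge> 2" and d: "d > 0" and U: "U \<noteq> 0" and g: "g \<noteq> 0"
    and int: "algebraic_int (U / g)" "algebraic_int ((U - Z) / (of_nat d * g))"
  shows "algebraic_int (of_nat (D_denom n r) / of_int (N_numer d n r) * ((U / g) ^ r * hypX (1 / of_nat n) r (Z / U)))"
proof -
  define q :: complex where "q = of_nat (D_denom n r) / of_int (N_numer d n r)"
  obtain c :: "nat \<Rightarrow> int" where c: "\<And>y::complex. q * hypX (1 / of_nat n) r (1 - of_nat d * y) = (\<Sum>k\<le>r. of_int (c k) * y ^ k)"
    using scaled_X_poly_integral[OF n] unfolding q_def by blast
  define y where "y = (U - Z) / (of_nat d * U)"
  have "Z / U = 1 - of_nat d * y" using d U by (simp add: y_def field_simps)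
  then have "q * ((U / g) ^ r * hypX (1 / of_nat n) r (Z / U)) = (U / g) ^ r * (\<Sum>k\<le>r. of_int (c k) * y ^ k)"
    using c[of y] by (simp add: mult_ac)
  also have "\<dots> = (\<Sum>k\<le>r. of_int (c k) * ((U / g) ^ (r - k) * ((U - Z) / (of_nat d * g)) ^ k))"
    unfolding sum_distrib_left
  proof (intro sum.cong refl)
    fix k assume "k \<in> {..r}"
    then have "(U / g) ^ r = (U / g) ^ (r - k) * (U / g) ^ k" by (simp add: power_add[symmetric])
    moreover have "(U / g) ^ k * y ^ k = ((U - Z) / (of_nat d * g)) ^ k"
      using U by (simp add: power_mult_distrib[symmetric] y_def mult.commute)
    ultimately show "(U / g) ^ r * (of_int (c k) * y ^ k) = of_int (c k) * ((U / g) ^ (r - k) * ((U - Z) / (of_nat d * g)) ^ k)"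
      by (simp add: mult_ac)
  qed
  also have "algebraic_int \<dots>"
    by (intro algebraic_int_sum algebraic_int_mult algebraic_int_power int int_imp_algebraic_int) auto
  finally show ?thesis by (simp only: q_def)
qed

text \<open>Reversal of the polynomial exchanges the roles of \<open>U\<close> and
  \<open>Z\<close>.\<close>

lemma algebraic_int_scaled_hypY:
  fixes U Z g :: complex
  assumes n: "n \<ge> 2" and d: "d > 0" and UZ: "U \<noteq> 0" "Z \<noteq> 0" and g: "g \<noteq> 0"
    and int: "algebraic_int (Z / g)" "algebraic_int ((U - Z) / (of_nat d * g))"
  shows "algebraic_int (of_nat (D_denom n r) / of_int (N_numer d n r) * ((U / g) ^ r * hypY (1 / of_nat n) r (Z / U)))"
proof -
  have "algebraic_int ((Z - U) / (of_nat d * g))"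
    using int(2) algebraic_int_minus[OF int(2)] by (simp add: minus_divide_left)
  from algebraic_int_scaled_hypX[OF n d UZ(2) g int(1) this, of r]
  have "algebraic_int (of_nat (D_denom n r) / of_int (N_numer d n r) * ((Z / g) ^ r * hypX (1 / of_nat n) r (U / Z)))" .
  moreover have "(U / g) ^ r * hypY (1 / of_nat n) r (Z / U) = (Z / g) ^ r * hypX (1 / of_nat n) r (U / Z)"
  proof -
    have "(U / g) ^ r * (Z / U) ^ r = (Z / g) ^ r" using UZ by (simp add: power_mult_distrib[symmetric])
    then show ?thesis using UZ by (simp add: hypY_conv_hypX)
  qed
  ultimately show ?thesis by simp
qed

text \<open>Conjugation sends Z to -U and U to -Z, so it swaps the two homogenised forms; their
  degree r produces the sign.\<close>

lemma conj_pair_scaled_hyp: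
  assumes c: "conj_pair t Z (- U)" and UZ: "U \<noteq> 0" "Z \<noteq> 0"
  shows "conj_pair t (U ^ r * hypX (1 / of_nat n) r (Z / U)) ((-1) ^ r * (U ^ r * hypY (1 / of_nat n) r (Z / U)))"
    and "conj_pair t (U ^ r * hypY (1 / of_nat n) r (Z / U)) ((-1) ^ r * (U ^ r * hypX (1 / of_nat n) r (Z / U)))"
proof -
  have X: "U ^ r * hypX (1 / of_nat n) r (Z / U) = (\<Sum>k\<le>r. of_rat (hyp_coeff (1 / of_nat n) r k) * (Z ^ k * U ^ (r - k)))"
    unfolding hypX_def sum_distrib_left hyp_coeff_of_rat
    using UZ by (intro sum.cong refl) (simp add: power_divide power_diff)
  have Y: "U ^ r * hypY (1 / of_nat n) r (Z / U) = (\<Sum>k\<le>r. of_rat (hyp_coeff (1 / of_nat n) r k) * (U ^ k * Z ^ (r - k)))"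
    unfolding hypY_def sum_distrib_left hyp_coeff_of_rat
    using UZ by (intro sum.cong refl) (simp add: power_divide power_diff)
  have c': "conj_pair t U (- Z)" using conj_pair_minus[OF conj_pair_sym[OF c]] by simp
  have s: "(- x) ^ k * (- y) ^ (r - k) = (-1) ^ r * (x ^ k * y ^ (r - k))" if "k \<le> r" for x y :: complex and k
  proof -
    have "(- x) ^ k * (- y) ^ (r - k) = ((-1) ^ k * (-1) ^ (r - k)) * (x ^ k * y ^ (r - k))"
      by (subst (1 2) power_minus) (simp only: mult_ac)
    also have "(-1 :: complex) ^ k * (-1) ^ (r - k) = (-1) ^ r" using that by (simp add: power_add[symmetric])
    finally show ?thesis .
  qed
  have "conj_pair t (U ^ r * hypX (1 / of_nat n) r (Z / U)) (\<Sum>k\<le>r. of_rat (hyp_coeff (1 / of_nat n) r k) * ((- U) ^ k * (- Z) ^ (r - k)))"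
    unfolding X by (intro conj_pair_sum conj_pair_mult conj_pair_of_rat conj_pair_power c c')
  also have "(\<Sum>k\<le>r. of_rat (hyp_coeff (1 / of_nat n) r k) * ((- U) ^ k * (- Z) ^ (r - k))) = (-1) ^ r * (U ^ r * hypY (1 / of_nat n) r (Z / U))"
    unfolding Y sum_distrib_left by (intro sum.cong refl) (simp add: s)
  finally show "conj_pair t (U ^ r * hypX (1 / of_nat n) r (Z / U)) ((-1) ^ r * (U ^ r * hypY (1 / of_nat n) r (Z / U)))" .
  have "conj_pair t (U ^ r * hypY (1 / of_nat n) r (Z / U)) (\<Sum>k\<le>r. of_rat (hyp_coeff (1 / of_nat n) r k) * ((- Z) ^ k * (- U) ^ (r - k)))"
    unfolding Y by (intro conj_pair_sum conj_pair_mult conj_pair_of_rat conj_pair_power c c')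
  also have "(\<Sum>k\<le>r. of_rat (hyp_coeff (1 / of_nat n) r k) * ((- Z) ^ k * (- U) ^ (r - k))) = (-1) ^ r * (U ^ r * hypX (1 / of_nat n) r (Z / U))"
    unfolding X sum_distrib_left by (intro sum.cong refl) (simp add: s)
  finally show "conj_pair t (U ^ r * hypY (1 / of_nat n) r (Z / U)) ((-1) ^ r * (U ^ r * hypX (1 / of_nat n) r (Z / U)))" .
qed

section \<open>The gap principle\<close>

text \<open>Take the first \<open>r\<close> at which the remainder term falls below 1 / \<tau>.
  Minimality bounds E^r, hence Q^r = (E^r)^\<kappa>, in terms of q. What is left of the budget is
  \<tau> - 1 > 15/4, exactly what the other term needs.\<close>

lemma gap_principle:
  fixes E Q L B \<tau> q \<delta> \<kappa> :: real
  assumes E: "E > 1" and Q: "Q \<ge> 1" and \<kappa>: "\<kappa> = ln Q / ln E" and L: "L \<ge> 0" and B: "B > 0"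
    and \<tau>: "\<tau> > 19 / 4" and q: "q \<ge> 1"
    and nz: "\<And>r. P r \<or> P (Suc r)"
    and key: "\<And>r::nat. P r \<Longrightarrow> 1 \<le> q * (L / E ^ r) + 15 / 4 * B * Q ^ r * q * \<delta>"
  shows "\<delta> > 1 / (\<tau> * B * Q * max 1 (\<tau> * L * E) powr \<kappa> * q powr (\<kappa> + 1))"
proof -
  have \<kappa>0: "\<kappa> \<ge> 0" using E Q by (simp add: \<kappa>)
  define r where "r = (LEAST r. q * L * \<tau> < E ^ r)"
  have "\<exists>r. q * L * \<tau> < E ^ r" using real_arch_pow[OF E] .
  then have r: "q * L * \<tau> < E ^ r" unfolding r_def by (rule LeastI_ex)
  define m where "m = max 1 (\<tau> * L * E)"
  have m: "m \<ge> 1" by (simp add: m_def)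
  have qm: "1 * 1 \<le> q * m" using q m by (intro mult_mono) auto
  have QE: "Q ^ k = (E ^ k) powr \<kappa>" for k
  proof -
    have "E powr \<kappa> = Q" using E Q by (simp add: \<kappa> powr_def)
    then have "Q ^ k = (E powr \<kappa>) ^ k" by simp
    also have "\<dots> = (E ^ k) powr \<kappa>" using E by (simp add: powr_realpow[symmetric] powr_powr mult.commute)
    finally show ?thesis .
  qed
  have Qr: "Q ^ r \<le> (q * m) powr \<kappa>"
  proof (cases r)
    \<comment> \<open>There is no preceding index here; the maximum with 1 in \<open>m\<close> takes
      care of this case.\<close>
    case 0
    then show ?thesis using qm \<kappa>0 by (simp add: ge_one_powr_ge_zero)
  next
    case (Suc k)
    then have "\<not> q * L * \<tau> < E ^ k" using not_less_Least[of k "\<lambda>r. q * L * \<tau> < E ^ r"] by (simp add: r_def)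
    then have "E ^ k * E \<le> q * L * \<tau> * E" using E by (intro mult_right_mono) auto
    also have "\<dots> = q * (\<tau> * L * E)" by simp
    also have "\<dots> \<le> q * m" using q by (intro mult_left_mono) (auto simp: m_def)
    finally have "E ^ r \<le> q * m" by (simp add: Suc mult.commute)
    then show ?thesis unfolding QE using E \<kappa>0 by (intro powr_mono2) auto
  qed
  \<comment> \<open>The remainder term is small at both candidates because E^k increases; having to
    allow r + 1 costs the separate factor \<open>Q\<close> in the conclusion.\<close>
  obtain k where k: "P k" "k = r \<or> k = Suc r" using nz[of r] by blast
  have "E ^ r \<le> E ^ k" "Q ^ k \<le> Q ^ Suc r" using k(2) E Q by (auto intro!: power_increasing)
  have Ek: "q * L * \<tau> < E ^ k" using r \<open>E ^ r \<le> E ^ k\<close> by linarith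
  have "q * (L / E ^ k) < 1 / \<tau>" using Ek E \<tau> by (simp add: field_simps)
  then have 1: "1 - 1 / \<tau> < 15 / 4 * B * Q ^ k * q * \<delta>" using key[OF k(1)] by linarith
  have "0 < 1 - 1 / \<tau>" using \<tau> by simp
  \<comment> \<open>Positivity of \<delta> is a consequence of the key inequality and must be known
    before Q^k may be enlarged.\<close>
  with 1 have "0 < (15 / 4 * B * Q ^ k * q) * \<delta>" by linarith
  moreover have "0 < 15 / 4 * B * Q ^ k * q" using B Q q by simp
  ultimately have \<delta>: "\<delta> > 0" by (simp only: zero_less_mult_pos)
  have "15 / 4 * B * Q ^ k * q * \<delta> \<le> 15 / 4 * B * Q ^ Suc r * q * \<delta>"
    using \<open>Q ^ k \<le> Q ^ Suc r\<close> B q \<delta> by (intro mult_right_mono mult_left_mono) auto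
  with 1 have "1 - 1 / \<tau> < 15 / 4 * B * Q ^ Suc r * q * \<delta>" by (rule less_le_trans)
  then have "\<tau> * (1 - 1 / \<tau>) < \<tau> * (15 / 4 * B * Q ^ Suc r * q * \<delta>)"
    using \<tau> by (intro mult_strict_left_mono) auto
  moreover have "\<tau> * (1 - 1 / \<tau>) = \<tau> - 1" using \<tau> by (simp add: field_simps)
  ultimately have "1 < \<tau> * B * Q ^ Suc r * q * \<delta>" using \<tau> by simp
  also have "\<tau> * B * Q ^ Suc r * q * \<delta> = \<tau> * B * Q * q * \<delta> * Q ^ r" by simp
  also have "\<dots> \<le> \<tau> * B * Q * q * \<delta> * (q * m) powr \<kappa>"
    using Qr \<tau> B Q q \<delta> by (intro mult_left_mono) auto
  also have "\<dots> = (\<tau> * B * Q * m powr \<kappa> * q powr (\<kappa> + 1)) * \<delta>"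
    using q m by (simp add: powr_mult powr_add)
  finally have "1 < (\<tau> * B * Q * m powr \<kappa> * q powr (\<kappa> + 1)) * \<delta>" .
  moreover have "0 < \<tau> * B * Q * m powr \<kappa> * q powr (\<kappa> + 1)" using \<tau> B Q q m by simp
  ultimately show ?thesis unfolding m_def[symmetric] by (simp add: divide_less_eq mult.commute)
qed

lemma ge_1_if_powers_bounded_below:
  fixes x C :: real
  assumes "\<And>s. 1 \<le> C * x ^ s" "x \<ge> 0"
  shows "x \<ge> 1"
proof (rule ccontr)
  assume "\<not> x \<ge> 1"
  then have x1: "x < 1" by simp
  have C: "C > 0" using assms(1)[of 0] by simp
  obtain s where "x ^ s < 1 / C" using real_arch_pow_inv[of "1 / C" x] C x1 by auto
  then have "C * x ^ s < 1" using C by (simp add: field_simps)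
  with assms(1)[of s] show False by simp
qed

section \<open>The quantities of the theorem\<close>

lemma hypN_conv_Gamma:
  assumes n: "n > 0"
  shows "hypN (1 / real n) r = real n * Gamma (real r + 1 + 1 / real n) / (Gamma (1 / real n) * fact r)"
proof -
  define a where "a = 1 / real n"
  have a: "a > 0" using n by (simp add: a_def)
  have "pochhammer (a + 1) r = Gamma (a + 1 + real r) / Gamma (a + 1)"
    using a by (intro pochhammer_Gamma) (auto elim!: nonpos_Ints_cases)
  also have "Gamma (a + 1) = a * Gamma a"
    using a by (intro Gamma_plus1) (auto elim!: nonpos_Ints_cases)
  finally have "hypN a r = Gamma (a + 1 + real r) / (a * Gamma a * fact r)"
    by (simp add: hypN_def add.commute)
  also have "\<dots> = real n * Gamma (real r + 1 + a) / (Gamma a * fact r)"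
    using n by (simp add: a_def add_ac)
  finally show ?thesis by (simp add: a_def)
qed

lemma N_cal_pos: "N_cal d n > 0"
  unfolding N_cal_def by (intro prod_pos) (auto simp: prime_gt_0_nat in_prime_factors_iff)

text \<open>A constant factor cannot compensate a smaller exponential rate, so the cube of the rate
  is at least 81/64, and (14/13)^3 is below that.\<close>

lemma scaled_growth_rate:
  fixes n d :: nat and \<C> \<D> :: real
  assumes n: "n \<ge> 3" and d: "d > 0" and D: "\<D> > 0"
    and CD: "\<And>r. real (D_denom n r) / of_int (N_numer d n r) \<le> \<C> * (\<D> / N_cal d n) ^ r"
  shows "14 / 13 \<le> \<D> * real d / N_cal d n"
proof -
  define \<rho> where "\<rho> = \<D> * real d / N_cal d n"
  have \<rho>0: "\<rho> \<ge> 0" using D N_cal_pos[of d n] by (simp add: \<rho>_def)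
  have "1 \<le> \<C> * (\<rho> ^ 3 * (64 / 81)) ^ s" for s
  proof -
    have "(81 / 64) ^ s \<le> real (D_denom n (3 * s)) / of_int (N_numer d n (3 * s)) * real d ^ (3 * s)"
      by (rule scaled_denominator_growth[OF n d])
    also have "\<dots> \<le> \<C> * (\<D> / N_cal d n) ^ (3 * s) * real d ^ (3 * s)"
      by (intro mult_right_mono CD) simp
    also have "\<dots> = \<C> * \<rho> ^ (3 * s)"
      by (simp add: \<rho>_def power_mult_distrib power_divide)
    finally have "(81 / 64) ^ s \<le> \<C> * (\<rho> ^ 3) ^ s" by (simp only: power_mult)
    then have "(81 / 64) ^ s * (64 / 81) ^ s \<le> \<C> * (\<rho> ^ 3) ^ s * (64 / 81 :: real) ^ s"
      by (intro mult_right_mono) auto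
    moreover have "(81 / 64 :: real) ^ s * (64 / 81) ^ s = 1" by (simp add: power_mult_distrib[symmetric])
    ultimately show ?thesis by (simp only: power_mult_distrib mult.assoc)
  qed
  then have "1 \<le> \<rho> ^ 3 * (64 / 81)" by (rule ge_1_if_powers_bounded_below) (use \<rho>0 in simp)
  then have "(14 / 13) ^ 3 \<le> \<rho> ^ 3" by (simp add: power3_eq_cube)
  then show ?thesis unfolding \<rho>_def[symmetric] using \<rho>0 by (rule power_le_imp_le_base[of _ 2, simplified])
qed

text \<open>Dividing by \<open>g\<close> amounts to dividing u1 and u2 by their gcd and multiplying
  by sqrt (g3 g4 / g2). The second integrality claim is the first with u1 negated, which changes
  none of the parity conditions.\<close>

lemma gcd_normalization:
  fixes t u\<^sub>1 u\<^sub>2 g\<^sub>1 g\<^sub>2 g\<^sub>3 g\<^sub>4 :: int and n :: nat and g :: real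
  assumes n: "n > 0" and t: "t \<noteq> 0" and u1: "u\<^sub>1 \<noteq> 0"
    and g1: "g\<^sub>1 = gcd u\<^sub>1 u\<^sub>2"
    and g2: "g\<^sub>2 = gcd (u\<^sub>1 div g\<^sub>1) t"
    and g3: "g\<^sub>3 = (if t mod 4 = 1 \<and> ((u\<^sub>1 - u\<^sub>2) div g\<^sub>1) mod 2 = 0 then 1
                     else if t mod 4 = 3 \<and> ((u\<^sub>1 - u\<^sub>2) div g\<^sub>1) mod 2 = 0 then 2
                     else 4)"
    and g4: "g\<^sub>4 = gcd (squarefree_part (g\<^sub>2 * g\<^sub>3))
                      ((gcd 2 (int n) * int n) div gcd (u\<^sub>1 div g\<^sub>1) (gcd 2 (int n) * int n))"
    and g: "g = of_int g\<^sub>1 * sqrt (of_int g\<^sub>2) / sqrt (of_int (g\<^sub>3 * g\<^sub>4))"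
  shows "g > 0" "g ^ 2 \<in> \<rat>"
    and "algebraic_int ((of_int u\<^sub>1 + of_int u\<^sub>2 * csqrt (of_int t)) / 2 / of_real g)"
    and "algebraic_int ((- of_int u\<^sub>1 + of_int u\<^sub>2 * csqrt (of_int t)) / 2 / of_real g)"
proof -
  have g1p: "g\<^sub>1 > 0" using u1 by (simp add: g1)
  have "g\<^sub>1 dvd u\<^sub>1" "g\<^sub>1 dvd u\<^sub>2" by (simp_all add: g1)
  then obtain v1 v2 where v1: "u\<^sub>1 = g\<^sub>1 * v1" and v2: "u\<^sub>2 = g\<^sub>1 * v2" by (elim dvdE)
  have dv: "u\<^sub>1 div g\<^sub>1 = v1" "(u\<^sub>1 - u\<^sub>2) div g\<^sub>1 = v1 - v2"
    using g1p by (simp_all add: v1 v2 right_diff_distrib[symmetric])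
  have g2p: "g\<^sub>2 > 0" "g\<^sub>2 dvd v1" "g\<^sub>2 dvd t" using t by (auto simp: g2 dv)
  have g3p: "g\<^sub>3 > 0" by (simp add: g3)
  have g4p: "g\<^sub>4 > 0"
  proof -
    have "squarefree_part (g\<^sub>2 * g\<^sub>3) \<noteq> 0" by simp
    then show ?thesis unfolding g4 by (simp add: gcd_pos_int)
  qed
  show g0: "g > 0" unfolding g using g1p g2p(1) g3p g4p by simp
  have "g ^ 2 = of_int (g\<^sub>1 ^ 2 * g\<^sub>2) / of_int (g\<^sub>3 * g\<^sub>4)"
    unfolding g using g2p(1) g3p g4p by (simp add: power_divide power_mult_distrib)
  then show "g ^ 2 \<in> \<rat>" by (simp only: Rats_divide Rats_of_int)
  have ginv: "of_int g\<^sub>1 / of_real g = complex_of_real (sqrt (of_int (g\<^sub>3 * g\<^sub>4)) / sqrt (of_int g\<^sub>2))"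
  proof -
    have "of_int g\<^sub>1 / g = sqrt (of_int (g\<^sub>3 * g\<^sub>4)) / sqrt (of_int g\<^sub>2)"
      unfolding g using g1p g2p(1) g3p g4p by (simp add: field_simps)
    then have "complex_of_real (of_int g\<^sub>1 / g) = of_real (sqrt (of_int (g\<^sub>3 * g\<^sub>4)) / sqrt (of_int g\<^sub>2))" by (simp only:)
    then show ?thesis by (simp only: of_real_divide of_real_of_int_eq)
  qed
  have c3: "g\<^sub>3 = 4 \<or> g\<^sub>3 = 2 \<and> odd t \<and> even (v1 - v2) \<or> g\<^sub>3 = 1 \<and> t mod 4 = 1 \<and> even (v1 - v2)"
    unfolding g3 dv by (auto; presburger)
  have c3': "g\<^sub>3 = 4 \<or> g\<^sub>3 = 2 \<and> odd t \<and> even (- v1 - v2) \<or> g\<^sub>3 = 1 \<and> t mod 4 = 1 \<and> even (- v1 - v2)"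
    using c3 by auto
  have "(of_int u\<^sub>1 + of_int u\<^sub>2 * csqrt (of_int t)) / 2 / of_real g = (of_int v1 + of_int v2 * csqrt (of_int t)) / 2 * (of_int g\<^sub>1 / of_real g)"
    by (simp add: v1 v2 field_simps)
  then show "algebraic_int ((of_int u\<^sub>1 + of_int u\<^sub>2 * csqrt (of_int t)) / 2 / of_real g)"
    unfolding ginv using algebraic_int_scaled_quadratic[OF g2p g4p c3] by simp
  have "(- of_int u\<^sub>1 + of_int u\<^sub>2 * csqrt (of_int t)) / 2 / of_real g = (of_int (- v1) + of_int v2 * csqrt (of_int t)) / 2 * (of_int g\<^sub>1 / of_real g)"
    by (simp add: v1 v2 field_simps)
  then show "algebraic_int ((- of_int u\<^sub>1 + of_int u\<^sub>2 * csqrt (of_int t)) / 2 / of_real g)"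
    unfolding ginv using algebraic_int_scaled_quadratic[of g\<^sub>2 "- v1", OF g2p(1) _ g2p(3) g4p c3'] g2p(2) by simp
qed

text \<open>U + Z + 2 U w and U + Z - 2 U w are U (1 + w)^2 and U (1 - w)^2. Minimum and maximum do
  not see which square root of 4 U Z is taken, and Re w \<ge> 0 decides which value is
  smaller.\<close>

lemma norm_root_bounds:
  fixes U Z w \<sigma> :: complex
  assumes Z: "Z = U * w ^ 2" and \<sigma>: "\<sigma> ^ 2 = 4 * U * Z" and w: "Re w \<ge> 0"
  shows "min (norm (U + Z + \<sigma>)) (norm (U + Z - \<sigma>)) = norm U * norm (1 - w) ^ 2"
    and "max (norm (U + Z + \<sigma>)) (norm (U + Z - \<sigma>)) = norm U * norm (1 + w) ^ 2"
proof -
  have "\<sigma> ^ 2 = (2 * U * w) ^ 2" using \<sigma> Z by (simp add: power2_eq_square)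
  then have s: "\<sigma> = 2 * U * w \<or> \<sigma> = - (2 * U * w)" by (simp only: power2_eq_iff)
  have e: "U + Z + 2 * U * w = U * (1 + w) ^ 2" "U + Z - 2 * U * w = U * (1 - w) ^ 2"
    by (simp_all add: Z power2_eq_square algebra_simps)
  have n: "norm (U + Z + 2 * U * w) = norm U * norm (1 + w) ^ 2" "norm (U + Z - 2 * U * w) = norm U * norm (1 - w) ^ 2"
    unfolding e by (simp_all add: norm_mult norm_power)
  have "norm (1 - w) ^ 2 \<le> norm (1 + w) ^ 2"
    unfolding cmod_power2 using w by (simp add: power2_eq_square algebra_simps)
  then have le: "norm U * norm (1 - w) ^ 2 \<le> norm U * norm (1 + w) ^ 2" by (intro mult_left_mono) auto
  show "min (norm (U + Z + \<sigma>)) (norm (U + Z - \<sigma>)) = norm U * norm (1 - w) ^ 2"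
    "max (norm (U + Z + \<sigma>)) (norm (U + Z - \<sigma>)) = norm U * norm (1 + w) ^ 2"
    using s le by (auto simp: n min_def max_def)
qed

lemma approximation_nonzero:
  fixes \<alpha> \<beta> W :: complex
  assumes n: "n \<ge> 2" and W: "W \<noteq> 1" and nz: "\<alpha> \<noteq> 0 \<or> \<beta> \<noteq> 0"
  shows "\<alpha> * hypX (1 / of_nat n) r W \<noteq> \<beta> * hypY (1 / of_nat n) r W \<or>
    \<alpha> * hypX (1 / of_nat n) (Suc r) W \<noteq> \<beta> * hypY (1 / of_nat n) (Suc r) W"
proof (rule ccontr)
  let ?X = "\<lambda>r. hypX (1 / of_nat n) r W" and ?Y = "\<lambda>r. hypY (1 / of_nat n) r W"
  assume "\<not> ?thesis"
  then have e: "\<alpha> * ?X r = \<beta> * ?Y r" "\<alpha> * ?X (Suc r) = \<beta> * ?Y (Suc r)" by auto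
  have det: "?X r * ?Y (Suc r) \<noteq> ?X (Suc r) * ?Y r"
    using hyp_determinant_nonzero[of "1 / real n" W r] n W by simp
  have "\<alpha> * (?X r * ?Y (Suc r)) = (\<alpha> * ?X r) * ?Y (Suc r)" by (simp only: mult_ac)
  also have "\<dots> = (\<beta> * ?Y (Suc r)) * ?Y r" by (simp only: e(1) mult_ac)
  also have "\<dots> = \<alpha> * (?X (Suc r) * ?Y r)" by (simp only: e(2)[symmetric] mult_ac)
  finally have "\<alpha> = 0" using det by simp
  have "\<beta> * (?X r * ?Y (Suc r)) = (\<beta> * ?Y (Suc r)) * ?X r" by (simp only: mult_ac)
  also have "\<dots> = (\<alpha> * ?X r) * ?X (Suc r)" by (simp only: e(2)[symmetric] mult_ac)
  also have "\<dots> = \<beta> * (?X (Suc r) * ?Y r)" by (simp only: e(1) mult_ac)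
  finally have "\<beta> = 0" using det by simp
  with \<open>\<alpha> = 0\<close> nz show False by simp
qed

lemma complex_of_real_in_Rats:
  assumes "x \<in> \<rat>" shows "complex_of_real x \<in> \<rat>"
proof -
  obtain i j :: int where "x = of_int i / of_int j"
    using assms by (rule Rats_cases') blast
  then have "complex_of_real x = of_int i / of_int j" by simp
  also have "\<dots> \<in> \<rat>" by (intro Rats_divide Rats_of_int)
  finally show ?thesis .
qed

text \<open>Conjugation exchanges the two terms of the form up to sign, so it maps \<open>G\<close>
  to (-1)^(r + 1) G, and the square of \<open>G\<close> is rational. The scaling keeps this because
  \<open>S\<close> and the square of \<open>g\<close> are rational.\<close>

lemma norm_scaled_form_ge_1:
  fixes \<beta>1 \<beta>2 U Z :: complex and g :: real and t x p q :: int and n d r :: nat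
  assumes n: "n \<ge> 2" and d: "d > 0" and UZ: "U \<noteq> 0" "Z \<noteq> 0" and g: "g > 0" "g ^ 2 \<in> \<rat>"
    and int: "algebraic_int (U / of_real g)" "algebraic_int (Z / of_real g)" "algebraic_int ((U - Z) / (of_nat d * of_real g))"
    and \<beta>: "algebraic_int \<beta>1" "algebraic_int \<beta>2" "conj_pair t \<beta>1 \<beta>2" and c: "conj_pair t Z (- U)"
  defines "S \<equiv> real (D_denom n r) / of_int (N_numer d n r)"
    and "F \<equiv> (of_int q * \<beta>1 - of_int p) * (of_int x - \<beta>2) * hypX (1 / of_nat n) r (Z / U) - (of_int q * \<beta>2 - of_int p) * (of_int x - \<beta>1) * hypY (1 / of_nat n) r (Z / U)"
  assumes F: "F \<noteq> 0"
  shows "1 \<le> S * (norm U / g) ^ r * norm F"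
proof -
  define \<alpha> where "\<alpha> = (of_int q * \<beta>1 - of_int p) * (of_int x - \<beta>2)"
  define \<alpha>' where "\<alpha>' = (of_int q * \<beta>2 - of_int p) * (of_int x - \<beta>1)"
  define X where "X = U ^ r * hypX (1 / of_nat n) r (Z / U)"
  define Y where "Y = U ^ r * hypY (1 / of_nat n) r (Z / U)"
  define G where "G = \<alpha> * X - \<alpha>' * Y"
  have G: "G = U ^ r * F" by (simp add: G_def X_def Y_def F_def \<alpha>_def \<alpha>'_def algebra_simps)
  have XY: "conj_pair t X ((-1) ^ r * Y)" "conj_pair t Y ((-1) ^ r * X)"
    unfolding X_def Y_def by (rule conj_pair_scaled_hyp[OF c UZ])+
  have \<alpha>: "conj_pair t \<alpha> \<alpha>'"
    unfolding \<alpha>_def \<alpha>'_def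
    by (intro conj_pair_mult conj_pair_diff conj_pair_of_int \<beta>(3) conj_pair_sym[OF \<beta>(3)])
  have "conj_pair t G (\<alpha>' * ((-1) ^ r * Y) - \<alpha> * ((-1) ^ r * X))"
    unfolding G_def by (intro conj_pair_diff conj_pair_mult \<alpha> conj_pair_sym[OF \<alpha>] XY)
  also have "\<alpha>' * ((-1) ^ r * Y) - \<alpha> * ((-1) ^ r * X) = (-1) ^ Suc r * G"
    by (simp add: G_def algebra_simps)
  finally have "G ^ 2 \<in> \<rat>"
    by (rule conj_pair_square_rational) (simp only: minus_one_power_iff split: if_splits, auto)
  define \<theta> where "\<theta> = of_real S * G / of_real g ^ r"
  have g2: "complex_of_real g ^ 2 \<in> \<rat>"
    unfolding of_real_power[symmetric] by (rule complex_of_real_in_Rats[OF g(2)])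
  have Sr: "complex_of_real S \<in> \<rat>"
    unfolding S_def by simp
  have "\<theta> ^ 2 = of_real S ^ 2 * G ^ 2 / (of_real g ^ 2) ^ r"
    by (simp add: \<theta>_def power_mult_distrib power_divide power_mult[symmetric] mult.commute)
  also have "\<dots> \<in> \<rat>" by (intro Rats_divide Rats_mult Rats_power[OF Sr] Rats_power[OF g2] \<open>G ^ 2 \<in> \<rat>\<close>)
  finally have 2: "\<theta> ^ 2 \<in> \<rat>" .
  have gc: "complex_of_real g \<noteq> 0" using g by simp
  have Sc: "complex_of_real S = of_nat (D_denom n r) / of_int (N_numer d n r)" by (simp add: S_def)
  have aX: "algebraic_int (of_real S * ((U / of_real g) ^ r * hypX (1 / of_nat n) r (Z / U)))"
    unfolding Sc by (rule algebraic_int_scaled_hypX[OF n d UZ(1) gc int(1,3)])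
  have aY: "algebraic_int (of_real S * ((U / of_real g) ^ r * hypY (1 / of_nat n) r (Z / U)))"
    unfolding Sc by (rule algebraic_int_scaled_hypY[OF n d UZ gc int(2,3)])
  have ai: "algebraic_int (complex_of_int k)" for k by (intro int_imp_algebraic_int) simp
  have "\<theta> = \<alpha> * (of_real S * ((U / of_real g) ^ r * hypX (1 / of_nat n) r (Z / U))) - \<alpha>' * (of_real S * ((U / of_real g) ^ r * hypY (1 / of_nat n) r (Z / U)))"
    using gc by (simp add: \<theta>_def G_def X_def Y_def power_divide diff_divide_distrib right_diff_distrib mult_ac)
  also have "algebraic_int \<dots>"
    unfolding \<alpha>_def \<alpha>'_def by (intro algebraic_int_diff algebraic_int_mult aX aY ai \<beta>)
  finally have 1: "algebraic_int \<theta>" .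
  have S0: "S > 0" using D_denom(1)[of n r] N_numer_pos[OF n, of d r] by (simp add: S_def)
  have 3: "\<theta> \<noteq> 0" using S0 F UZ gc by (simp add: \<theta>_def G)
  have "norm \<theta> \<ge> 1" by (rule norm_ge_1_if_square_rational[OF 1 2 3])
  also have "norm \<theta> = S * (norm U / g) ^ r * norm F"
    using S0 g by (simp add: \<theta>_def G norm_mult norm_divide norm_power power_divide)
  finally show ?thesis .
qed

theorem corollary2p7:
  fixes n d :: nat
    and t x u\<^sub>1 u\<^sub>2 g\<^sub>1 g\<^sub>2 g\<^sub>3 g\<^sub>4 :: int
    and a b a' b' :: rat
    and \<beta>\<^sub>1 \<beta>\<^sub>2 \<gamma>\<^sub>1 \<gamma>\<^sub>2 U Z W A :: complex
    and g \<C> \<D> m M E Q \<kappa> c :: real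
  assumes n: "n \<ge> 3"
    and t: "t \<noteq> 0"
    and \<beta>\<^sub>1: "\<beta>\<^sub>1 = of_rat a + of_rat b * csqrt (of_int t)"
    and b: "b \<noteq> 0"
    and \<beta>\<^sub>2: "\<beta>\<^sub>2 = of_rat a - of_rat b * csqrt (of_int t)"
    and \<beta>_int: "algebraic_int \<beta>\<^sub>1" "algebraic_int \<beta>\<^sub>2"
    and \<gamma>\<^sub>1: "\<gamma>\<^sub>1 = of_rat a' + of_rat b' * csqrt (of_int t)"
    and \<gamma>\<^sub>2: "\<gamma>\<^sub>2 = of_rat a' - of_rat b' * csqrt (of_int t)"
    and \<gamma>_int: "algebraic_int \<gamma>\<^sub>1"
    and U: "U = - \<gamma>\<^sub>2 * (of_int x - \<beta>\<^sub>2) ^ n"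
    and Z: "Z = \<gamma>\<^sub>1 * (of_int x - \<beta>\<^sub>1) ^ n"
    and W: "W = Z / U"
    and A: "A = (\<beta>\<^sub>1 * (of_int x - \<beta>\<^sub>2) * W powr (1 / of_nat n) - \<beta>\<^sub>2 * (of_int x - \<beta>\<^sub>1))
                / ((of_int x - \<beta>\<^sub>2) * W powr (1 / of_nat n) - (of_int x - \<beta>\<^sub>1))"
    and U_nz: "U \<noteq> 0"
    and A_denom_nz: "(of_int x - \<beta>\<^sub>2) * W powr (1 / of_nat n) - (of_int x - \<beta>\<^sub>1) \<noteq> 0"
    and U_u: "U = (of_int u\<^sub>1 + of_int u\<^sub>2 * csqrt (of_int t)) / 2"
    and Z_u: "Z = (- of_int u\<^sub>1 + of_int u\<^sub>2 * csqrt (of_int t)) / 2"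
    and u\<^sub>1_nz: "u\<^sub>1 \<noteq> 0"
    and g\<^sub>1: "g\<^sub>1 = gcd u\<^sub>1 u\<^sub>2"
    and g\<^sub>2: "g\<^sub>2 = gcd (u\<^sub>1 div g\<^sub>1) t"
    and g\<^sub>3: "g\<^sub>3 = (if t mod 4 = 1 \<and> ((u\<^sub>1 - u\<^sub>2) div g\<^sub>1) mod 2 = 0 then 1
                     else if t mod 4 = 3 \<and> ((u\<^sub>1 - u\<^sub>2) div g\<^sub>1) mod 2 = 0 then 2
                     else 4)"
    and g\<^sub>4: "g\<^sub>4 = gcd (squarefree_part (g\<^sub>2 * g\<^sub>3))
                      ((gcd 2 (int n) * int n) div gcd (u\<^sub>1 div g\<^sub>1) (gcd 2 (int n) * int n))"
    and g: "g = of_int g\<^sub>1 * sqrt (of_int g\<^sub>2) / sqrt (of_int (g\<^sub>3 * g\<^sub>4))"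
    and d: "d > 0" "algebraic_int (of_int u\<^sub>1 / (of_nat d * g))"
           "\<And>d' :: nat. d' > 0 \<Longrightarrow> algebraic_int (of_int u\<^sub>1 / (of_nat d' * g)) \<Longrightarrow> d' \<le> d"
    and CD_pos: "\<C> > 0" "\<D> > 0"
    and CD: "\<And>r :: nat.
        max 1 (max (Gamma (1 - 1 / real n) * fact r / Gamma (real r + 1 - 1 / real n))
                   (real n * Gamma (real r + 1 + 1 / real n) / (Gamma (1 / real n) * fact r)))
          * (real (D_denom n r) / of_int (N_numer d n r))
        < \<C> * (\<D> / N_cal d n) ^ r"
    and m: "m = min (cmod (of_int u\<^sub>2 * csqrt (of_int t) + csqrt (of_int (u\<^sub>2\<^sup>2 * t - u\<^sub>1\<^sup>2))))
                    (cmod (of_int u\<^sub>2 * csqrt (of_int t) - csqrt (of_int (u\<^sub>2\<^sup>2 * t - u\<^sub>1\<^sup>2))))"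
    and M: "M = max (cmod (of_int u\<^sub>2 * csqrt (of_int t) + csqrt (of_int (u\<^sub>2\<^sup>2 * t - u\<^sub>1\<^sup>2))))
                    (cmod (of_int u\<^sub>2 * csqrt (of_int t) - csqrt (of_int (u\<^sub>2\<^sup>2 * t - u\<^sub>1\<^sup>2))))"
    and E: "E = \<bar>g\<bar> * N_cal d n / (\<D> * m)"
    and Q: "Q = \<D> * M / (\<bar>g\<bar> * N_cal d n)"
    and \<kappa>: "\<kappa> = ln Q / ln E"
    and c: "c = 4 * sqrt \<bar>2 * of_int t\<bar> * (cmod (of_int x - \<beta>\<^sub>1) + cmod (of_int x - \<beta>\<^sub>2)) * \<C> * Q
                * (max 1 (5 * sqrt \<bar>2 * of_int t\<bar> * cmod (1 - W powr (1 / of_nat n))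
                            * cmod (of_int x - \<beta>\<^sub>2) * cmod (A - \<beta>\<^sub>1) * \<C> * E)) powr \<kappa>"
    and E_gt: "E > 1"
    and W_cases: "(W \<in> \<real> \<and> 0 < Re W \<and> Re W < 1) \<or> (cmod W = 1 \<and> W \<noteq> -1)"
  shows "\<forall>p q :: int. q \<noteq> 0 \<longrightarrow>
           cmod (A - of_int p / of_int q) > 1 / (c * real_of_int \<bar>q\<bar> powr (\<kappa> + 1))"
proof (intro allI impI)
  fix p q :: int
  assume q0: "q \<noteq> 0"
  define s where "s = csqrt (of_int t)"
  define \<xi>1 where "\<xi>1 = of_int x - \<beta>\<^sub>1"
  define \<xi>2 where "\<xi>2 = of_int x - \<beta>\<^sub>2"
  define w where "w = csqrt W"
  define Wa where "Wa = W powr (1 / of_nat n)"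
  have n2: "n \<ge> 2" using n by simp
  have W0: "W \<noteq> 0" using W_cases by auto
  have Z_nz: "Z \<noteq> 0" using W0 W by auto
  have ZUW: "Z / U = W" by (simp add: W)
  have ZW: "Z = U * W" using W U_nz by simp
  have \<xi>2_nz: "\<xi>2 \<noteq> 0" using U_nz U n by (auto simp: \<xi>2_def power_0_left)
  have \<xi>1_nz: "\<xi>1 \<noteq> 0" using Z_nz Z n by (auto simp: \<xi>1_def power_0_left)
  have UmZ: "U - Z = of_int u\<^sub>1" unfolding U_u Z_u by (simp add: field_simps)
  have UpZ: "U + Z = of_int u\<^sub>2 * s" unfolding U_u Z_u s_def by (simp add: field_simps)
  have W1: "W \<noteq> 1" using UmZ u\<^sub>1_nz ZW by auto
  have w2: "w ^ 2 = W" by (simp add: w_def)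
  have Rew: "Re w \<ge> 0" unfolding w_def using csqrt_principal[of W] by auto
  have w1: "1 - w \<noteq> 0" using W1 w2 by auto
  have w1': "1 + w \<noteq> 0"
  proof
    assume "1 + w = 0"
    then have "Re (1 + w) = 0" by (simp only: zero_complex.sel)
    then show False using Rew by simp
  qed
  have pZ: "conj_pair t Z (- U)"
    unfolding conj_pair_def U_u Z_u
    by (rule exI[of _ "- of_int u\<^sub>1 / 2"], rule exI[of _ "of_int u\<^sub>2 / 2"])
       (simp add: of_rat_divide of_rat_minus field_simps)
  have p\<beta>: "conj_pair t \<beta>\<^sub>1 \<beta>\<^sub>2" unfolding conj_pair_def \<beta>\<^sub>1 \<beta>\<^sub>2 by blast
  have s0: "s \<noteq> 0" using t by (simp add: s_def)
  have \<beta>_ne: "\<beta>\<^sub>1 \<noteq> \<beta>\<^sub>2" using b s0 by (simp add: \<beta>\<^sub>1 \<beta>\<^sub>2 s_def)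

  have n0: "n > 0" using n by simp
  note gn = gcd_normalization[OF n0 t u\<^sub>1_nz g\<^sub>1 g\<^sub>2 g\<^sub>3 g\<^sub>4 g]
  have ag: "\<bar>g\<bar> = g" using gn(1) by simp
  have Ug: "algebraic_int (U / of_real g)" unfolding U_u by (rule gn(3))
  have Zg: "algebraic_int (Z / of_real g)" unfolding Z_u by (rule gn(4))
  have "algebraic_int (complex_of_real (of_int u\<^sub>1 / (of_nat d * g)))" using d(2) by (rule algebraic_int_of_real)
  then have dg: "algebraic_int ((U - Z) / (of_nat d * of_real g))" by (simp add: UmZ)
  \<comment> \<open>u1 / (d g) is a nonzero algebraic integer with rational square. This converts
    the growth of D d^r / N into a lower bound for \<open>\<D>\<close> |u1|.\<close>
  have u1_ge: "real d * g \<le> \<bar>real_of_int u\<^sub>1\<bar>"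
  proof -
    define h where "h = (U - Z) / (of_nat d * of_real g)"
    have h: "h = complex_of_real (of_int u\<^sub>1 / (of_nat d * g))" by (simp add: h_def UmZ)
    have "h \<noteq> 0" using d(1) gn(1) u\<^sub>1_nz by (simp add: h_def UmZ)
    moreover have "(of_int u\<^sub>1 / (of_nat d * g)) ^ 2 \<in> \<rat>"
      using gn(2) by (simp add: power_divide power_mult_distrib)
    then have "h ^ 2 \<in> \<rat>" unfolding h of_real_power[symmetric] by (rule complex_of_real_in_Rats)
    ultimately have "1 \<le> norm h" using dg by (intro norm_ge_1_if_square_rational) (simp_all add: h_def)
    also have "norm h = \<bar>real_of_int u\<^sub>1\<bar> / (real d * g)" unfolding h norm_of_real using gn(1) by (simp add: abs_divide abs_mult)
    finally show ?thesis using d(1) gn(1) by (simp add: field_simps)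
  qed

  have ZUw: "Z = U * w ^ 2" using ZW w2 by simp
  have sig: "csqrt (of_int (u\<^sub>2\<^sup>2 * t - u\<^sub>1\<^sup>2)) ^ 2 = 4 * U * Z"
  proof -
    have "4 * U * Z = (U + Z) ^ 2 - (U - Z) ^ 2" by (simp add: power2_eq_square algebra_simps)
    also have "\<dots> = of_int u\<^sub>2 ^ 2 * s ^ 2 - of_int u\<^sub>1 ^ 2" unfolding UpZ UmZ by (simp add: power_mult_distrib)
    also have "s ^ 2 = of_int t" by (simp add: s_def)
    finally show ?thesis by simp
  qed
  have mU: "m = norm U * norm (1 - w) ^ 2" and MU: "M = norm U * norm (1 + w) ^ 2"
    unfolding m M s_def[symmetric] UpZ[symmetric] using norm_root_bounds[OF ZUw sig Rew]
    by (simp_all add: min.commute max.commute)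
  have Upos: "norm U > 0" using U_nz by simp
  have m0: "m > 0" and M0: "M > 0" using Upos w1 w1' by (simp_all add: mU MU)
  \<comment> \<open>Thus |u1| is the geometric mean of \<open>m\<close> and
    \<open>M\<close>.\<close>
  have "U - Z = U * ((1 - w) * (1 + w))" by (simp add: ZUw power2_eq_square algebra_simps)
  then have u1w: "\<bar>real_of_int u\<^sub>1\<bar> = norm U * (norm (1 - w) * norm (1 + w))"
    using UmZ by (metis norm_mult norm_of_int)
  have le_w: "norm (1 - w) \<le> norm (1 + w)"
  proof -
    have "norm (1 - w) ^ 2 \<le> norm (1 + w) ^ 2"
      unfolding cmod_power2 using Rew by (simp add: power2_eq_square algebra_simps)
    then show ?thesis by (rule power2_le_imp_le) simp
  qed
  have uM: "\<bar>real_of_int u\<^sub>1\<bar> \<le> M"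
    unfolding u1w MU power2_eq_square using le_w by (intro mult_left_mono mult_right_mono) auto

  define Nc where "Nc = N_cal d n"
  have Nc: "Nc > 0" unfolding Nc_def by (rule N_cal_pos)
  define Nr where "Nr r = hypN (1 / real n) r" for r
  define S where "S r = real (D_denom n r) / of_int (N_numer d n r)" for r
  have S0: "S r > 0" for r unfolding S_def using D_denom(1)[of n r] N_numer_pos[OF n2, of d r] by simp
  have CDr: "S r \<le> \<C> * (\<D> / Nc) ^ r" "S r * Nr r \<le> \<C> * (\<D> / Nc) ^ r" for r
  proof -
    have "1 * S r \<le> max 1 (max (Gamma (1 - 1 / real n) * fact r / Gamma (real r + 1 - 1 / real n))
                   (real n * Gamma (real r + 1 + 1 / real n) / (Gamma (1 / real n) * fact r))) * S r"
      using S0[of r] by (intro mult_right_mono) auto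
    then show "S r \<le> \<C> * (\<D> / Nc) ^ r" using CD[of r] unfolding Nc_def S_def by linarith
    have "Nr r * S r \<le> max 1 (max (Gamma (1 - 1 / real n) * fact r / Gamma (real r + 1 - 1 / real n))
                   (real n * Gamma (real r + 1 + 1 / real n) / (Gamma (1 / real n) * fact r))) * S r"
      unfolding Nr_def hypN_conv_Gamma[OF n0] using S0[of r] by (intro mult_right_mono) auto
    then show "S r * Nr r \<le> \<C> * (\<D> / Nc) ^ r" using CD[of r] unfolding Nc_def S_def by (simp add: mult.commute)
  qed
  have rho: "14 / 13 \<le> \<D> * real d / Nc"
    unfolding Nc_def using CDr(1) by (intro scaled_growth_rate[OF n d(1) CD_pos(2)]) (simp add: S_def Nc_def)
  then have rho': "14 / 13 * Nc * g \<le> \<D> * (real d * g)"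
    using Nc gn(1) by (simp add: field_simps)
  also have "\<dots> \<le> \<D> * \<bar>real_of_int u\<^sub>1\<bar>" using u1_ge CD_pos(2) by (intro mult_left_mono) auto
  finally have Du: "14 / 13 * Nc * g \<le> \<D> * \<bar>real_of_int u\<^sub>1\<bar>" .
  have E': "E = g * Nc / (\<D> * m)" and Q': "Q = \<D> * M / (g * Nc)" by (simp_all add: E Q ag Nc_def)
  have Em: "\<D> * m < g * Nc" using E_gt CD_pos(2) m0 by (simp add: E' field_simps)
  have Q1: "Q \<ge> 1"
  proof -
    have "0 < Nc * g" using Nc gn(1) by simp
    then have "g * Nc \<le> \<D> * \<bar>real_of_int u\<^sub>1\<bar>" using Du by (simp add: mult_ac)
    also have "\<dots> \<le> \<D> * M" using uM CD_pos(2) by (intro mult_left_mono) auto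
    finally show ?thesis using \<open>0 < Nc * g\<close> by (simp add: Q' mult_ac)
  qed
  \<comment> \<open>E > 1 says that \<open>\<D>\<close> m is less than g N, while \<open>Du\<close>
    says that \<open>\<D>\<close> |u1| is at least 14/13 g N. For real W the quotient |u1| / m is (1
    + v) / (1 - v), which therefore exceeds 14/13.\<close>
  have w27: "1 / 27 \<le> Re w" if Wr: "W \<in> \<real>" "0 < Re W" "Re W < 1"
  proof -
    obtain y where y: "W = of_real y" by (rule Reals_cases[OF Wr(1)])
    have y01: "0 < y" "y < 1" using Wr by (simp_all add: y)
    define v where "v = sqrt y"
    have v: "0 < v" "v < 1" using y01 by (simp_all add: v_def)
    have wv: "w = of_real v" using y01 by (simp add: w_def y v_def)
    have nw: "norm (1 - w) = 1 - v" "norm (1 + w) = 1 + v"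
    proof -
      have "1 - w = of_real (1 - v)" "1 + w = of_real (1 + v)" by (simp_all add: wv)
      then show "norm (1 - w) = 1 - v" "norm (1 + w) = 1 + v" using v by (simp_all only: norm_of_real)
    qed
    have "14 / 13 * Nc * g * (1 - v) \<le> \<D> * \<bar>real_of_int u\<^sub>1\<bar> * (1 - v)"
      using Du v by (intro mult_right_mono) auto
    also have "\<dots> = \<D> * m * (1 + v)" unfolding u1w mU nw by (simp add: power2_eq_square)
    also have "\<dots> < g * Nc * (1 + v)" using Em v by (intro mult_strict_right_mono) auto
    finally have "(Nc * g) * (14 / 13 * (1 - v)) < (Nc * g) * (1 + v)" by (simp add: mult_ac)
    moreover have "Nc * g > 0" using Nc gn(1) by simp
    ultimately have "14 / 13 * (1 - v) < 1 + v" by (simp only: mult_less_cancel_left_pos)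
    then show ?thesis by (simp add: wv)
  qed
  define a\<^sub>n where "a\<^sub>n = 1 / real n"
  have an: "0 < a\<^sub>n" "a\<^sub>n \<le> 1 / 3" using n by (simp_all add: a\<^sub>n_def field_simps)
  have anc: "complex_of_real a\<^sub>n = 1 / of_nat n" by (simp add: a\<^sub>n_def)
  have Wc: "(W \<in> \<real> \<and> 0 < Re W \<and> Re W < 1 \<and> 1 / 27 \<le> Re (csqrt W)) \<or> (cmod W = 1 \<and> W \<noteq> -1)"
    using W_cases w27 by (auto simp: w_def)
  define X where "X r = hypX (1 / of_nat n) r W" for r
  define Y where "Y r = hypY (1 / of_nat n) r W" for r
  have hb: "norm (X r) \<le> 15 / 4 * Nr r * norm (1 + w) ^ (2 * r)"
      "norm (Y r) \<le> 15 / 4 * Nr r * norm (1 + w) ^ (2 * r)"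
      "norm (X r - Wa * Y r) \<le> 5 / 4 * Nr r * norm (1 - Wa) * norm (1 - w) ^ (2 * r)" for r
    using hyp_bounds[OF an Wc, of r] unfolding anc by (simp_all add: X_def Y_def Nr_def w_def Wa_def a\<^sub>n_def)

  have den: "\<xi>2 * Wa - \<xi>1 \<noteq> 0" using A_denom_nz by (simp add: \<xi>1_def \<xi>2_def Wa_def)
  have "A * (\<xi>2 * Wa - \<xi>1) = \<beta>\<^sub>1 * \<xi>2 * Wa - \<beta>\<^sub>2 * \<xi>1"
    using den unfolding A \<xi>1_def \<xi>2_def Wa_def by simp
  \<comment> \<open>\<open>A\<close> is a fractional linear function of \<open>Wa\<close>; solving
    for \<open>Wa\<close> is what later makes X - Wa * Y appear.\<close>
  then have Arel: "(A - \<beta>\<^sub>1) * \<xi>2 * Wa = (A - \<beta>\<^sub>2) * \<xi>1" by (simp add: algebra_simps)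

  define \<delta> where "\<delta> = norm (A - of_int p / of_int q)"
  \<comment> \<open>With \<tau> = 4 sqrt |2t|, the product \<tau> L E is the second entry of the
    maximum in \<open>c\<close>, as 4 * 5/4 = 5.\<close>
  define L where "L = 5 / 4 * \<C> * norm (1 - Wa) * norm \<xi>2 * norm (A - \<beta>\<^sub>1)"
  define B where "B = (norm \<xi>1 + norm \<xi>2) * \<C>"
  define \<alpha> where "\<alpha> = (of_int q * \<beta>\<^sub>1 - of_int p) * \<xi>2"
  define \<alpha>' where "\<alpha>' = (of_int q * \<beta>\<^sub>2 - of_int p) * \<xi>1"
  have q1: "1 \<le> real_of_int \<bar>q\<bar>" using q0 by linarith
  have key: "1 \<le> real_of_int \<bar>q\<bar> * (L / E ^ r) + 15 / 4 * B * Q ^ r * real_of_int \<bar>q\<bar> * \<delta>"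
    if nz: "\<alpha> * X r \<noteq> \<alpha>' * Y r" for r
  proof -
    define F where "F = \<alpha> * X r - \<alpha>' * Y r"
    define R where "R = \<xi>2 * X r - \<xi>1 * Y r"
    have "1 \<le> S r * (norm U / g) ^ r * norm F"
      unfolding S_def F_def \<alpha>_def \<alpha>'_def X_def Y_def \<xi>1_def \<xi>2_def ZUW[symmetric]
    proof (rule norm_scaled_form_ge_1[OF n2 d(1) U_nz Z_nz gn(1,2) Ug Zg dg \<beta>_int p\<beta> pZ])
      show "(of_int q * \<beta>\<^sub>1 - of_int p) * (of_int x - \<beta>\<^sub>2) * hypX (1 / of_nat n) r (Z / U) -
        (of_int q * \<beta>\<^sub>2 - of_int p) * (of_int x - \<beta>\<^sub>1) * hypY (1 / of_nat n) r (Z / U) \<noteq> 0"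
        using nz by (simp add: \<alpha>_def \<alpha>'_def X_def Y_def \<xi>1_def \<xi>2_def ZUW)
    qed
    moreover have "norm F \<le> real_of_int \<bar>q\<bar> * (\<delta> * norm R) + real_of_int \<bar>q\<bar> * (norm (A - \<beta>\<^sub>1) * norm \<xi>2 * norm (X r - Wa * Y r))"
    proof -
      define V where "V = (A - \<beta>\<^sub>1) * \<xi>2 * (X r - Wa * Y r)"
      \<comment> \<open>Writing p as q A minus an error splits \<open>F\<close>: \<open>R\<close>
        carries the distance of A from p / q, and \<open>V\<close> the Pade remainder.\<close>
      have "F = of_int q * (\<beta>\<^sub>1 * \<xi>2 * X r - \<beta>\<^sub>2 * \<xi>1 * Y r) - of_int p * R"
        by (simp add: F_def \<alpha>_def \<alpha>'_def R_def algebra_simps)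
      also have "\<beta>\<^sub>1 * \<xi>2 * X r - \<beta>\<^sub>2 * \<xi>1 * Y r = A * R - (A - \<beta>\<^sub>1) * \<xi>2 * X r + (A - \<beta>\<^sub>2) * \<xi>1 * Y r"
        by (simp add: R_def algebra_simps)
      also have "\<dots> = A * R - V"
        unfolding Arel[symmetric] V_def by (simp add: algebra_simps)
      finally have "F = of_int q * (A * R - V) - of_int p * R" .
      moreover have "of_int q * ((A - of_int p / of_int q) * R) = of_int q * (A * R) - of_int p * R"
        using q0 by (simp add: field_simps)
      ultimately have "F = of_int q * ((A - of_int p / of_int q) * R) - of_int q * V"
        by (simp add: right_diff_distrib)
      then have "norm F \<le> norm (of_int q * ((A - of_int p / of_int q) * R)) + norm (of_int q * V)"
        by (simp only: norm_triangle_ineq4)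
      then show ?thesis by (simp add: norm_mult \<delta>_def V_def)
    qed
    moreover have "norm R \<le> (norm \<xi>1 + norm \<xi>2) * (15 / 4 * Nr r * norm (1 + w) ^ (2 * r))"
    proof -
      have "norm R \<le> norm (\<xi>2 * X r) + norm (\<xi>1 * Y r)" unfolding R_def by (rule norm_triangle_ineq4)
      also have "\<dots> \<le> norm \<xi>2 * (15 / 4 * Nr r * norm (1 + w) ^ (2 * r)) + norm \<xi>1 * (15 / 4 * Nr r * norm (1 + w) ^ (2 * r))"
        unfolding norm_mult by (intro add_mono mult_left_mono hb) auto
      finally show ?thesis by (simp add: algebra_simps)
    qed
    moreover have SU: "0 \<le> S r * (norm U / g) ^ r" using S0[of r] gn(1) by simp
    moreover have \<delta>0: "0 \<le> \<delta>" by (simp add: \<delta>_def)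
    ultimately have k1: "1 \<le> S r * (norm U / g) ^ r * (real_of_int \<bar>q\<bar> * (\<delta> * ((norm \<xi>1 + norm \<xi>2) * (15 / 4 * Nr r * norm (1 + w) ^ (2 * r))))
        + real_of_int \<bar>q\<bar> * (norm (A - \<beta>\<^sub>1) * norm \<xi>2 * (5 / 4 * Nr r * norm (1 - Wa) * norm (1 - w) ^ (2 * r))))"
    proof -
      assume 1: "1 \<le> S r * (norm U / g) ^ r * norm F"
        and 2: "norm F \<le> real_of_int \<bar>q\<bar> * (\<delta> * norm R) + real_of_int \<bar>q\<bar> * (norm (A - \<beta>\<^sub>1) * norm \<xi>2 * norm (X r - Wa * Y r))"
        and 3: "norm R \<le> (norm \<xi>1 + norm \<xi>2) * (15 / 4 * Nr r * norm (1 + w) ^ (2 * r))"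
      have "real_of_int \<bar>q\<bar> * (\<delta> * norm R) + real_of_int \<bar>q\<bar> * (norm (A - \<beta>\<^sub>1) * norm \<xi>2 * norm (X r - Wa * Y r))
        \<le> real_of_int \<bar>q\<bar> * (\<delta> * ((norm \<xi>1 + norm \<xi>2) * (15 / 4 * Nr r * norm (1 + w) ^ (2 * r))))
        + real_of_int \<bar>q\<bar> * (norm (A - \<beta>\<^sub>1) * norm \<xi>2 * (5 / 4 * Nr r * norm (1 - Wa) * norm (1 - w) ^ (2 * r)))"
        using \<delta>0 q1 3 hb(3)[of r] by (intro add_mono mult_left_mono) auto
      with 2 have "norm F \<le> real_of_int \<bar>q\<bar> * (\<delta> * ((norm \<xi>1 + norm \<xi>2) * (15 / 4 * Nr r * norm (1 + w) ^ (2 * r))))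
        + real_of_int \<bar>q\<bar> * (norm (A - \<beta>\<^sub>1) * norm \<xi>2 * (5 / 4 * Nr r * norm (1 - Wa) * norm (1 - w) ^ (2 * r)))"
        by (rule order_trans)
      then show ?thesis using 1 mult_left_mono[OF _ SU] order_trans by blast
    qed
    have pow: "(norm U / g) ^ r * norm (1 + w) ^ (2 * r) = (M / g) ^ r" "(norm U / g) ^ r * norm (1 - w) ^ (2 * r) = (m / g) ^ r"
      unfolding MU mU power_mult by (simp_all add: power_mult_distrib[symmetric])
    have scaled: "S r * Nr r * (y / g) ^ r \<le> \<C> * (\<D> * y / (g * Nc)) ^ r" if "y > 0" for y
    proof -
      have "S r * Nr r * (y / g) ^ r \<le> \<C> * (\<D> / Nc) ^ r * (y / g) ^ r"
        using CDr(2)[of r] that gn(1) by (intro mult_right_mono) auto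
      also have "\<dots> = \<C> * (\<D> / Nc * (y / g)) ^ r" by (simp only: power_mult_distrib mult.assoc)
      finally show ?thesis by (simp add: mult_ac)
    qed
    have "\<D> * m / (g * Nc) = 1 / E" by (simp add: E')
    then have b1: "S r * Nr r * (M / g) ^ r \<le> \<C> * Q ^ r" and b2: "S r * Nr r * (m / g) ^ r \<le> \<C> / E ^ r"
      using scaled[OF M0] scaled[OF m0] by (simp_all add: Q' power_one_over)
    note k1
    also have "S r * (norm U / g) ^ r * (real_of_int \<bar>q\<bar> * (\<delta> * ((norm \<xi>1 + norm \<xi>2) * (15 / 4 * Nr r * norm (1 + w) ^ (2 * r))))
        + real_of_int \<bar>q\<bar> * (norm (A - \<beta>\<^sub>1) * norm \<xi>2 * (5 / 4 * Nr r * norm (1 - Wa) * norm (1 - w) ^ (2 * r))))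
      = real_of_int \<bar>q\<bar> * \<delta> * (norm \<xi>1 + norm \<xi>2) * (15 / 4) * (S r * Nr r * ((norm U / g) ^ r * norm (1 + w) ^ (2 * r)))
        + real_of_int \<bar>q\<bar> * (norm (A - \<beta>\<^sub>1) * norm \<xi>2 * norm (1 - Wa) * (5 / 4)) * (S r * Nr r * ((norm U / g) ^ r * norm (1 - w) ^ (2 * r)))"
      by (simp add: algebra_simps)
    also have "\<dots> \<le> real_of_int \<bar>q\<bar> * \<delta> * (norm \<xi>1 + norm \<xi>2) * (15 / 4) * (\<C> * Q ^ r)
        + real_of_int \<bar>q\<bar> * (norm (A - \<beta>\<^sub>1) * norm \<xi>2 * norm (1 - Wa) * (5 / 4)) * (\<C> / E ^ r)"
      unfolding pow using \<delta>0 q1 by (intro add_mono mult_left_mono b1 b2) auto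
    also have "\<dots> = real_of_int \<bar>q\<bar> * (L / E ^ r) + 15 / 4 * B * Q ^ r * real_of_int \<bar>q\<bar> * \<delta>"
      by (simp add: L_def B_def algebra_simps)
    finally show ?thesis .
  qed
  \<comment> \<open>If \<open>t\<close> is a square, one of the two may vanish, but not both, since
    \<open>\<beta>\<^sub>1\<close> and \<open>\<beta>\<^sub>2\<close> differ.\<close>
  have \<alpha>nz: "\<alpha> \<noteq> 0 \<or> \<alpha>' \<noteq> 0"
  proof (rule ccontr)
    assume "\<not> ?thesis"
    then have "of_int q * \<beta>\<^sub>1 = of_int p" "of_int q * \<beta>\<^sub>2 = of_int p"
      using \<xi>1_nz \<xi>2_nz by (auto simp: \<alpha>_def \<alpha>'_def)
    then have "of_int q * \<beta>\<^sub>1 = of_int q * \<beta>\<^sub>2" by simp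
    then show False using q0 \<beta>_ne by simp
  qed
  have alt: "\<alpha> * X r \<noteq> \<alpha>' * Y r \<or> \<alpha> * X (Suc r) \<noteq> \<alpha>' * Y (Suc r)" for r
    unfolding X_def Y_def by (rule approximation_nonzero[OF n2 W1 \<alpha>nz])
  define \<tau> where "\<tau> = 4 * sqrt \<bar>2 * real_of_int t\<bar>"
  \<comment> \<open>6/5 < sqrt 2, and 4 * 6/5 = 24/5 exceeds 19/4 = 1 + 15/4.\<close>
  have \<tau>: "\<tau> > 19 / 4"
  proof -
    have "2 \<le> \<bar>2 * real_of_int t\<bar>" using t by linarith
    then have "(6 / 5) ^ 2 \<le> \<bar>2 * real_of_int t\<bar>" by (simp add: power2_eq_square)
    then have "6 / 5 \<le> sqrt \<bar>2 * real_of_int t\<bar>" by (rule real_le_rsqrt)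
    then show ?thesis by (simp add: \<tau>_def)
  qed
  have L0: "L \<ge> 0" using CD_pos by (simp add: L_def)
  have B0: "B > 0" using CD_pos \<xi>1_nz by (simp add: B_def add_pos_nonneg)
  have "1 / (\<tau> * B * Q * max 1 (\<tau> * L * E) powr \<kappa> * real_of_int \<bar>q\<bar> powr (\<kappa> + 1)) < \<delta>"
    by (rule gap_principle[where P = "\<lambda>r. \<alpha> * X r \<noteq> \<alpha>' * Y r", OF E_gt Q1 \<kappa> L0 B0 \<tau> q1 alt key])
  moreover have "\<tau> * B * Q * max 1 (\<tau> * L * E) powr \<kappa> = c"
  proof -
    have e: "\<tau> * L * E = 5 * sqrt \<bar>2 * of_int t\<bar> * norm (1 - Wa) * norm \<xi>2 * norm (A - \<beta>\<^sub>1) * \<C> * E"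
      by (simp add: \<tau>_def L_def)
    show ?thesis unfolding c e unfolding \<tau>_def B_def \<xi>1_def \<xi>2_def Wa_def by (simp only: mult.assoc)
  qed
  ultimately show "cmod (A - of_int p / of_int q) > 1 / (c * real_of_int \<bar>q\<bar> powr (\<kappa> + 1))"
    by (simp add: \<delta>_def)
qed


end
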